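(* Let $\delta_n\in(0,1]$ and $0<c_n<\sqrt{24}<C_n$, and let $\alpha\in(0,1)$. All limits are as $n\to\infty$. (a) Let $I_n$ be a bounded open interval and $f_n$ a density in $\mathcal{F}\bigl(I_n,\delta_n,C_n\sqrt{\log(e/\delta_n)/n}\bigr)$. Then $$\mathbb{P}_{f_n}\bigl(\mathcal{D}^+(\alpha)\text{ contains an interval }J\subset I_n\bigr)\to 1,$$ provided that $(C_n-\sqrt{24})\sqrt{\log(e/\delta_n)}\to\infty$. (b) Let $\phi_n(\mathbf{X})$ be any test with level $\alpha\in(0,1)$ under the null hypothesis that $\mathbf{X}$ is drawn from a nonincreasing density. If $(\log n)^2/n\le\delta_n\to0$, then $$\inf_{f\in\mathcal{F}(\delta_n,\,c_n\sqrt{\log(e/\delta_n)/n})}\mathbb{E}_f\phi_n(\mathbf{X})\le\alpha+o(1),$$ provided that $(\sqrt{24}-c_n)\sqrt{\log(e/\delta_n)}\to\infty$. (c) Let $I_n$ be any bounded open interval and $b_n$ some number in $[0,2\sqrt{n\delta_n}]$. If $\phi_n(\mathbf{X})$ is any test with level $\alpha\in(0,1)$ under the null hypothesis that the density is nonincreasing on $I_n$, then $$\inf_{f\in\mathcal{F}(I_n,\delta_n,b_n/\sqrt n)}\mathbb{E}_f\phi_n(\mathbf{X})\to1$$ implies that $b_n\to\infty$ and $n\delta_n\to\infty$.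
   Context: Data: $Y_1,\ldots,Y_m$ are independent with common distribution function $F$ and Lebesgue density $f$ on $\mathbb{R}$; $\mathbb{P}_f,\mathbb{E}_f$ denote probability and expectation when the density is $f$. If $F$ is known to be supported by $[a,\infty)$, $(-\infty,b]$ or $[a,b]$, one adds $a$, $b$, or both, respectively, to the order statistics $Y_{(1)}<\cdots<Y_{(m)}$. The resulting ordered vector is relabelled $\mathbf{X}=(X_{(i)})_{i=0}^{n+1}$, $X_{(0)}<\cdots<X_{(n+1)}$, so $n\in\{m-2,m-1,m\}$. Write $\mathcal{I}_{jk}:=(X_{(j)},X_{(k)})$. Let $\beta(x):=1\{x\in(0,1)\}(2x-1)$, $\Gamma(\delta):=(2\log(e/\delta))^{1/2}$, and for a vector $\mathbf{V}=(V_{(i)})_{i=0}^{n+1}$ with strictly increasing components and $0\le j<k\le n+1$, $k-j>1$, $$T_{jk}(\mathbf{V}):=\sum_{i=j+1}^{k-1}\beta\left(\frac{V_{(i)}-V_{(j)}}{V_{(k)}-V_{(j)}}\right),\qquad T_n(\mathbf{V}):=\max_{j,k:\,k-j>1}\left(\sqrt{\tfrac{3}{k-j-1}}|T_{jk}(\mathbf{V})|-\Gamma\left(\tfrac{k-j}{n+1}\right)\right).$$ Let $\mathbf{U}=(U_{(i)})_{i=0}^{n+1}$ with $U_{(0)}=0$, $U_{(n+1)}=1$ and $U_{(1)}<\cdots<U_{(n)}$ the order statistics of $n$ i.i.d. uniform variables on $[0,1]$. Let $\kappa_n(\alpha)$ be the $(1-\alpha)$-quantile of the distribution of $T_n(\mathbf{U})$,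 and $$c_{jk}(\alpha):=\sqrt{\tfrac{k-j-1}{3}}\left(\Gamma\left(\tfrac{k-j}{n+1}\right)+\kappa_n(\alpha)\right),\qquad \mathcal{D}^{+}(\alpha):=\{\mathcal{I}_{jk}: k-j>1,\ T_{jk}(\mathbf{X})>c_{jk}(\alpha)\}.$$ For a bounded open interval $I\subset\mathbb{R}$ of length $|I|$ let $$\inf_I f':=\inf_{x,y\in I:\,x<y}\frac{f(y)-f(x)}{y-x},\qquad H(f,I):=\inf_I f'\cdot|I|^2/\sqrt{F(I)},$$ where $F(I)=\int_I f(x)\,dx$. For $\delta\in(0,1]$ and $\eta\in\mathbb{R}$, let $\mathcal{F}(I,\delta,\eta):=\{f:\ F(I)=\delta,\ H(f,I)\ge\eta\}$ (over probability densities $f$ on $\mathbb{R}$) and $\mathcal{F}(\delta,\eta):=\bigcup_{I}\mathcal{F}(I,\delta,\eta)$, the union being over all bounded open intervals $I$. A test $\phi_n(\mathbf{X})$ is a measurable function of $\mathbf{X}$ with values in $[0,1]$; it has level $\alpha$ under a null hypothesis if $\mathbb{E}_f\phi_n(\mathbf{X})\le\alpha$ for every density $f$ in the null hypothesis.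
   Formalization: In (b) "nonincreasing density" means nonincreasing to the right of its left end point (a if known, else arbitrary), as none is nonincreasing on all of R; in (c) "nonincreasing on I_n" is required only inside the known support, since (c) can fail if I_n extends beyond a. *)

theory Defs
  imports "HOL-Probability.Probability"
begin

text \<open>
  Prior knowledge on the support of \<open>F\<close> is encoded by \<open>a < b\<close> in the extended reals:
  \<open>F\<close> is known to be supported by \<open>{x. a \<le> x \<le> b}\<close>, and \<open>a = -\<infinity>\<close> (\<open>b = \<infinity>\<close>) means that no lower
  (upper) bound is known.  The parameter \<open>n\<close> is fixed first; the number of observations is then
  \<open>m = n\<close>, \<open>n + 1\<close> or \<open>n + 2\<close>, such that the vector \<open>X\<close>, including the known finite
  end points, has \<open>n + 2\<close> components.
\<close>

definition sample_size :: "ereal \<Rightarrow> ereal \<Rightarrow> nat \<Rightarrow> nat" where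
  "sample_size a b n = n + (if a = -\<infinity> then 1 else 0) + (if b = \<infinity> then 1 else 0)"

text \<open>The model: Lebesgue densities of distributions supported by the known set.\<close>

definition densities :: "ereal \<Rightarrow> ereal \<Rightarrow> (real \<Rightarrow> real) set" where
  "densities a b = {f. f \<in> borel_measurable lborel \<and> (\<forall>x. 0 \<le> f x) \<and>
     (\<integral>\<^sup>+ x. ennreal (f x) \<partial>lborel) = 1 \<and>
     (AE x in lborel. \<not> (a \<le> ereal x \<and> ereal x \<le> b) \<longrightarrow> f x = 0)}"

definition sample_law :: "ereal \<Rightarrow> ereal \<Rightarrow> nat \<Rightarrow> (real \<Rightarrow> real) \<Rightarrow> (nat \<Rightarrow> real) measure" where
  "sample_law a b n f =
     (\<Pi>\<^sub>M i\<in>{..<sample_size a b n}. density lborel (\<lambda>x. ennreal (f x)))"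

definition ordered_vector :: "ereal \<Rightarrow> ereal \<Rightarrow> nat \<Rightarrow> (nat \<Rightarrow> real) \<Rightarrow> nat \<Rightarrow> real" where
  "ordered_vector a b n y =
     (\<lambda>i\<in>{..n+1}. sort ((if a = -\<infinity> then [] else [real_of_ereal a])
        @ map y [0..<sample_size a b n]
        @ (if b = \<infinity> then [] else [real_of_ereal b])) ! i)"

definition score :: "real \<Rightarrow> real" where
  "score x = indicator {0<..<1} x * (2 * x - 1)"

definition pen :: "real \<Rightarrow> real" where
  "pen \<delta> = sqrt (2 * ln (exp 1 / \<delta>))"

definition T_loc :: "nat \<Rightarrow> nat \<Rightarrow> (nat \<Rightarrow> real) \<Rightarrow> real" where
  "T_loc j k V = (\<Sum>i=j+1..k-1. score ((V i - V j) / (V k - V j)))"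

definition T_max :: "nat \<Rightarrow> (nat \<Rightarrow> real) \<Rightarrow> real" where
  "T_max n V = Max ((\<lambda>(j,k). sqrt (3 / (real k - real j - 1)) * \<bar>T_loc j k V\<bar>
                        - pen ((real k - real j) / (real n + 1)))
                   ` {(j,k). j + 1 < k \<and> k \<le> n + 1})"

text \<open>
  The vector \<open>U\<close> is the ordered vector of an \<open>n\<close>-sample from the uniform density with known
  support \<open>[0,1]\<close>.
\<close>

definition kappa :: "nat \<Rightarrow> real \<Rightarrow> real" where
  "kappa n \<alpha> = Inf {x. 1 - \<alpha> \<le> measure (sample_law 0 1 n (indicator {0..1}))
     {u \<in> space (sample_law 0 1 n (indicator {0..1})). T_max n (ordered_vector 0 1 n u) \<le> x}}"

definition crit :: "nat \<Rightarrow> real \<Rightarrow> nat \<Rightarrow> nat \<Rightarrow> real" where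
  "crit n \<alpha> j k = sqrt ((real k - real j - 1) / 3)
     * (pen ((real k - real j) / (real n + 1)) + kappa n \<alpha>)"

definition D_plus :: "nat \<Rightarrow> real \<Rightarrow> (nat \<Rightarrow> real) \<Rightarrow> real set set" where
  "D_plus n \<alpha> X = {{X j<..<X k} | j k. j + 1 < k \<and> k \<le> n + 1 \<and> T_loc j k X > crit n \<alpha> j k}"

definition bounded_open_intervals :: "real set set" where
  "bounded_open_intervals = {{l<..<r} | l r. l < r}"

definition mass :: "(real \<Rightarrow> real) \<Rightarrow> real set \<Rightarrow> real" where
  "mass f I = (LINT x:I|lborel. f x)"

text \<open>The infimum of the difference quotients may be \<open>-\<infinity>\<close>, hence the extended reals.\<close>

definition inf_slope :: "(real \<Rightarrow> real) \<Rightarrow> real set \<Rightarrow> ereal" where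
  "inf_slope f I = (INF (x,y)\<in>{(x,y). x \<in> I \<and> y \<in> I \<and> x < y}. ereal ((f y - f x) / (y - x)))"

definition H :: "(real \<Rightarrow> real) \<Rightarrow> real set \<Rightarrow> ereal" where
  "H f I = inf_slope f I * ereal ((measure lborel I)\<^sup>2 / sqrt (mass f I))"

definition F_class :: "ereal \<Rightarrow> ereal \<Rightarrow> real set \<Rightarrow> real \<Rightarrow> real \<Rightarrow> (real \<Rightarrow> real) set" where
  "F_class a b I \<delta> \<eta> = {f \<in> densities a b. mass f I = \<delta> \<and> H f I \<ge> ereal \<eta>}"

definition F_union :: "ereal \<Rightarrow> ereal \<Rightarrow> real \<Rightarrow> real \<Rightarrow> (real \<Rightarrow> real) set" where
  "F_union a b \<delta> \<eta> = (\<Union>I\<in>bounded_open_intervals. F_class a b I \<delta> \<eta>)"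

text \<open>
  A density cannot be nonincreasing on the whole line.  As usual, a nonincreasing density is
  nonincreasing to the right of its left end point \<open>c\<close> (and up to the known upper bound, if any);
  if a lower bound \<open>a\<close> is known, then \<open>c = a\<close>, and otherwise \<open>c\<close> is an arbitrary unknown real
  number.  The end point itself is excluded, so that \<open>f\<close> may be unbounded near \<open>c\<close>.
\<close>

definition nonincreasing_densities :: "ereal \<Rightarrow> ereal \<Rightarrow> (real \<Rightarrow> real) set" where
  "nonincreasing_densities a b = {f. \<exists>c::real. (a = -\<infinity> \<or> a = ereal c) \<and>
     f \<in> densities (ereal c) b \<and> antimono_on {x. c < x \<and> ereal x < b} f}"

text \<open>
  Monotonicity on \<open>I\<close> is only required inside the known support, which matters only if \<open>I\<close> exceeds
  it: a density vanishing to the left of \<open>a\<close> could otherwise not charge an interval \<open>I\<close> around \<open>a\<close>.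
\<close>

definition nonincreasing_densities_on :: "ereal \<Rightarrow> ereal \<Rightarrow> real set \<Rightarrow> (real \<Rightarrow> real) set" where
  "nonincreasing_densities_on a b I =
     {f \<in> densities a b. antimono_on {x \<in> I. a < ereal x \<and> ereal x < b} f}"

definition is_test :: "nat \<Rightarrow> ((nat \<Rightarrow> real) \<Rightarrow> real) \<Rightarrow> bool" where
  "is_test n \<phi> \<longleftrightarrow> \<phi> \<in> borel_measurable (\<Pi>\<^sub>M i\<in>{..n+1}. borel) \<and>
     (\<forall>x \<in> space (\<Pi>\<^sub>M i\<in>{..n+1}. borel). 0 \<le> \<phi> x \<and> \<phi> x \<le> 1)"

definition expect_test ::
  "ereal \<Rightarrow> ereal \<Rightarrow> nat \<Rightarrow> ((nat \<Rightarrow> real) \<Rightarrow> real) \<Rightarrow> (real \<Rightarrow> real) \<Rightarrow> real" where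
  "expect_test a b n \<phi> f = (LINT y|sample_law a b n f. \<phi> (ordered_vector a b n y))"

definition level_test ::
  "ereal \<Rightarrow> ereal \<Rightarrow> nat \<Rightarrow> real \<Rightarrow> (real \<Rightarrow> real) set \<Rightarrow> ((nat \<Rightarrow> real) \<Rightarrow> real) \<Rightarrow> bool" where
  "level_test a b n \<alpha> null \<phi> \<longleftrightarrow>
     is_test n \<phi> \<and> (\<forall>f\<in>null. expect_test a b n \<phi> f \<le> \<alpha>)"

text \<open>
  The infimum over an empty class is \<open>\<infinity>\<close>; it is neither \<open>\<le> \<alpha>\<close> nor close to \<open>1\<close>.
\<close>

definition min_power ::
  "ereal \<Rightarrow> ereal \<Rightarrow> nat \<Rightarrow> ((nat \<Rightarrow> real) \<Rightarrow> real) \<Rightarrow> (real \<Rightarrow> real) set \<Rightarrow> ereal" where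
  "min_power a b n \<phi> A = (INF f\<in>A. ereal (expect_test a b n \<phi> f))"

end

theory Submission
  imports Defs "HOL-Real_Asymp.Real_Asymp"
begin

text \<open>
  Three independent arguments carry the three claims.

  Consistency. On an interval \<open>I\<close> of mass \<open>\<delta>\<close> with density slope at least \<open>\<sigma>\<close>, write \<open>h = \<sigma> |I|\<^sup>2 / \<delta>\<close>.
  The local statistic of the extreme order statistics in \<open>I\<close> is an affine function of two sums of
  independent variables, the number of observations in \<open>I\<close> and the sum of their centred positions, so
  Chebyshev's inequality shows that it is at least \<open>n \<delta> h / 6\<close> up to \<open>O(sqrt (n \<delta>))\<close>
  (\<open>score_moment\<close>, \<open>detection_bound\<close>). Its critical value is \<open>sqrt (n \<delta> / 3)\<close> times
  \<open>sqrt (2 log (e/\<delta>))\<close> plus \<open>O(sqrt (n \<delta>))\<close>, provided that \<open>kappa n \<alpha>\<close> stays bounded. The leading terms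
  agree exactly when \<open>h = sqrt (24 log (e/\<delta>) / (n \<delta>))\<close>, which is where the constant comes from.

  Boundedness of \<open>kappa n \<alpha>\<close> (\<open>kappa_bounded\<close>) is the hardest step. For uniform variables each
  local statistic has at most the exponential moments that bound a centred sum of independent uniform variables
  (\<open>T_loc_mgf\<close>), hence subgaussian tails. The penalty pays for a union bound only over a sparse
  collection of index pairs. Therefore all short pairs are used (their number is too small to
  matter), but long pairs only on dyadic grids. The remaining pairs are handled by a deterministic
  argument: control of the statistics on the grid forces the order statistics to stay close to
  equidistant, and then every local statistic is close to one on the grid
  (\<open>multiscale_extension\<close>).

  Optimality. The uniform density on an interval is nonincreasing. Tilting it linearly on one of about
  \<open>1/\<delta>\<close> disjoint cells of mass \<open>\<delta>\<close> gives alternatives whose likelihood ratios are uncorrelated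
  under the uniform density. If \<open>h\<^sup>2 \<delta>\<close>, with \<open>h\<close> the relative slope of the tilt, is too small compared with \<open>24 log (e/\<delta>) / n\<close>, each log likelihood ratio
  stays well below \<open>log (1/\<delta>)\<close> with high probability, so the average of the truncated likelihood ratios concentrates at
  \<open>1\<close> and no test distinguishes their mixture from the null density (\<open>mixture_power_bound\<close>,
  \<open>likelihood_tail\<close>).

  Necessity. If \<open>b_n\<close> is bounded along a subsequence, then on \<open>I_n\<close> an alternative that is linear there
  is contiguous to the null density that is constant there: \<open>E_0 (1 / sqrt L)\<close> is bounded for the likelihood
  ratio \<open>L\<close> (\<open>contiguity_bound\<close>), so the power stays away from \<open>1\<close>. Since \<open>b_n \<le> 2 sqrt (n \<delta>_n)\<close>, divergence of
  \<open>b_n\<close> entails divergence of \<open>n \<delta>_n\<close>.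
\<close>

section \<open>The ordered sample\<close>

definition law :: "(real \<Rightarrow> real) \<Rightarrow> real measure" where
  "law f = density lborel (\<lambda>x. ennreal (f x))"

text \<open>
  The unsorted list behind \<open>ordered_vector\<close>: sums over it do not depend on the order, which gives
  access to the independence of the observations.
\<close>

definition points :: "ereal \<Rightarrow> ereal \<Rightarrow> nat \<Rightarrow> (nat \<Rightarrow> real) \<Rightarrow> real list" where
  "points a b n y = (if a = -\<infinity> then [] else [real_of_ereal a])
        @ map y [0..<sample_size a b n]
        @ (if b = \<infinity> then [] else [real_of_ereal b])"

lemma length_points: "length (points a b n y) = n + 2"
  by (auto simp: points_def sample_size_def)

lemma ordered_vector_eq: "i \<le> n + 1 \<Longrightarrow> ordered_vector a b n y i = sort (points a b n y) ! i"
  by (simp add: ordered_vector_def points_def)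

lemma sample_law_eq: "sample_law a b n f = PiM {..<sample_size a b n} (\<lambda>_. law f)"
  by (simp add: sample_law_def law_def)

lemma sets_law [measurable_cong, simp]: "sets (law f) = sets borel"
  by (simp add: law_def)

lemma space_law [simp]: "space (law f) = UNIV"
  by (simp add: law_def)

lemma sets_sample_law [measurable_cong]:
  "sets (sample_law a b n f) = sets (PiM {..<sample_size a b n} (\<lambda>_. borel))"
  unfolding sample_law_eq by (intro sets_PiM_cong) auto

lemma densitiesD:
  assumes "f \<in> densities a b"
  shows "f \<in> borel_measurable borel" "0 \<le> f x" "(\<integral>\<^sup>+ x. ennreal (f x) \<partial>lborel) = 1"
    "AE x in lborel. \<not> (a \<le> ereal x \<and> ereal x \<le> b) \<longrightarrow> f x = 0"
  using assms by (auto simp: densities_def)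

lemma prob_space_law: "f \<in> densities a b \<Longrightarrow> prob_space (law f)"
  unfolding law_def using densitiesD[of f a b]
  by (intro prob_spaceI) (simp add: emeasure_density)

lemma prob_space_sample_law: "f \<in> densities a b \<Longrightarrow> prob_space (sample_law a' b' n f)"
  unfolding sample_law_eq by (intro prob_space_PiM prob_space_law)

text \<open>
  Measurability of order statistics rests on this: they are determined by counts of observations,
  which are sums of measurable functions.
\<close>

lemma nth_sort_le_iff:
  assumes "i < length xs"
  shows "sort xs ! i \<le> (t::real) \<longleftrightarrow> i < length (filter (\<lambda>x. x \<le> t) xs)"
proof -
  have main: "sorted ys \<Longrightarrow> i < length ys \<Longrightarrow> ys ! i \<le> t \<longleftrightarrow> i < length (filter (\<lambda>x. x \<le> t) ys)" for ys i
  proof (induction ys arbitrary: i)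
    case (Cons z zs)
    show ?case
    proof (cases "z \<le> t")
      case True
      then show ?thesis using Cons by (cases i) auto
    next
      case False
      then have "filter (\<lambda>x. x \<le> t) zs = []" using Cons.prems(1) by (auto simp: filter_empty_conv)
      moreover have "z \<le> (z # zs) ! i" using Cons.prems sorted_nth_mono[of "z # zs" 0 i] by auto
      ultimately show ?thesis using False by auto
    qed
  qed simp
  have "length (filter (\<lambda>x. x \<le> t) (sort xs)) = length (filter (\<lambda>x. x \<le> t) xs)"
    by (metis mset_filter mset_sort size_mset)
  then show ?thesis using main[of "sort xs" i] assms by simp
qed

lemma length_filter_points:
  "real (length (filter P (points a b n y))) =
    of_bool (a \<noteq> -\<infinity> \<and> P (real_of_ereal a)) + (\<Sum>i<sample_size a b n. of_bool (P (y i)))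
      + of_bool (b \<noteq> \<infinity> \<and> P (real_of_ereal b))"
proof -
  have "real (length (filter P (map y [0..<m]))) = (\<Sum>i<m. of_bool (P (y i)))" for m
    by (induction m) auto
  then show ?thesis unfolding points_def by simp
qed

lemma measurable_ordered_vector_component [measurable]:
  assumes "i \<le> n + 1"
  shows "(\<lambda>y. ordered_vector a b n y i) \<in> borel_measurable (PiM {..<sample_size a b n} (\<lambda>_. borel))"
proof (rule borel_measurable_iff_le[THEN iffD2], rule allI)
  fix t
  let ?M = "PiM {..<sample_size a b n} (\<lambda>_. borel)"
  have [simp]: "i < n + 2" using assms by auto
  define c d where "c = (of_bool (a \<noteq> -\<infinity> \<and> real_of_ereal a \<le> t) :: real)"
    and "d = (of_bool (b \<noteq> \<infinity> \<and> real_of_ereal b \<le> t) :: real)"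
  have eq: "ordered_vector a b n y i \<le> t \<longleftrightarrow> real i < c + (\<Sum>i<sample_size a b n. indicator {..t} (y i)) + d" for y
    unfolding ordered_vector_eq[OF assms] nth_sort_le_iff[of i "points a b n y", unfolded length_points, OF \<open>i < n + 2\<close>]
    unfolding of_nat_less_iff[where 'a=real, symmetric] length_filter_points c_def d_def indicator_def atMost_iff ..
  have "{y \<in> space ?M. ordered_vector a b n y i \<le> t}
    = {y \<in> space ?M. real i < c + (\<Sum>i<sample_size a b n. indicator {..t} (y i)) + d}"
    unfolding eq ..
  also have "\<dots> \<in> sets ?M" by measurable
  finally show "{y \<in> space ?M. ordered_vector a b n y i \<le> t} \<in> sets ?M" .
qed

lemma measurable_ordered_vector [measurable]:
  "ordered_vector a b n \<in> measurable (PiM {..<sample_size a b n} (\<lambda>_. borel)) (PiM {..n+1} (\<lambda>_. borel))"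
proof -
  have 1: "ordered_vector a b n = (\<lambda>y. \<lambda>i\<in>{..n+1}. ordered_vector a b n y i)"
    by (auto simp: ordered_vector_def fun_eq_iff restrict_def)
  show ?thesis
    by (subst 1, intro measurable_restrict measurable_ordered_vector_component) auto
qed

text \<open>
  Symmetric statistics of the order statistics are sums over the unsorted sample.
\<close>

lemma sum_ordered_vector:
  "(\<Sum>i\<le>n+1. h (ordered_vector a b n y i)) = sum_list (map h (points a b n y))"
proof -
  have "sum_list (map h (points a b n y)) = sum_list (map h (sort (points a b n y)))"
    by (simp flip: sum_mset_sum_list)
  also have "\<dots> = (\<Sum>i<n+2. h (sort (points a b n y) ! i))"
    by (simp add: sum_list_sum_nth length_points atLeast0LessThan)
  also have "{..<n+2} = {..n+1}" by auto
  finally show ?thesis by (simp add: ordered_vector_eq)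
qed

lemma sum_list_points:
  "sum_list (map h (points a b n y)) = (if a = -\<infinity> then 0 else h (real_of_ereal a))
     + (\<Sum>i<sample_size a b n. h (y i)) + (if b = \<infinity> then 0 else h (real_of_ereal b))"
  unfolding points_def by (simp add: interv_sum_list_conv_sum_set_nat comp_def atLeast0LessThan add.assoc)

lemma ordered_vector_mono:
  assumes "i \<le> j" "j \<le> n + 1"
  shows "ordered_vector a b n y i \<le> ordered_vector a b n y j"
  using assms by (simp add: ordered_vector_eq sorted_nth_mono length_points)

lemma ordered_vector_strict_mono:
  assumes "distinct (points a b n y)" "i < j" "j \<le> n + 1"
  shows "ordered_vector a b n y i < ordered_vector a b n y j"
proof -
  have "ordered_vector a b n y i \<noteq> ordered_vector a b n y j"
    using assms by (simp add: ordered_vector_eq nth_eq_iff_index_eq length_points)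
  then show ?thesis using ordered_vector_mono[of i j n a b y] assms by simp
qed

lemma ordered_vector_image: "ordered_vector a b n y ` {..n+1} = set (points a b n y)"
proof -
  have "set (points a b n y) = set (sort (points a b n y))" by simp
  also have "\<dots> = (\<lambda>i. sort (points a b n y) ! i) ` {..<n+2}"
    by (auto simp: set_conv_nth length_points)
  also have "{..<n+2} = {..n+1}" by auto
  finally show ?thesis by (auto simp: ordered_vector_eq)
qed

lemma AE_law_neq: "f \<in> borel_measurable borel \<Longrightarrow> AE x in law f. x \<noteq> c"
  unfolding law_def by (subst AE_density) (auto intro: AE_mp[OF AE_lborel_singleton])

lemma AE_neq_pair:
  assumes f: "f \<in> densities a b" and "i \<in> I" "j \<in> I" "i \<noteq> j" "finite I"
  shows "AE y in PiM I (\<lambda>_. law f). y i \<noteq> y j"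
proof -
  interpret law: prob_space "law f" by (rule prob_space_law[OF f])
  interpret prod: product_sigma_finite "\<lambda>_::'a. law f" by standard
  note densitiesD(1)[OF f, measurable]
  define J where "J = I - {i}"
  have I: "I = insert i J" "finite J" "i \<notin> J" "j \<in> J" using assms by (auto simp: J_def)
  have "(\<lambda>y. indicator {y. y i = y j} y :: ennreal) \<in> borel_measurable (PiM (insert i J) (\<lambda>_. borel :: real measure))"
  proof -
    have "(\<lambda>y. y i) \<in> borel_measurable (PiM (insert i J) (\<lambda>_. borel :: real measure))"
      "(\<lambda>y. y j) \<in> borel_measurable (PiM (insert i J) (\<lambda>_. borel :: real measure))"
      using \<open>j \<in> J\<close> by (auto intro!: measurable_component_singleton)
    from borel_measurable_eq[OF this] show ?thesis
      by (intro borel_measurable_indicator') simp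
  qed
  then have m: "(\<lambda>y. indicator {y. y i = y j} y :: ennreal) \<in> borel_measurable (PiM (insert i J) (\<lambda>_. law f))"
    by (simp add: measurable_def space_PiM cong: sets_PiM_cong)
  have "(\<integral>\<^sup>+ y. indicator {y. y i = y j} y \<partial>PiM (insert i J) (\<lambda>_. law f))
     = (\<integral>\<^sup>+ x. (\<integral>\<^sup>+ z. indicator {y. y i = y j} (x(i := z)) \<partial>law f) \<partial>PiM J (\<lambda>_. law f))"
    by (intro prod.product_nn_integral_insert I m)
  also have "\<dots> = (\<integral>\<^sup>+ x. (\<integral>\<^sup>+ z. 0 \<partial>law f) \<partial>PiM J (\<lambda>_. law f))"
  proof (rule nn_integral_cong, rule nn_integral_cong_AE)
    fix x :: "'a \<Rightarrow> real"
    show "AE z in law f. indicator {y. y i = y j} (x(i := z)) = (0::ennreal)"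
      using AE_law_neq[OF densitiesD(1)[OF f], of "x j"] by eventually_elim (use \<open>i \<noteq> j\<close> in auto)
  qed
  finally have "(\<integral>\<^sup>+ y. indicator {y. y i = y j} y \<partial>PiM I (\<lambda>_. law f)) = 0" by (simp add: I(1))
  then have "AE y in PiM I (\<lambda>_. law f). indicator {y. y i = y j} y = (0::ennreal)"
    using m by (subst (asm) nn_integral_0_iff_AE) (auto simp: I(1))
  then show ?thesis by eventually_elim (auto simp: indicator_def)
qed

text \<open>
  Ties have probability zero because every hyperplane \<open>y i = y j\<close> is null by Fubini; then the
  ordered vector is strictly increasing.
\<close>

lemma AE_distinct_points:
  assumes f: "f \<in> densities a b" and "a' < b'"
  shows "AE y in sample_law a' b' n f. distinct (points a' b' n y)"
proof -
  let ?I = "{..<sample_size a' b' n}"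
  note m = densitiesD(1)[OF f]
  have 1: "AE y in sample_law a' b' n f. \<forall>i\<in>?I. \<forall>j\<in>?I. i \<noteq> j \<longrightarrow> y i \<noteq> y j"
    unfolding sample_law_eq
  proof (intro AE_finite_allI)
    fix i j assume "i \<in> ?I" "j \<in> ?I"
    then show "AE y in PiM ?I (\<lambda>_. law f). i \<noteq> j \<longrightarrow> y i \<noteq> y j"
      by (cases "i = j") (auto intro!: AE_neq_pair[OF f])
  qed auto
  have 2: "AE y in sample_law a' b' n f. \<forall>i\<in>?I. y i \<noteq> c" for c
    unfolding sample_law_eq by (intro AE_finite_allI AE_PiM_component prob_space_law[OF f] AE_law_neq m) auto
  show ?thesis using 1 2[of "real_of_ereal a'"] 2[of "real_of_ereal b'"]
  proof eventually_elim
    case (elim y)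
    have "a' \<noteq> -\<infinity> \<Longrightarrow> b' \<noteq> \<infinity> \<Longrightarrow> real_of_ereal a' \<noteq> real_of_ereal b'"
      using \<open>a' < b'\<close> by (cases a'; cases b') auto
    moreover have "inj_on y ?I" using elim by (auto simp: inj_on_def)
    moreover have "real_of_ereal a' \<notin> y ` ?I" "real_of_ereal b' \<notin> y ` ?I" using elim by (simp_all add: image_iff eq_commute)
    ultimately show ?case
      by (cases "a' = -\<infinity>") (auto simp: points_def distinct_map atLeast0LessThan)
  qed
qed

text \<open>
  The bound is stated with the second moment instead of the variance, since all applications use
  bounded functions whose second moment is small.
\<close>

lemma (in prob_space) Chebyshev_iid_sum:
  fixes g :: "'a \<Rightarrow> real"
  assumes [measurable]: "g \<in> borel_measurable M" and int: "integrable M (\<lambda>x. (g x)\<^sup>2)" and "c > 0"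
  shows "measure (PiM {..<m} (\<lambda>_. M)) {y \<in> space (PiM {..<m} (\<lambda>_. M)).
     c \<le> \<bar>(\<Sum>i<m. g (y i)) - real m * expectation g\<bar>} \<le> real m * expectation (\<lambda>x. (g x)\<^sup>2) / c\<^sup>2"
proof -
  let ?P = "PiM {..<m} (\<lambda>_. M)"
  interpret prod: product_sigma_finite "\<lambda>_::nat. M" by standard
  interpret P: prob_space ?P by (intro prob_space_PiM) (rule prob_space_axioms)
  define \<mu> where "\<mu> = expectation g"
  define e where "e x = g x - \<mu>" for x
  have intg: "integrable M g" by (rule square_integrable_imp_integrable[OF assms(1) int])
  have inte: "integrable M e" "expectation e = 0" unfolding e_def
    using intg by (auto simp: \<mu>_def prob_space)
  have inte2: "integrable M (\<lambda>x. (e x)\<^sup>2)"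
    unfolding e_def power2_diff using intg int by auto
  have e2: "expectation (\<lambda>x. (e x)\<^sup>2) \<le> expectation (\<lambda>x. (g x)\<^sup>2)"
    using variance_eq[OF intg int] by (simp add: e_def \<mu>_def)
  have [measurable]: "e \<in> borel_measurable M" unfolding e_def by measurable
  have cross: "integrable ?P (\<lambda>y. e (y i) * e (y j)) \<and>
      (\<integral>y. e (y i) * e (y j) \<partial>?P) = (if i = j then expectation (\<lambda>x. (e x)\<^sup>2) else 0)"
    if "i < m" "j < m" for i j
  proof -
    define h where "h l x = (if l = i then e x else 1) * (if l = j then e x else 1)" for l x
    have h: "integrable M (h l)" for l
      unfolding h_def using inte inte2 by (cases "l = i"; cases "l = j") (auto simp: power2_eq_square)
    have eq: "(\<Prod>l<m. h l (y l)) = e (y i) * e (y j)" for y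
      using that by (simp add: h_def prod.distrib prod.delta)
    have "(\<integral>y. (\<Prod>l<m. h l (y l)) \<partial>?P) = (\<Prod>l<m. expectation (h l))"
      by (intro prod.product_integral_prod h) auto
    moreover have "integrable ?P (\<lambda>y. \<Prod>l<m. h l (y l))"
      by (intro prod.product_integrable_prod h) auto
    moreover have "(\<Prod>l<m. expectation (h l)) = (if i = j then expectation (\<lambda>x. (e x)\<^sup>2) else 0)"
    proof (cases "i = j")
      case True
      have "h l = (if l = i then (\<lambda>x. (e x)\<^sup>2) else (\<lambda>_. 1))" for l
        using True by (auto simp: h_def power2_eq_square)
      then have "expectation (h l) = (if l = i then expectation (\<lambda>x. (e x)\<^sup>2) else 1)" for l
        by (simp add: prob_space)
      then show ?thesis using True that by (simp add: prod.delta)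
    next
      case False
      then have "h i = e" by (auto simp: h_def fun_eq_iff)
      then have "expectation (h i) = 0" using inte by simp
      then show ?thesis using False that by (auto intro!: prod_zero)
    qed
    ultimately show ?thesis by (simp add: eq)
  qed
  define S where "S y = (\<Sum>i<m. e (y i))" for y :: "nat \<Rightarrow> 'a"
  have S2: "(S y)\<^sup>2 = (\<Sum>i<m. \<Sum>j<m. e (y i) * e (y j))" for y
    unfolding S_def by (simp add: power2_eq_square sum_product)
  have iS2: "integrable ?P (\<lambda>y. (S y)\<^sup>2)" unfolding S2 using cross by (auto intro!: Bochner_Integration.integrable_sum)
  have "(\<integral>y. (S y)\<^sup>2 \<partial>?P) = (\<Sum>i<m. \<Sum>j<m. (if i = j then expectation (\<lambda>x. (e x)\<^sup>2) else 0))"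
    unfolding S2 using cross by (subst Bochner_Integration.integral_sum)
      (auto intro!: Bochner_Integration.integrable_sum sum.cong simp: Bochner_Integration.integral_sum)
  then have ES2: "(\<integral>y. (S y)\<^sup>2 \<partial>?P) = real m * expectation (\<lambda>x. (e x)\<^sup>2)" by simp
  have Sm[measurable]: "S \<in> borel_measurable ?P" unfolding S_def by measurable
  have "P.prob {y \<in> space ?P. c \<le> \<bar>S y\<bar>} \<le> (\<integral>y. (S y)\<^sup>2 \<partial>?P) / c\<^sup>2"
    using P.second_moment_method[OF Sm iS2 \<open>c > 0\<close>] .
  also have "\<dots> \<le> real m * expectation (\<lambda>x. (g x)\<^sup>2) / c\<^sup>2"
    unfolding ES2 using e2 by (intro divide_right_mono mult_left_mono) auto
  finally show ?thesis
    by (simp add: S_def e_def sum_subtractf \<mu>_def)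
qed

text \<open>
  Multiplying a density by \<open>\<rho>\<close> multiplies the law of the sample by the product of the values of
  \<open>\<rho>\<close>; this product is the likelihood ratio of all later sections.
\<close>

lemma PiM_law_density:
  assumes f: "f \<in> densities a b" and g: "g \<in> densities a b"
    and \<rho>: "\<rho> \<in> borel_measurable borel" "\<And>x. 0 \<le> \<rho> x" and fg: "\<And>x. g x = f x * \<rho> x" and "finite I"
  shows "PiM I (\<lambda>_. law g) = density (PiM I (\<lambda>_. law f)) (\<lambda>y. ennreal (\<Prod>i\<in>I. \<rho> (y i)))"
proof -
  interpret lf: prob_space "law f" by (rule prob_space_law[OF f])
  interpret lg: prob_space "law g" by (rule prob_space_law[OF g])
  interpret pf: product_sigma_finite "\<lambda>_::'a. law f" by standard
  interpret pg: product_sigma_finite "\<lambda>_::'a. law g" by standard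
  note [measurable] = \<rho>(1) densitiesD(1)[OF f]
  have lg: "law g = density (law f) (\<lambda>x. ennreal (\<rho> x))"
    unfolding law_def fg using densitiesD(2)[OF f]
    by (subst density_density_eq) (auto simp: ennreal_mult' \<rho> intro!: density_cong)
  show ?thesis
  proof (rule pg.PiM_eqI[OF \<open>finite I\<close>, symmetric])
    show "sets (density (PiM I (\<lambda>_. law f)) (\<lambda>y. ennreal (\<Prod>i\<in>I. \<rho> (y i)))) = sets (PiM I (\<lambda>_. law g))"
      by (simp cong: sets_PiM_cong)
    fix A assume A: "\<And>i. i \<in> I \<Longrightarrow> A i \<in> sets (law g)"
    then have [measurable]: "\<And>i. i \<in> I \<Longrightarrow> A i \<in> sets borel" by simp
    have PA: "Pi\<^sub>E I A \<in> sets (PiM I (\<lambda>_. law f))" using A by (intro sets_PiM_I_finite) (auto simp: \<open>finite I\<close>)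
    have "emeasure (density (PiM I (\<lambda>_. law f)) (\<lambda>y. ennreal (\<Prod>i\<in>I. \<rho> (y i)))) (Pi\<^sub>E I A)
      = (\<integral>\<^sup>+ y. ennreal (\<Prod>i\<in>I. \<rho> (y i)) * indicator (Pi\<^sub>E I A) y \<partial>PiM I (\<lambda>_. law f))"
      using PA by (intro emeasure_density) auto
    also have "\<dots> = (\<integral>\<^sup>+ y. (\<Prod>i\<in>I. ennreal (\<rho> (y i)) * indicator (A i) (y i)) \<partial>PiM I (\<lambda>_. law f))"
    proof (intro nn_integral_cong)
      fix y assume "y \<in> space (PiM I (\<lambda>_. law f))"
      then have "indicator (Pi\<^sub>E I A) y = (\<Prod>i\<in>I. indicator (A i) (y i) :: ennreal)"
        using \<open>finite I\<close> by (auto simp: space_PiM indicator_def PiE_iff prod_zero_iff)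
      then show "ennreal (\<Prod>i\<in>I. \<rho> (y i)) * indicator (Pi\<^sub>E I A) y = (\<Prod>i\<in>I. ennreal (\<rho> (y i)) * indicator (A i) (y i))"
        by (simp add: prod.distrib prod_ennreal \<rho>)
    qed
    also have "\<dots> = (\<Prod>i\<in>I. \<integral>\<^sup>+ x. ennreal (\<rho> x) * indicator (A i) x \<partial>law f)"
      by (intro pf.product_nn_integral_prod \<open>finite I\<close>) measurable
    also have "\<dots> = (\<Prod>i\<in>I. emeasure (law g) (A i))"
      unfolding lg by (intro prod.cong refl emeasure_density[symmetric]) measurable
    finally show "emeasure (density (PiM I (\<lambda>_. law f)) (\<lambda>y. ennreal (\<Prod>i\<in>I. \<rho> (y i)))) (Pi\<^sub>E I A)
      = (\<Prod>i\<in>I. emeasure (law g) (A i))" .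
  qed
qed

section \<open>Exponential moments of the local statistics under uniformity\<close>

text \<open>
  Power series comparison: \<open>sinh x / x\<close> has the coefficients \<open>1 / (2k+1)!\<close>, which are at most
  \<open>1 / (6^k k!)\<close>. The \<open>6\<close> reflects the variance \<open>1/3\<close> of a uniform variable on \<open>[-1,1]\<close>.
\<close>

lemma sinh_le_exp:
  fixes x :: real
  assumes "x > 0"
  shows "sinh x \<le> x * exp (x\<^sup>2 / 6)"
proof -
  define g where "g n = (if even n then 0 else x ^ n /\<^sub>R fact n)" for n
  have "g sums sinh x" unfolding g_def by (rule sinh_converges)
  then have "(\<lambda>n. sum g {n * 2..<n * 2 + 2}) sums sinh x" by (rule sums_group) (rule zero_less_numeral)
  moreover have "sum g {n * 2..<n * 2 + 2} = x ^ (2 * n + 1) / fact (2 * n + 1)" for n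
  proof -
    have "{n * 2..<n * 2 + 2} = {2 * n, 2 * n + 1}" by auto
    then show ?thesis by (simp add: g_def divide_inverse mult.commute)
  qed
  ultimately have 1: "(\<lambda>n. x ^ (2 * n + 1) / fact (2 * n + 1)) sums sinh x" by simp
  have 2: "(\<lambda>n. x * ((x\<^sup>2 / 6) ^ n / fact n)) sums (x * exp (x\<^sup>2 / 6))"
    using exp_converges[of "x\<^sup>2 / 6"] by (intro sums_mult) (simp add: scaleR_conv_of_real field_simps)
  have fact: "6 ^ n * fact n \<le> (fact (2 * n + 1) :: real)" for n
  proof (induction n)
    case (Suc n)
    have "(6::real) ^ Suc n * fact (Suc n) = (6 ^ n * fact n) * (6 * (real n + 1))" by (simp add: field_simps)
    also have "\<dots> \<le> fact (2 * n + 1) * ((2 * real n + 2) * (2 * real n + 3))"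
    proof (rule mult_mono[OF Suc.IH])
      have "(2 * real n + 2) * 3 \<le> (2 * real n + 2) * (2 * real n + 3)" by (intro mult_left_mono) auto
      then show "6 * (real n + 1) \<le> (2 * real n + 2) * (2 * real n + 3)" by simp
    qed auto
    also have "\<dots> = fact (2 * Suc n + 1)" by (simp add: field_simps)
    finally show ?case .
  qed simp
  show ?thesis
  proof (rule sums_le[OF _ 1 2])
    fix n
    have "x ^ (2 * n + 1) / fact (2 * n + 1) \<le> x ^ (2 * n + 1) / (6 ^ n * fact n)"
      using assms fact[of n] by (intro divide_left_mono) auto
    also have "\<dots> = x * ((x\<^sup>2 / 6) ^ n / fact n)"
      by (simp add: power_mult power_divide)
    finally show "x ^ (2 * n + 1) / fact (2 * n + 1) \<le> x * ((x\<^sup>2 / 6) ^ n / fact n)" .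
  qed
qed

lemma uniform_density: "indicator {0..1} \<in> densities 0 1"
proof -
  have [simp]: "ennreal (indicator {0..1} x) = indicator {0..1} (x::real)" for x
    by (auto simp: indicator_def)
  show ?thesis
    unfolding densities_def
  proof (intro CollectI conjI allI AE_I2 impI)
    show "(\<integral>\<^sup>+ x. ennreal (indicator {0..1} (x::real)) \<partial>lborel) = 1" by simp
  qed (auto simp: zero_ereal_def one_ereal_def)
qed

lemma sample_size_01 [simp]: "sample_size 0 1 n = n"
  by (simp add: sample_size_def)

lemma nn_integral_law_uniform:
  assumes "g \<in> borel_measurable borel"
  shows "(\<integral>\<^sup>+ v. g v \<partial>law (indicator {0..1})) = (\<integral>\<^sup>+ v. g v * indicator {0..1} v \<partial>lborel)"
proof -
  have [simp]: "ennreal (indicator {0..1} x) = indicator {0..1} (x::real)" for x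
    by (auto simp: indicator_def)
  show ?thesis unfolding law_def using assms
    by (subst nn_integral_density) (auto simp: mult.commute)
qed

text \<open>
  A uniform variable conditioned to lie in \<open>(s,t)\<close> is uniform there, so its rescaled position has
  the moment generating function \<open>sinh L / L\<close>.
\<close>

lemma uniform_interval_mgf:
  fixes s t L :: real
  assumes "0 \<le> s" "s < t" "t \<le> 1"
  shows "(\<integral>\<^sup>+ v. indicator {s<..<t} v * ennreal (exp (L * (2 * ((v - s) / (t - s)) - 1))) \<partial>law (indicator {0..1}))
    \<le> ennreal (exp (L\<^sup>2 / 6)) * (\<integral>\<^sup>+ v. indicator {s<..<t} v \<partial>law (indicator {0..1}))"
proof -
  have len: "(\<integral>\<^sup>+ v. indicator {s<..<t} v \<partial>law (indicator {0..1})) = ennreal (t - s)"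
  proof -
    have "(\<integral>\<^sup>+ v. indicator {s<..<t} v \<partial>law (indicator {0..1})) = (\<integral>\<^sup>+ v. indicator {s<..<t} v * indicator {0..1} v \<partial>lborel)"
      by (rule nn_integral_law_uniform) measurable
    also have "\<dots> = (\<integral>\<^sup>+ v. indicator {s<..<t} v \<partial>lborel)"
      using assms by (intro nn_integral_cong) (auto simp: indicator_def)
    finally show ?thesis using assms by simp
  qed
  show ?thesis
  proof (cases "L = 0")
    case True
    then show ?thesis by simp
  next
    case False
    define c where "c = L * (2 * (1 / (t - s)))"
    have "c \<noteq> 0" using False assms by (simp add: c_def)
    define F where "F v = exp (L * (2 * ((v - s) / (t - s)) - 1)) / c" for v
    have "(\<integral>\<^sup>+ v. indicator {s<..<t} v * ennreal (exp (L * (2 * ((v - s) / (t - s)) - 1))) \<partial>law (indicator {0..1}))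
      = (\<integral>\<^sup>+ v. indicator {s<..<t} v * ennreal (exp (L * (2 * ((v - s) / (t - s)) - 1))) * indicator {0..1} v \<partial>lborel)"
      by (rule nn_integral_law_uniform) measurable
    also have "\<dots> \<le> (\<integral>\<^sup>+ v. ennreal (exp (L * (2 * ((v - s) / (t - s)) - 1))) * indicator {s..t} v \<partial>lborel)"
      by (intro nn_integral_mono) (auto simp: indicator_def)
    also have "\<dots> = ennreal (F t - F s)"
    proof (rule nn_integral_FTC_Icc)
      fix v assume "v \<in> {s..t}"
      show "(F has_real_derivative exp (L * (2 * ((v - s) / (t - s)) - 1))) (at v)"
      proof -
        have "((\<lambda>v. L * (2 * ((v - s) / (t - s)) - 1)) has_real_derivative c) (at v)"
        proof -
          have "((\<lambda>v. (v - s) / (t - s)) has_real_derivative 1 / (t - s)) (at v)"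
            by (rule DERIV_cdivide) (auto intro!: derivative_eq_intros)
          from DERIV_cmult[OF DERIV_diff[OF DERIV_cmult[OF this, of 2] DERIV_const[of 1]], of L]
          show ?thesis unfolding c_def by (simp only: diff_0_right)
        qed
        from DERIV_cdivide[OF DERIV_fun_exp[OF this], of c] show ?thesis
          unfolding F_def using \<open>c \<noteq> 0\<close> by simp
      qed
    qed (use assms in auto)
    also have "F t - F s = (t - s) * (sinh \<bar>L\<bar> / \<bar>L\<bar>)"
      using assms False by (cases "L > 0") (simp_all add: F_def c_def sinh_field_def field_simps abs_if)
    also have "\<dots> \<le> (t - s) * exp (L\<^sup>2 / 6)"
      using assms False sinh_le_exp[of "\<bar>L\<bar>"] by (intro mult_left_mono) (auto simp: field_simps)
    finally show ?thesis unfolding len using assms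
      by (simp add: ennreal_mult[symmetric] mult.commute ennreal_leI)
  qed
qed

lemma measurable_score [measurable]: "score \<in> borel_measurable borel"
  unfolding score_def by measurable

text \<open>
  The score vanishes outside \<open>(0,1)\<close>, so the sum may run over all points, in any order.
\<close>

lemma T_loc_eq_sum_points:
  fixes X y a b n
  defines "X \<equiv> ordered_vector a b n y"
  assumes "j < k" "k \<le> n + 1" "X j < X k"
  shows "T_loc j k X = sum_list (map (\<lambda>x. score ((x - X j) / (X k - X j))) (points a b n y))"
proof -
  have "(\<Sum>i\<le>n+1. score ((X i - X j) / (X k - X j))) = (\<Sum>i=j+1..k-1. score ((X i - X j) / (X k - X j)))"
  proof (rule sum.mono_neutral_right)
    show "\<forall>i\<in>{..n + 1} - {j + 1..k - 1}. score ((X i - X j) / (X k - X j)) = 0"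
    proof
      fix i assume i: "i \<in> {..n + 1} - {j + 1..k - 1}"
      then have "i \<le> j \<or> k \<le> i" by auto
      then show "score ((X i - X j) / (X k - X j)) = 0"
      proof
        assume "i \<le> j"
        then have "X i \<le> X j" unfolding X_def using assms by (intro ordered_vector_mono) auto
        then show ?thesis using assms by (auto simp: score_def indicator_def divide_simps)
      next
        assume "k \<le> i"
        then have "X k \<le> X i" unfolding X_def using i by (intro ordered_vector_mono) auto
        then show ?thesis using assms by (auto simp: score_def indicator_def divide_simps)
      qed
    qed
  qed (use assms in auto)
  then show ?thesis
    using sum_ordered_vector[where h = "\<lambda>x. score ((x - X j) / (X k - X j))" and n = n and a = a and b = b and y = y]
    unfolding T_loc_def X_def by argo
qed

lemma measurable_T_loc [measurable]:
  assumes "j < k" "k \<le> n + 1"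
  shows "(\<lambda>y. T_loc j k (ordered_vector a b n y)) \<in> borel_measurable (PiM {..<sample_size a b n} (\<lambda>_. borel))"
proof -
  have "(\<lambda>y. ordered_vector a b n y i) \<in> borel_measurable (PiM {..<sample_size a b n} (\<lambda>_. borel))" if "i \<le> k" for i
    using that assms by (intro measurable_ordered_vector_component) auto
  then show ?thesis unfolding T_loc_def using assms
    by (intro borel_measurable_sum measurable_compose[OF _ measurable_score] borel_measurable_divide
        borel_measurable_diff) auto
qed

text \<open>
  The unsorted points with both known end points: index \<open>0\<close> is the end point \<open>0\<close>, the indices
  \<open>1, ..., n\<close> are the observations and index \<open>n + 1\<close> is the end point \<open>1\<close>.
\<close>

definition sample_point :: "nat \<Rightarrow> (nat \<Rightarrow> real) \<Rightarrow> nat \<Rightarrow> real" where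
  "sample_point n u c = (if c = 0 then 0 else if c \<le> n then u (c - 1) else 1)"

text \<open>
  The event that the points with indices \<open>p\<close> and \<open>q\<close> have ranks \<open>j\<close> and \<open>k\<close>, and that \<open>B\<close> is the set of
  observations strictly between them. Almost surely exactly one of these events occurs.
\<close>

definition config :: "nat \<Rightarrow> nat \<Rightarrow> nat \<Rightarrow> nat \<Rightarrow> nat \<Rightarrow> nat set \<Rightarrow> (nat \<Rightarrow> real) set" where
  "config n j k p q B = {u. 0 \<le> sample_point n u p \<and> sample_point n u p < sample_point n u q \<and> sample_point n u q \<le> 1 \<and>
     (\<forall>i<n. i \<in> B \<longleftrightarrow> sample_point n u p < u i \<and> u i < sample_point n u q) \<and>
     (\<Sum>c\<le>n+1. of_bool (sample_point n u c < sample_point n u p)) = real j \<and>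
     (\<Sum>c\<le>n+1. of_bool (sample_point n u c < sample_point n u q)) = real k}"

lemma measurable_sample_point [measurable]: "(\<lambda>u. sample_point n u c) \<in> borel_measurable (PiM {..<n} (\<lambda>_. borel))"
  unfolding sample_point_def by (cases "c = 0"; cases "c \<le> n") (auto intro!: measurable_component_singleton)

lemma sets_config: "{u \<in> space (PiM {..<n} (\<lambda>_. borel)). u \<in> config n j k p q B} \<in> sets (PiM {..<n} (\<lambda>_. borel))"
proof -
  have *: "(\<lambda>u. of_bool (sample_point n u c < sample_point n u d) :: real) \<in> borel_measurable (PiM {..<n} (\<lambda>_. borel))" for c d
    by measurable
  note [measurable] = borel_measurable_sum[OF *]
  show ?thesis unfolding config_def mem_Collect_eq by measurable
qed

text \<open>
  Given the observations outside \<open>B\<close>, those in \<open>B\<close> are independent and uniform between the two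
  selected points; Fubini's theorem reduces the claim to a product of one-dimensional integrals.
\<close>

lemma config_mgf:
  assumes "B \<subseteq> {..<n}" "p \<le> n + 1" "q \<le> n + 1"
  defines "P \<equiv> PiM {..<n} (\<lambda>_. law (indicator {0..1}))"
  shows "(\<integral>\<^sup>+ u. indicator (config n j k p q B) u *
      (\<Prod>b\<in>B. ennreal (exp (L * (2 * ((u b - sample_point n u p) / (sample_point n u q - sample_point n u p)) - 1)))) \<partial>P)
    \<le> ennreal (exp (L\<^sup>2 / 6)) ^ card B * (\<integral>\<^sup>+ u. indicator (config n j k p q B) u \<partial>P)"
proof (cases "\<forall>b\<in>B. b + 1 \<noteq> p \<and> b + 1 \<noteq> q")
  case False
  then obtain b where b: "b \<in> B" "b + 1 = p \<or> b + 1 = q" by auto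
  have "u \<notin> config n j k p q B" for u
  proof
    assume "u \<in> config n j k p q B"
    then have "sample_point n u p < u b" "u b < sample_point n u q" using b assms(1) by (auto simp: config_def)
    moreover have "sample_point n u (b + 1) = u b" using b assms(1) by (auto simp: sample_point_def)
    ultimately show False using b by auto
  qed
  then show ?thesis by simp
next
  case True
  define M where "M = law (indicator {0..1})"
  interpret M: prob_space M unfolding M_def by (rule prob_space_law[OF uniform_density])
  interpret prod: product_sigma_finite "\<lambda>_::nat. M" by standard
  define J where "J = {..<n} - B"
  have fin: "finite J" "finite B" "J \<inter> B = {}" "J \<union> B = {..<n}"
    using assms(1) finite_subset[OF assms(1)] by (auto simp: J_def)
  define s where "s x = sample_point n (merge J B (x, \<lambda>_. 0)) p" for x
  define t where "t x = sample_point n (merge J B (x, \<lambda>_. 0)) q" for x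
  have zs: "sample_point n (merge J B (x, y)) p = s x" "sample_point n (merge J B (x, y)) q = t x" for x y
  proof -
    have "sample_point n (merge J B (x, y)) c = sample_point n (merge J B (x, \<lambda>_. 0)) c" if "\<forall>b\<in>B. b + 1 \<noteq> c" for c
      using that by (cases c) (auto simp: sample_point_def merge_def)
    then show "sample_point n (merge J B (x, y)) p = s x" "sample_point n (merge J B (x, y)) q = t x"
      using True by (auto simp: s_def t_def)
  qed
  define K where "K = {x. merge J B (x, \<lambda>_. (s x + t x) / 2) \<in> config n j k p q B}"
  have Kst: "0 \<le> s x \<and> s x < t x \<and> t x \<le> 1" if "x \<in> K" for x
    using that by (auto simp: K_def config_def zs)
  have split: "merge J B (x, y) \<in> config n j k p q B \<longleftrightarrow> x \<in> K \<and> (\<forall>b\<in>B. s x < y b \<and> y b < t x)" for x y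
  proof (cases "s x < t x \<and> (\<forall>b\<in>B. s x < y b \<and> y b < t x)")
    case True
    have mid: "s x < (s x + t x) / 2" "(s x + t x) / 2 < t x" using True by auto
    have 1: "(sample_point n (merge J B (x, y)) c < s x) = (sample_point n (merge J B (x, \<lambda>_. (s x + t x) / 2)) c < s x)"
      "(sample_point n (merge J B (x, y)) c < t x) = (sample_point n (merge J B (x, \<lambda>_. (s x + t x) / 2)) c < t x)" if "c \<le> n + 1" for c
      using True mid that by (auto simp: sample_point_def merge_def not_less less_imp_le)
    have 2: "(i \<in> B \<longleftrightarrow> s x < merge J B (x, y) i \<and> merge J B (x, y) i < t x)
       = (i \<in> B \<longleftrightarrow> s x < merge J B (x, \<lambda>_. (s x + t x) / 2) i \<and> merge J B (x, \<lambda>_. (s x + t x) / 2) i < t x)" if "i < n" for i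
      using True mid that fin by (auto simp: merge_def)
    have 3: "(\<Sum>c\<le>n+1. of_bool (sample_point n (merge J B (x, y)) c < s x)) =
        (\<Sum>c\<le>n+1. of_bool (sample_point n (merge J B (x, \<lambda>_. (s x + t x) / 2)) c < s x) :: real)"
      "(\<Sum>c\<le>n+1. of_bool (sample_point n (merge J B (x, y)) c < t x)) =
        (\<Sum>c\<le>n+1. of_bool (sample_point n (merge J B (x, \<lambda>_. (s x + t x) / 2)) c < t x) :: real)"
      using 1 by (intro sum.cong; simp)+
    have 4: "(\<forall>i<n. i \<in> B \<longleftrightarrow> s x < merge J B (x, y) i \<and> merge J B (x, y) i < t x)
       = (\<forall>i<n. i \<in> B \<longleftrightarrow> s x < merge J B (x, \<lambda>_. (s x + t x) / 2) i \<and> merge J B (x, \<lambda>_. (s x + t x) / 2) i < t x)"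
      using 2 by blast
    have "merge J B (x, y) \<in> config n j k p q B \<longleftrightarrow> x \<in> K"
      unfolding K_def config_def mem_Collect_eq zs 3 4 ..
    then show ?thesis using True by simp
  next
    case False
    have "\<not> merge J B (x, y) \<in> config n j k p q B"
    proof
      assume c: "merge J B (x, y) \<in> config n j k p q B"
      then have st: "s x < t x" "\<forall>i<n. i \<in> B \<longrightarrow> s x < merge J B (x, y) i \<and> merge J B (x, y) i < t x"
        by (auto simp: config_def zs)
      have "s x < y b \<and> y b < t x" if "b \<in> B" for b
      proof -
        have "b < n" "merge J B (x, y) b = y b" using that assms(1) fin by (auto simp: merge_def)
        then show ?thesis using st that by auto
      qed
      then show False using False st by auto
    qed
    moreover have "x \<in> K \<Longrightarrow> s x < t x" using Kst by auto
    ultimately show ?thesis using False by auto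
  qed
  define h where "h L s t v = indicator {s<..<t} v * ennreal (exp (L * (2 * ((v - s) / (t - s)) - 1)))"
    for L s t v :: real
  have hm [measurable]: "h L s t \<in> borel_measurable borel" for L s t unfolding h_def by measurable
  define f where "f L u = indicator (config n j k p q B) u *
      (\<Prod>b\<in>B. ennreal (exp (L * (2 * ((u b - sample_point n u p) / (sample_point n u q - sample_point n u p)) - 1))))" for L and u :: "nat \<Rightarrow> real"
  have inner: "(\<integral>\<^sup>+ y. f L (merge J B (x, y)) \<partial>PiM B (\<lambda>_. M)) = indicator K x * (\<integral>\<^sup>+ v. h L (s x) (t x) v \<partial>M) ^ card B" for L x
  proof -
    have "f L (merge J B (x, y)) = indicator K x * (\<Prod>b\<in>B. h L (s x) (t x) (y b))" for y
    proof -
      have "indicator (config n j k p q B) (merge J B (x, y)) = indicator K x * (\<Prod>b\<in>B. indicator {s x<..<t x} (y b) :: ennreal)"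
        using split[of x y] fin(2) by (auto simp: indicator_def prod_zero_iff)
      moreover have "merge J B (x, y) b = y b" if "b \<in> B" for b using that fin by (auto simp: merge_def)
      ultimately show ?thesis by (simp add: f_def h_def zs prod.distrib mult.assoc cong: prod.cong)
    qed
    then have "(\<integral>\<^sup>+ y. f L (merge J B (x, y)) \<partial>PiM B (\<lambda>_. M)) = (\<integral>\<^sup>+ y. indicator K x * (\<Prod>b\<in>B. h L (s x) (t x) (y b)) \<partial>PiM B (\<lambda>_. M))"
      by simp
    also have "\<dots> = indicator K x * (\<integral>\<^sup>+ y. (\<Prod>b\<in>B. h L (s x) (t x) (y b)) \<partial>PiM B (\<lambda>_. M))"
      by (intro nn_integral_cmult borel_measurable_prod_ennreal measurable_compose[OF measurable_component_singleton])
        (auto simp: M_def)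
    also have "(\<integral>\<^sup>+ y. (\<Prod>b\<in>B. h L (s x) (t x) (y b)) \<partial>PiM B (\<lambda>_. M)) = (\<Prod>b\<in>B. \<integral>\<^sup>+ v. h L (s x) (t x) v \<partial>M)"
      using fin by (intro prod.product_nn_integral_prod) (auto simp: M_def)
    finally show ?thesis by simp
  qed
  have fm: "f L \<in> borel_measurable (PiM (J \<union> B) (\<lambda>_. M))" for L
  proof -
    have sets: "sets (PiM {..<n} (\<lambda>_. M)) = sets (PiM {..<n} (\<lambda>_. borel))" by (intro sets_PiM_cong) (auto simp: M_def)
    have [measurable]: "indicator (config n j k p q B) \<in> borel_measurable (PiM {..<n} (\<lambda>_. borel))"
      using sets_config[of n j k p q B] by (intro borel_measurable_indicator'[where f = "\<lambda>x. x"]) simp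
    have [measurable]: "(\<lambda>u. u b) \<in> borel_measurable (PiM {..<n} (\<lambda>_. borel :: real measure))" if "b \<in> B" for b
      using that assms(1) by (intro measurable_component_singleton) auto
    have "f L \<in> borel_measurable (PiM {..<n} (\<lambda>_. borel))" unfolding f_def by measurable
    then show ?thesis unfolding fin(4) measurable_cong_sets[OF sets refl] .
  qed
  have "(\<integral>\<^sup>+ u. f L u \<partial>P) = (\<integral>\<^sup>+ x. indicator K x * (\<integral>\<^sup>+ v. h L (s x) (t x) v \<partial>M) ^ card B \<partial>PiM J (\<lambda>_. M))" for L
    using prod.product_nn_integral_fold[OF fin(3,1,2) fm, of L] unfolding inner fin(4) P_def M_def[symmetric] .
  note fold = this
  have "(\<integral>\<^sup>+ u. f L u \<partial>P) \<le> (\<integral>\<^sup>+ x. ennreal (exp (L\<^sup>2 / 6)) ^ card B * (indicator K x * (\<integral>\<^sup>+ v. h 0 (s x) (t x) v \<partial>M) ^ card B) \<partial>PiM J (\<lambda>_. M))"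
    unfolding fold
  proof (rule nn_integral_mono)
    fix x
    have "x \<in> K \<Longrightarrow> (\<integral>\<^sup>+ v. h L (s x) (t x) v \<partial>M) \<le> ennreal (exp (L\<^sup>2 / 6)) * (\<integral>\<^sup>+ v. h 0 (s x) (t x) v \<partial>M)"
      using uniform_interval_mgf[of "s x" "t x" L] Kst[of x] by (simp add: h_def M_def)
    then have "x \<in> K \<Longrightarrow> (\<integral>\<^sup>+ v. h L (s x) (t x) v \<partial>M) ^ card B \<le> (ennreal (exp (L\<^sup>2 / 6)) * (\<integral>\<^sup>+ v. h 0 (s x) (t x) v \<partial>M)) ^ card B"
      by (intro power_mono) auto
    then show "indicator K x * (\<integral>\<^sup>+ v. h L (s x) (t x) v \<partial>M) ^ card B
       \<le> ennreal (exp (L\<^sup>2 / 6)) ^ card B * (indicator K x * (\<integral>\<^sup>+ v. h 0 (s x) (t x) v \<partial>M) ^ card B)"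
      by (auto simp: indicator_def power_mult_distrib)
  qed
  also have "\<dots> = ennreal (exp (L\<^sup>2 / 6)) ^ card B * (\<integral>\<^sup>+ u. f 0 u \<partial>P)"
  proof -
    have "(\<lambda>x. \<integral>\<^sup>+ y. f 0 (merge J B (x, y)) \<partial>PiM B (\<lambda>_. M)) \<in> borel_measurable (PiM J (\<lambda>_. M))"
    proof -
      interpret B: finite_product_sigma_finite "\<lambda>_. M" B by standard (rule fin)
      show ?thesis using fm[of 0]
        by (intro B.borel_measurable_nn_integral measurable_compose[OF _ fm] measurable_merge) auto
    qed
    then show ?thesis unfolding fold inner by (rule nn_integral_cmult)
  qed
  finally show ?thesis by (simp add: f_def)
qed

lemma points_nth: "c \<le> n + 1 \<Longrightarrow> points 0 1 n u ! c = sample_point n u c"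
  by (cases c) (auto simp: points_def sample_point_def nth_append)

lemma sum_list_points_01: "sum_list (map h (points 0 1 n u)) = (\<Sum>c\<le>n+1. h (sample_point n u c))"
proof -
  have "sum_list (map h (points 0 1 n u)) = (\<Sum>c<n+2. h (points 0 1 n u ! c))"
    by (simp add: sum_list_sum_nth length_points atLeast0LessThan)
  also have "{..<n+2} = {..n+1}" by auto
  also have "(\<Sum>c\<le>n+1. h (points 0 1 n u ! c)) = (\<Sum>c\<le>n+1. h (sample_point n u c))"
    by (intro sum.cong) (auto simp: points_nth)
  finally show ?thesis .
qed

lemma AE_uniform_sample:
  "AE u in PiM {..<n} (\<lambda>_. law (indicator {0..1})). distinct (points 0 1 n u) \<and> (\<forall>i<n. 0 \<le> u i \<and> u i \<le> 1)"
proof -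
  have "AE u in PiM {..<n} (\<lambda>_. law (indicator {0..1})). distinct (points 0 1 n u)"
    using AE_distinct_points[OF uniform_density, of 0 1 n] unfolding sample_law_eq sample_size_01 by simp
  moreover have "AE u in PiM {..<n} (\<lambda>_. law (indicator {0..1})). \<forall>i\<in>{..<n}. 0 \<le> u i \<and> u i \<le> 1"
  proof (intro AE_finite_allI AE_PiM_component prob_space_law[OF uniform_density])
    show "AE x in law (indicator {0..1}). 0 \<le> x \<and> x \<le> 1"
      unfolding law_def by (subst AE_density) (auto simp: indicator_def)
  qed auto
  ultimately show ?thesis by eventually_elim auto
qed

text \<open>
  The conditional law of the statistic given its configuration is that of a sum of \<open>k - j - 1\<close>
  independent uniform variables on \<open>[-1,1]\<close>. Summation over all configurations removes the
  conditioning.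
\<close>

lemma T_loc_mgf:
  assumes jk: "j + 1 < k" "k \<le> n + 1"
  shows "(\<integral>\<^sup>+ u. ennreal (exp (L * T_loc j k (ordered_vector 0 1 n u))) \<partial>PiM {..<n} (\<lambda>_. law (indicator {0..1})))
    \<le> ennreal (exp (L\<^sup>2 / 6)) ^ (k - j - 1)"
proof -
  let ?P = "PiM {..<n} (\<lambda>_. law (indicator {0..1}))"
  interpret P: prob_space ?P by (intro prob_space_PiM prob_space_law[OF uniform_density])
  define Conf where "Conf = {..n+1} \<times> {..n+1} \<times> {B. B \<subseteq> {..<n} \<and> card B = k - j - 1}"
  have [simp]: "finite Conf" unfolding Conf_def by (intro finite_cartesian_product) auto
  define I where "I = (\<lambda>(p,q,B) u. indicator (config n j k p q B) u :: ennreal)"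
  define E where "E = (\<lambda>(p,q,B) u. \<Prod>b\<in>B. ennreal (exp (L * (2 * ((u b - sample_point n u p) / (sample_point n u q - sample_point n u p)) - 1))))"
  have Im: "I c \<in> borel_measurable ?P" for c
  proof -
    have sets: "sets ?P = sets (PiM {..<n} (\<lambda>_. borel))" by (intro sets_PiM_cong) auto
    obtain p q B where c: "c = (p, q, B)" by (cases c)
    have "indicator (config n j k p q B) \<in> borel_measurable (PiM {..<n} (\<lambda>_. borel))"
      using sets_config[of n j k p q B] by (intro borel_measurable_indicator'[where f = "\<lambda>x. x"]) simp
    then show ?thesis unfolding measurable_cong_sets[OF sets refl] by (simp add: I_def c)
  qed
  have Em: "(\<lambda>u. I c u * E c u) \<in> borel_measurable ?P" if "c \<in> Conf" for c
  proof -
    have sets: "sets ?P = sets (PiM {..<n} (\<lambda>_. borel))" by (intro sets_PiM_cong) auto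
    obtain p q B where c: "c = (p, q, B)" by (cases c)
    have [measurable]: "(\<lambda>u. u b) \<in> borel_measurable (PiM {..<n} (\<lambda>_. borel :: real measure))" if "b \<in> B" for b
      using that \<open>c \<in> Conf\<close> by (intro measurable_component_singleton) (auto simp: Conf_def c)
    have "E c \<in> borel_measurable (PiM {..<n} (\<lambda>_. borel))" unfolding E_def c by simp
    then show ?thesis using Im[of c] unfolding measurable_cong_sets[OF sets refl] by measurable
  qed
  have key: "AE u in ?P. ennreal (exp (L * T_loc j k (ordered_vector 0 1 n u))) \<le> (\<Sum>c\<in>Conf. I c u * E c u)
      \<and> (\<Sum>c\<in>Conf. I c u) \<le> 1"
    using AE_uniform_sample[of n]
  proof eventually_elim
    case (elim u)
    then have dist: "distinct (points 0 1 n u)" and u01: "\<And>i. i < n \<Longrightarrow> 0 \<le> u i \<and> u i \<le> 1" by auto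
    define V where "V = ordered_vector 0 1 n u"
    have Vmono: "V i < V i' \<longleftrightarrow> i < i'" if "i \<le> n + 1" "i' \<le> n + 1" for i i'
      unfolding V_def using ordered_vector_strict_mono[OF dist, of i i'] ordered_vector_strict_mono[OF dist, of i' i] that
      by (cases i i' rule: linorder_cases) auto
    have set_points: "set (points 0 1 n u) = sample_point n u ` {..n+1}"
    proof -
      have "set (points 0 1 n u) = (\<lambda>c. points 0 1 n u ! c) ` {..n+1}"
        by (auto simp: set_conv_nth length_points less_Suc_eq_le)
      then show ?thesis by (simp add: points_nth)
    qed
    have zz01: "0 \<le> sample_point n u c \<and> sample_point n u c \<le> 1" for c
    proof (cases "c = 0 \<or> n < c")
      case False
      then have "c - 1 < n" by auto
      then show ?thesis using u01[of "c - 1"] by (auto simp: sample_point_def)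
    qed (auto simp: sample_point_def)
    have Vzz: "\<exists>c\<le>n+1. V i = sample_point n u c" if "i \<le> n + 1" for i
    proof -
      have "V i \<in> set (points 0 1 n u)" unfolding V_def ordered_vector_image[symmetric] using that by auto
      then show ?thesis unfolding set_points by auto
    qed
    have inj: "sample_point n u c = sample_point n u c' \<Longrightarrow> c = c'" if "c \<le> n + 1" "c' \<le> n + 1" for c c'
      using dist that by (auto simp: points_nth[symmetric] nth_eq_iff_index_eq length_points)
    have sumeq: "(\<Sum>c\<le>n+1. h (sample_point n u c)) = (\<Sum>l\<le>n+1. h (V l))" for h :: "real \<Rightarrow> real"
      unfolding V_def sum_ordered_vector sum_list_points_01 ..
    have rank: "(\<Sum>c\<le>n+1. of_bool (sample_point n u c < V i)) = real i" if "i \<le> n + 1" for i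
    proof -
      have "(\<Sum>c\<le>n+1. of_bool (sample_point n u c < V i)) = (\<Sum>l\<le>n+1. of_bool (V l < V i) :: real)" by (rule sumeq)
      also have "\<dots> = (\<Sum>l\<le>n+1. of_bool (l < i))" using that Vmono by (intro sum.cong) auto
      also have "\<dots> = real (card ({..n+1} \<inter> {l. l < i}))" by (simp del: sum.atMost_Suc)
      also have "{..n+1} \<inter> {l. l < i} = {..<i}" using that by auto
      finally show ?thesis by simp
    qed
    obtain p where p: "p \<le> n + 1" "V j = sample_point n u p" using Vzz[of j] jk by auto
    obtain q where q: "q \<le> n + 1" "V k = sample_point n u q" using Vzz[of k] jk by auto
    define B where "B = {i. i < n \<and> V j < u i \<and> u i < V k}"
    have Vjk: "V j < V k" using Vmono[of j k] jk by auto
    have shift: "(\<Sum>c\<le>n+1. h (sample_point n u c)) = h 0 + (\<Sum>i<n. h (u i)) + h 1" for h :: "real \<Rightarrow> real"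
    proof -
      have "(\<Sum>c\<le>n+1. h (sample_point n u c)) = (\<Sum>c\<le>n. h (sample_point n u c)) + h (sample_point n u (n + 1))" by simp
      also have "(\<Sum>c\<le>n. h (sample_point n u c)) = h (sample_point n u 0) + (\<Sum>i<n. h (sample_point n u (Suc i)))"
        unfolding lessThan_Suc_atMost[symmetric] by (rule sum.lessThan_Suc_shift)
      finally show ?thesis by (simp add: sample_point_def)
    qed
    have V01: "0 \<le> V j" "V k \<le> 1" using zz01 p q by auto
    have "card B = k - j - 1"
    proof -
      have "real (card B) = (\<Sum>i<n. of_bool (V j < u i \<and> u i < V k))"
      proof -
        have "B = {..<n} \<inter> {i. V j < u i \<and> u i < V k}" by (auto simp: B_def)
        then show ?thesis by simp
      qed
      also have "\<dots> = (\<Sum>c\<le>n+1. of_bool (V j < sample_point n u c \<and> sample_point n u c < V k))" using V01 shift[of "\<lambda>x. of_bool (V j < x \<and> x < V k)"] by simp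
      also have "\<dots> = (\<Sum>l\<le>n+1. of_bool (V j < V l \<and> V l < V k))" by (rule sumeq)
      also have "\<dots> = (\<Sum>l\<le>n+1. of_bool (j < l \<and> l < k))" using jk Vmono by (intro sum.cong) auto
      also have "\<dots> = real (card ({..n+1} \<inter> {l. j < l \<and> l < k}))" by (simp del: sum.atMost_Suc)
      also have "{..n+1} \<inter> {l. j < l \<and> l < k} = {j<..<k}" using jk by auto
      finally show ?thesis by simp
    qed
    then have conf: "(p, q, B) \<in> Conf" using p q by (auto simp: Conf_def B_def)
    have inconf: "u \<in> config n j k p q B"
      using rank[of j] rank[of k] jk zz01 Vjk p q by (auto simp: config_def B_def)
    have "T_loc j k V = (\<Sum>c\<le>n+1. score ((sample_point n u c - V j) / (V k - V j)))"
      using T_loc_eq_sum_points[of j k n 0 1 u] Vjk jk by (simp add: V_def sum_list_points_01)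
    also have "\<dots> = (\<Sum>i<n. score ((u i - V j) / (V k - V j)))"
    proof -
      have "score ((0 - V j) / (V k - V j)) = 0" "score ((1 - V j) / (V k - V j)) = 0"
        using V01 Vjk by (auto simp: score_def indicator_def divide_simps)
      then show ?thesis using shift[of "\<lambda>x. score ((x - V j) / (V k - V j))"] by simp
    qed
    also have "\<dots> = (\<Sum>b\<in>B. 2 * ((u b - V j) / (V k - V j)) - 1)"
      using Vjk by (intro sum.mono_neutral_cong_right) (auto simp: B_def score_def indicator_def divide_simps)
    finally have "ennreal (exp (L * T_loc j k V)) = E (p, q, B) u"
      by (simp add: E_def p q sum_distrib_left exp_sum prod_ennreal B_def)
    also have "\<dots> = I (p, q, B) u * E (p, q, B) u" using inconf by (simp add: I_def)
    also have "\<dots> \<le> (\<Sum>c\<in>Conf. I c u * E c u)"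
      using conf by (intro member_le_sum) auto
    finally have 1: "ennreal (exp (L * T_loc j k V)) \<le> (\<Sum>c\<in>Conf. I c u * E c u)" .
    have uniq: "c = (p, q, B)" if "c \<in> Conf" "I c u \<noteq> 0" for c
    proof -
      obtain p' q' B' where c: "c = (p', q', B')" by (cases c)
      have c': "u \<in> config n j k p' q' B'" using that by (auto simp: I_def c indicator_def split: if_splits)
      have p': "p' \<le> n + 1" "q' \<le> n + 1" "B' \<subseteq> {..<n}" using that by (auto simp: Conf_def c)
      have zV: "sample_point n u r = V i" if r: "r \<le> n + 1" "(\<Sum>c\<le>n+1. of_bool (sample_point n u c < sample_point n u r)) = real i" and i: "i \<le> n + 1" for r i
      proof -
        have "sample_point n u r \<in> V ` {..n+1}" unfolding V_def ordered_vector_image set_points using r by auto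
        then obtain l where l: "l \<le> n + 1" "sample_point n u r = V l" by auto
        then have "l = i" using r rank[of l] by simp
        then show ?thesis using l by simp
      qed
      have pq: "sample_point n u p' = V j" "sample_point n u q' = V k"
        using c' p' jk by (auto intro!: zV simp: config_def)
      then have "p' = p" "q' = q" using inj p' p q by auto
      moreover have "B' = B" using c' pq p' by (auto simp: config_def B_def)
      ultimately show ?thesis by (simp add: c)
    qed
    have "(\<Sum>c\<in>Conf. I c u) = (\<Sum>c\<in>{(p, q, B)}. I c u)"
      using conf uniq by (intro sum.mono_neutral_right) auto
    also have "\<dots> \<le> 1" by (simp add: I_def indicator_def)
    finally show ?case using 1 by (simp add: V_def)
  qed
  have "(\<integral>\<^sup>+ u. ennreal (exp (L * T_loc j k (ordered_vector 0 1 n u))) \<partial>?P) \<le> (\<integral>\<^sup>+ u. (\<Sum>c\<in>Conf. I c u * E c u) \<partial>?P)"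
    by (rule nn_integral_mono_AE, rule eventually_mono[OF key], rule conjunct1)
  also have "\<dots> = (\<Sum>c\<in>Conf. \<integral>\<^sup>+ u. I c u * E c u \<partial>?P)"
    by (intro nn_integral_sum Em)
  also have "\<dots> \<le> (\<Sum>c\<in>Conf. ennreal (exp (L\<^sup>2 / 6)) ^ (k - j - 1) * (\<integral>\<^sup>+ u. I c u \<partial>?P))"
  proof (intro sum_mono)
    fix c assume "c \<in> Conf"
    then obtain p q B where c: "c = (p, q, B)" "p \<le> n + 1" "q \<le> n + 1" "B \<subseteq> {..<n}" "card B = k - j - 1"
      by (auto simp: Conf_def)
    show "(\<integral>\<^sup>+ u. I c u * E c u \<partial>?P) \<le> ennreal (exp (L\<^sup>2 / 6)) ^ (k - j - 1) * (\<integral>\<^sup>+ u. I c u \<partial>?P)"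
      using config_mgf[OF c(4,2,3), of j k L] by (simp add: I_def E_def c(1,5))
  qed
  also have "\<dots> = ennreal (exp (L\<^sup>2 / 6)) ^ (k - j - 1) * (\<integral>\<^sup>+ u. (\<Sum>c\<in>Conf. I c u) \<partial>?P)"
    by (subst nn_integral_sum) (auto simp: Im sum_distrib_left)
  also have "\<dots> \<le> ennreal (exp (L\<^sup>2 / 6)) ^ (k - j - 1) * (\<integral>\<^sup>+ u. 1 \<partial>?P)"
    by (rule mult_left_mono, rule nn_integral_mono_AE, rule eventually_mono[OF key], erule conjunct2) simp
  finally show ?thesis by (simp add: P.emeasure_space_1)
qed

text \<open>
  Chernoff's bound for both signs with the optimal exponent.
\<close>

lemma T_loc_tail:
  assumes jk: "j + 1 < k" "k \<le> n + 1" and "x > 0"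
  defines "P \<equiv> sample_law 0 1 n (indicator {0..1})"
  shows "measure P {u \<in> space P. x \<le> sqrt (3 / (real k - real j - 1)) * \<bar>T_loc j k (ordered_vector 0 1 n u)\<bar>} \<le> 2 * exp (- x\<^sup>2 / 2)"
proof -
  interpret P: prob_space P unfolding P_def by (rule prob_space_sample_law[OF uniform_density])
  define T where "T u = T_loc j k (ordered_vector 0 1 n u)" for u
  define d where "d = real k - real j - 1"
  have d: "d > 0" "real (k - j - 1) = d" using jk by (auto simp: d_def)
  define L where "L = x * sqrt (3 / d)"
  have Tm [measurable]: "T \<in> borel_measurable P"
    using measurable_T_loc[of j k n 0 1] jk unfolding T_def P_def measurable_cong_sets[OF sets_sample_law refl] by simp
  have L2: "L\<^sup>2 = 3 * x\<^sup>2 / d" unfolding L_def using d by (simp add: power_mult_distrib)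
  have one: "measure P {u \<in> space P. x \<le> sqrt (3 / d) * (e * T u)} \<le> exp (- x\<^sup>2 / 2)" if e: "e = 1 \<or> e = -1" for e :: real
  proof -
    have "{u \<in> space P. x \<le> sqrt (3 / d) * (e * T u)} = {u \<in> space P. 1 \<le> ennreal (exp (- x\<^sup>2)) * ennreal (exp ((L * e) * T u))}"
    proof (intro Collect_cong conj_cong refl)
      fix u
      have "x \<le> sqrt (3 / d) * (e * T u) \<longleftrightarrow> x * x \<le> x * (sqrt (3 / d) * (e * T u))" using \<open>x > 0\<close> by simp
      also have "\<dots> \<longleftrightarrow> 0 \<le> - x\<^sup>2 + L * e * T u" by (simp add: L_def power2_eq_square algebra_simps)
      also have "\<dots> \<longleftrightarrow> 1 \<le> exp (- x\<^sup>2) * exp ((L * e) * T u)" by (simp add: exp_add[symmetric])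
      also have "\<dots> \<longleftrightarrow> 1 \<le> ennreal (exp (- x\<^sup>2)) * ennreal (exp ((L * e) * T u))"
        by (simp add: ennreal_mult[symmetric] flip: ennreal_1)
      finally show "x \<le> sqrt (3 / d) * (e * T u) \<longleftrightarrow> 1 \<le> ennreal (exp (- x\<^sup>2)) * ennreal (exp ((L * e) * T u))" .
    qed
    then have "emeasure P {u \<in> space P. x \<le> sqrt (3 / d) * (e * T u)}
      = emeasure P {u \<in> space P. 1 \<le> ennreal (exp (- x\<^sup>2)) * ennreal (exp ((L * e) * T u))}" by simp
    also have "\<dots> \<le> ennreal (exp (- x\<^sup>2)) * (\<integral>\<^sup>+ u. ennreal (exp ((L * e) * T u)) * indicator (space P) u \<partial>P)"
      using nn_integral_Markov_inequality[of "\<lambda>u. ennreal (exp ((L * e) * T u))" "space P" P "ennreal (exp (- x\<^sup>2))"]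
      by (simp add: Collect_conj_eq[symmetric] conj_commute Int_def)
    also have "(\<integral>\<^sup>+ u. ennreal (exp ((L * e) * T u)) * indicator (space P) u \<partial>P) = (\<integral>\<^sup>+ u. ennreal (exp ((L * e) * T u)) \<partial>P)"
      by (intro nn_integral_cong) (auto simp: indicator_def)
    also have "\<dots> \<le> ennreal (exp ((L * e)\<^sup>2 / 6)) ^ (k - j - 1)"
      using T_loc_mgf[OF jk, of "L * e"] by (simp add: T_def P_def sample_law_eq)
    also have "\<dots> = ennreal (exp (x\<^sup>2 / 2))"
    proof -
      have "(L * e)\<^sup>2 = 3 * x\<^sup>2 / d" using e L2 by (auto simp: power_mult_distrib)
      then have "real (k - j - 1) * ((L * e)\<^sup>2 / 6) = x\<^sup>2 / 2" using d by simp
      then show ?thesis by (simp add: ennreal_power exp_of_nat_mult[symmetric])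
    qed
    finally have "emeasure P {u \<in> space P. x \<le> sqrt (3 / d) * (e * T u)} \<le> ennreal (exp (- x\<^sup>2 / 2))"
      by (simp add: mult_left_mono ennreal_mult[symmetric] exp_add[symmetric])
    then show ?thesis by (simp add: P.emeasure_eq_measure)
  qed
  have "{u \<in> space P. x \<le> sqrt (3 / d) * \<bar>T u\<bar>} \<subseteq> {u \<in> space P. x \<le> sqrt (3 / d) * (1 * T u)} \<union> {u \<in> space P. x \<le> sqrt (3 / d) * (-1 * T u)}"
    by (auto simp: abs_if split: if_splits)
  then have "measure P {u \<in> space P. x \<le> sqrt (3 / d) * \<bar>T u\<bar>} \<le>
     measure P ({u \<in> space P. x \<le> sqrt (3 / d) * (1 * T u)} \<union> {u \<in> space P. x \<le> sqrt (3 / d) * (-1 * T u)})"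
    by (intro P.finite_measure_mono) auto
  also have "\<dots> \<le> measure P {u \<in> space P. x \<le> sqrt (3 / d) * (1 * T u)} + measure P {u \<in> space P. x \<le> sqrt (3 / d) * (-1 * T u)}"
    by (intro measure_Un_le) auto
  also have "\<dots> \<le> 2 * exp (- x\<^sup>2 / 2)" using one[of 1] one[of "-1"] by simp
  finally show ?thesis by (simp add: d_def T_def)
qed

section \<open>Local statistics of increasing sequences on a dyadic grid\<close>

text \<open>
  The local statistic without its denominator: for increasing \<open>V\<close> it equals
  \<open>(V k - V j) * T_loc j k V\<close>. Unlike the statistic it is linear in \<open>V\<close> and vanishes for arithmetic
  progressions.
\<close>

definition Q :: "(nat \<Rightarrow> real) \<Rightarrow> nat \<Rightarrow> nat \<Rightarrow> real" where
  "Q V j k = (\<Sum>i\<in>{j<..<k}. 2 * V i - V j - V k)"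

lemma Q_refl [simp]: "Q V j j = 0"
  by (simp add: Q_def)

text \<open>
  This identity links neighbouring scales: if the values of \<open>Q\<close> on an interval and on both of its
  parts are small, then the increments of \<open>V\<close> over the parts are nearly proportional to their
  lengths.
\<close>

lemma Q_split:
  assumes "j \<le> i" "i \<le> k"
  shows "Q V j k = Q V j i + Q V i k + (real k - real i) * (V i - V j) - (real i - real j) * (V k - V i)"
proof (cases "i = j \<or> i = k")
  case False
  then have ji: "j < i" "i < k" using assms by auto
  have set: "{j<..<k} = {j<..<i} \<union> ({i} \<union> {i<..<k})" using ji by auto
  have "Q V j k = (\<Sum>l\<in>{j<..<i}. 2 * V l - V j - V k) + ((2 * V i - V j - V k) + (\<Sum>l\<in>{i<..<k}. 2 * V l - V j - V k))"
    unfolding Q_def set by (subst sum.union_disjoint; (subst sum.union_disjoint)?; auto)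
  also have "(\<Sum>l\<in>{j<..<i}. 2 * V l - V j - V k) = Q V j i + (\<Sum>l\<in>{j<..<i}. V i - V k)"
    unfolding Q_def sum.distrib[symmetric] by (intro sum.cong) auto
  also have "(\<Sum>l\<in>{i<..<k}. 2 * V l - V j - V k) = Q V i k + (\<Sum>l\<in>{i<..<k}. V i - V j)"
    unfolding Q_def sum.distrib[symmetric] by (intro sum.cong) auto
  also have "(\<Sum>l\<in>{j<..<i}. V i - V k) = (real i - real j - 1) * (V i - V k)" using ji by (simp add: of_nat_diff)
  also have "(\<Sum>l\<in>{i<..<k}. V i - V j) = (real k - real i - 1) * (V i - V j)" using ji by (simp add: of_nat_diff)
  finally show ?thesis by (simp add: algebra_simps)
qed auto

lemma Q_linear: "Q (\<lambda>i. c * real i) j k = 0"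
proof (cases "j < k")
  case True
  have "(\<Sum>i\<in>{j<..<k}. 2 * real i - real j - real k) = 0"
  proof -
    have "(\<Sum>i\<in>{j<..<k}. 2 * real i - real j - real k) = (\<Sum>i\<in>{j<..<k}. 2 * real (j + k - i) - real j - real k)"
      by (rule sum.reindex_bij_witness[of _ "\<lambda>i. j + k - i" "\<lambda>i. j + k - i"]) auto
    also have "\<dots> = - (\<Sum>i\<in>{j<..<k}. 2 * real i - real j - real k)"
      unfolding sum_negf[symmetric] by (intro sum.cong) (auto simp: of_nat_diff)
    finally show ?thesis by simp
  qed
  moreover have "Q (\<lambda>i. c * real i) j k = c * (\<Sum>i\<in>{j<..<k}. 2 * real i - real j - real k)"
    unfolding Q_def sum_distrib_left by (intro sum.cong) (auto simp: algebra_simps)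
  ultimately show ?thesis by simp
qed (simp add: Q_def)

lemma Q_diff: "Q (\<lambda>i. V i - W i) j k = Q V j k - Q W j k"
  unfolding Q_def sum_subtractf[symmetric] by (intro sum.cong) (auto simp: algebra_simps)

lemma Q_cmult: "Q (\<lambda>i. c * V i) j k = c * Q V j k"
  unfolding Q_def sum_distrib_left by (intro sum.cong) (auto simp: algebra_simps)

text \<open>
  Constants do not contribute to \<open>Q\<close>, and each summand is a second difference of values within \<open>e\<close> of \<open>w\<close>.
\<close>

lemma abs_Q_le:
  assumes "\<And>i. j \<le> i \<Longrightarrow> i \<le> k \<Longrightarrow> \<bar>W i - w\<bar> \<le> e" "j \<le> k"
  shows "\<bar>Q W j k\<bar> \<le> 4 * e * (real k - real j)"
proof -
  have e: "0 \<le> e" using assms(1)[of j] assms(2) by auto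
  have "\<bar>Q W j k\<bar> \<le> (\<Sum>i\<in>{j<..<k}. 4 * e)"
    unfolding Q_def
  proof (rule order.trans[OF sum_abs], intro sum_mono)
    fix i assume "i \<in> {j<..<k}"
    then show "\<bar>2 * W i - W j - W k\<bar> \<le> 4 * e"
      using assms(1)[of i] assms(1)[of j] assms(1)[of k] by auto
  qed
  also have "\<dots> = real (k - j - 1) * (4 * e)" by simp
  also have "\<dots> \<le> real (k - j) * (4 * e)" using e by (intro mult_right_mono) auto
  finally show ?thesis using assms(2) by (simp add: of_nat_diff mult.commute)
qed

locale increasing_points =
  fixes V :: "nat \<Rightarrow> real" and N :: nat
  assumes V0: "V 0 = 0" and VN: "V N = 1" and strict: "\<And>i j. i < j \<Longrightarrow> j \<le> N \<Longrightarrow> V i < V j"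
    and Npos: "0 < N"
begin

lemma mono: "i \<le> j \<Longrightarrow> j \<le> N \<Longrightarrow> V i \<le> V j"
  using strict[of i j] by (cases "i = j") auto

lemma T_loc_Q:
  assumes "j < k" "k \<le> N"
  shows "T_loc j k V = Q V j k / (V k - V j)"
proof -
  have "T_loc j k V = (\<Sum>i\<in>{j<..<k}. (2 * V i - V j - V k) / (V k - V j))"
    unfolding T_loc_def
  proof (intro sum.cong)
    fix i assume "i \<in> {j<..<k}"
    then have "V j < V i" "V i < V k" using strict[of j i] strict[of i k] assms by auto
    then show "score ((V i - V j) / (V k - V j)) = (2 * V i - V j - V k) / (V k - V j)"
      by (auto simp: score_def indicator_def field_simps)
  qed (use assms in auto)
  then show ?thesis by (simp add: Q_def sum_divide_distrib)
qed

lemma Q_T_loc: "j < k \<Longrightarrow> k \<le> N \<Longrightarrow> Q V j k = T_loc j k V * (V k - V j)"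
  using strict[of j k] by (simp add: T_loc_Q)

text \<open>
  The rescaled deviation of the points from equidistant ones.
\<close>

definition W :: "nat \<Rightarrow> real" where "W i = real N * V i - real i"

lemma Q_W: "Q W j k = real N * Q V j k"
proof -
  have "W = (\<lambda>i. real N * V i - 1 * real i)" by (auto simp: W_def)
  then show ?thesis using Q_diff[of "\<lambda>i. real N * V i" "\<lambda>i. 1 * real i" j k] Q_linear[of 1 j k] by (simp add: Q_cmult)
qed

text \<open>
  Dyadic nodes of level \<open>D\<close>, rounded down to integers.
\<close>

definition grid :: "nat \<Rightarrow> nat \<Rightarrow> nat" where "grid D a = a * N div 2 ^ D"
definition len :: "nat \<Rightarrow> real" where "len D = real N / 2 ^ D"

lemma len_pos: "0 < len D" using Npos by (simp add: len_def)
lemma len_Suc: "len (Suc D) = len D / 2" by (simp add: len_def)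
lemma len_antimono: "D \<le> E \<Longrightarrow> len E \<le> len D"
  unfolding len_def by (intro divide_left_mono power_increasing) auto
lemma grid_0 [simp]: "grid D 0 = 0" by (simp add: grid_def)
lemma grid_last [simp]: "grid D (2 ^ D) = N" by (simp add: grid_def)
lemma grid_double: "grid (Suc D) (2 * a) = grid D a" by (simp add: grid_def mult.assoc)
lemma grid_mono: "a \<le> b \<Longrightarrow> grid D a \<le> grid D b" by (simp add: grid_def div_le_mono)
lemma grid_le: "a \<le> 2 ^ D \<Longrightarrow> grid D a \<le> N" using grid_mono[of a "2 ^ D" D] by simp
lemma grid_bounds: "real a * len D - 1 < real (grid D a)" "real (grid D a) \<le> real a * len D"
proof -
  have "real (grid D a) = real_of_int \<lfloor>real (a * N) / real (2 ^ D)\<rfloor>"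
    unfolding grid_def using floor_divide_of_nat_eq[of "a * N" "2 ^ D", where ?'a = real] by simp
  moreover have "real (a * N) / real (2 ^ D) = real a * len D" by (simp add: len_def)
  ultimately show "real a * len D - 1 < real (grid D a)" "real (grid D a) \<le> real a * len D" by linarith+
qed

lemma grid_diff:
  assumes "a \<le> b"
  shows "\<bar>(real (grid D b) - real (grid D a)) - (real b - real a) * len D\<bar> < 1"
  using grid_bounds[where a = a and D = D] grid_bounds[where a = b and D = D] by (simp add: algebra_simps abs_if)

end

text \<open>
  Points whose local statistics are small on every pair of neighbouring nodes down to level \<open>R\<close>.
  The factor \<open>sqrt (D + 8)\<close> has the order of the penalty at level \<open>D\<close>, and the lower bound on the mesh
  size keeps all deviations below it small compared with the mesh size.
\<close>

locale controlled_points = increasing_points +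
  fixes R :: nat and K :: real
  assumes K: "1 \<le> K"
    and big: "\<And>D. D \<le> R \<Longrightarrow> 640 * (K * sqrt (real D + 8)) \<le> sqrt (len D)"
    and nodes: "\<And>D a. D \<le> R \<Longrightarrow> a < 2 ^ D \<Longrightarrow>
      \<bar>T_loc (grid D a) (grid D (a + 1)) V\<bar> \<le> K * sqrt (real D + 8) * sqrt (real (grid D (a + 1)) - real (grid D a))"
begin

definition \<beta> :: "nat \<Rightarrow> real" where "\<beta> D = K * sqrt (real D + 8)"

lemma \<beta>_ge: "2 \<le> \<beta> D"
proof -
  have "2 \<le> sqrt (real D + 8)" by (rule real_le_rsqrt) simp
  then have "1 * 2 \<le> K * sqrt (real D + 8)" using K by (intro mult_mono) auto
  then show ?thesis by (simp add: \<beta>_def)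
qed

lemma \<beta>_mono: "\<beta> D \<le> \<beta> (Suc D)"
  unfolding \<beta>_def using K by (intro mult_left_mono) auto

lemma sqrt_len_ge: "D \<le> R \<Longrightarrow> 1280 \<le> sqrt (len D)"
  using big[of D] \<beta>_ge[of D] by (simp add: \<beta>_def)

lemma len_ge: "D \<le> R \<Longrightarrow> 1280 * 1280 \<le> len D"
  using sqrt_len_ge[of D] real_sqrt_pow2[of "len D"] len_pos[of D]
    mult_mono[of 1280 "sqrt (len D)" 1280 "sqrt (len D)"] by (simp add: power2_eq_square)

lemma fluct_small: 
  assumes "D \<le> R" shows "80 * \<beta> D * sqrt (len D) \<le> len D / 8"
proof -
  have "640 * \<beta> D * sqrt (len D) \<le> sqrt (len D) * sqrt (len D)"
    using big[OF assms] len_pos[of D] by (intro mult_right_mono) (auto simp: \<beta>_def)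
  then show ?thesis using len_pos[of D] by simp
qed

lemma grid_len:
  assumes "D \<le> R"
  shows "len D - 1 < real (grid D (a + 1)) - real (grid D a)" "real (grid D (a + 1)) - real (grid D a) < len D + 1"
    "grid D a < grid D (a + 1)"
proof -
  show 1: "len D - 1 < real (grid D (a + 1)) - real (grid D a)" and "real (grid D (a + 1)) - real (grid D a) < len D + 1"
    using grid_diff[of a "a + 1" D] by (auto simp: abs_if split: if_splits)
  show "grid D a < grid D (a + 1)" using 1 len_ge[OF assms] by linarith
qed

text \<open>
  Induction on the level by splitting a cell into halves. The increment of \<open>W\<close> over the parent contributes about one
  half of itself to each child, and the statistics of the parent and both children contribute the rest. The
  bound shrinks from level to level by a factor of at least \<open>1 / sqrt 2 > 1 / 2\<close>, so a large enough constant persists.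
\<close>

lemma node_fluctuation:
  "D \<le> R \<Longrightarrow> a < 2 ^ D \<Longrightarrow> \<bar>W (grid D (a + 1)) - W (grid D a)\<bar> \<le> 80 * \<beta> D * sqrt (len D)"
proof (induction D arbitrary: a)
  case 0
  have "0 \<le> 80 * \<beta> 0 * sqrt (len 0)" using \<beta>_ge[of 0] len_pos[of 0] by simp
  then show ?case using 0 grid_last[of 0] by (simp add: W_def V0 VN)
next
  case (Suc D)
  define a' where "a' = a div 2"
  have a': "a' < 2 ^ D" using Suc.prems by (simp add: a'_def less_mult_imp_div_less mult.commute)
  define j i k where "j = grid D a'" and "i = grid (Suc D) (2 * a' + 1)" and "k = grid D (a' + 1)"
  have jk': "j = grid (Suc D) (2 * a')" "k = grid (Suc D) (2 * a' + 1 + 1)"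
    using grid_double[of D a'] grid_double[of D "a' + 1"] by (simp_all add: j_def k_def)
  have kN: "k \<le> N" unfolding k_def using a' by (intro grid_le) auto
  note L = len_ge[OF Suc.prems(1)] len_Suc[of D]
  have D: "D \<le> R" using Suc by simp
  define m x where "m = real k - real j" and "x = real i - real j"
  have ji: "j < i" "i < k" and x: "len D / 2 - 1 < x" "x < len D / 2 + 1" "len D / 2 - 1 < m - x" "m - x < len D / 2 + 1"
    using grid_len[OF Suc.prems(1), of "2 * a'"] grid_len[OF Suc.prems(1), of "2 * a' + 1"] L
    by (auto simp: jk' i_def m_def x_def algebra_simps)
  have m: "len D - 1 < m" "m < len D + 1" using grid_len[OF D, of a'] by (auto simp: m_def j_def k_def)
  have IH: "\<bar>W k - W j\<bar> \<le> 80 * \<beta> D * sqrt (len D)" using Suc.IH[OF D a'] by (simp add: j_def k_def)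
  have \<beta>: "2 \<le> \<beta> D" "\<beta> D \<le> \<beta> (Suc D)" using \<beta>_ge \<beta>_mono by auto
  have m0: "0 < m" using m L by simp
  have R2: "real N * (V k - V j) \<le> 2 * m"
  proof -
    have "real N * (V k - V j) = m + (W k - W j)" by (simp add: W_def m_def algebra_simps)
    also have "\<dots> \<le> m + len D / 8" using IH fluct_small[OF D] by linarith
    finally show ?thesis using m L by linarith
  qed
  have Vjik: "V j < V i" "V i < V k" using strict ji kN by auto
  define s where "s = (real N / m) * (Q V j k - Q V j i - Q V i k)"
  have Wi: "W i - W j = (x / m) * (W k - W j) + s" 
  proof -
    have Qe: "Q V j k - Q V j i - Q V i k = m * (V i - V j) - x * (V k - V j)"
      using Q_split[of j i k V] ji by (simp add: x_def m_def algebra_simps)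
    have "s = real N * (V i - V j) - (x / m) * (real N * (V k - V j))"
      unfolding s_def Qe using m0 by (simp add: field_simps)
    moreover have "real N * (V i - V j) = (W i - W j) + x" "real N * (V k - V j) = (W k - W j) + m"
      by (simp_all add: W_def x_def m_def algebra_simps)
    ultimately have "s = (W i - W j) + x - (x / m) * ((W k - W j) + m)" by (simp only:)
    moreover have "(x / m) * ((W k - W j) + m) = (x / m) * (W k - W j) + x" using m0 by (simp add: distrib_left)
    ultimately show ?thesis by linarith
  qed
  have sq: "sqrt m \<le> 11/10 * sqrt (len D)"
  proof -
    have "m \<le> (11/10)\<^sup>2 * len D" using m L by (simp add: power2_eq_square)
    then have "sqrt m \<le> sqrt ((11/10)\<^sup>2 * len D)" by simp
    then show ?thesis by (simp add: real_sqrt_mult)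
  qed
  have s: "\<bar>s\<bar> \<le> 66/10 * (\<beta> (Suc D) * sqrt (len D))"
  proof -
    have T: "\<bar>T_loc j k V\<bar> \<le> \<beta> (Suc D) * sqrt m" "\<bar>T_loc j i V\<bar> \<le> \<beta> (Suc D) * sqrt m" "\<bar>T_loc i k V\<bar> \<le> \<beta> (Suc D) * sqrt m"
    proof -
      have "\<bar>T_loc j k V\<bar> \<le> \<beta> D * sqrt m" using nodes[OF D a'] by (simp add: j_def k_def m_def \<beta>_def)
      then show "\<bar>T_loc j k V\<bar> \<le> \<beta> (Suc D) * sqrt m" using \<beta> m0 by (smt (verit) mult_right_mono real_sqrt_ge_zero)
      have c: "2 * a' < 2 ^ Suc D" "2 * a' + 1 < 2 ^ Suc D" using a' by auto
      have "\<bar>T_loc j i V\<bar> \<le> \<beta> (Suc D) * sqrt x" using nodes[OF Suc.prems(1) c(1)] by (simp add: jk' i_def x_def \<beta>_def)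
      also have "\<dots> \<le> \<beta> (Suc D) * sqrt m" using \<beta> ji by (intro mult_left_mono) (auto simp: x_def m_def)
      finally show "\<bar>T_loc j i V\<bar> \<le> \<beta> (Suc D) * sqrt m" .
      have "\<bar>T_loc i k V\<bar> \<le> \<beta> (Suc D) * sqrt (m - x)" using nodes[OF Suc.prems(1) c(2)] by (simp add: jk' i_def x_def m_def \<beta>_def)
      also have "\<dots> \<le> \<beta> (Suc D) * sqrt m" using \<beta> ji by (intro mult_left_mono) (auto simp: x_def m_def)
      finally show "\<bar>T_loc i k V\<bar> \<le> \<beta> (Suc D) * sqrt m" .
    qed
    have bQ: "\<bar>Q V u v\<bar> \<le> \<beta> (Suc D) * sqrt m * (V k - V j)" if "\<bar>T_loc u v V\<bar> \<le> \<beta> (Suc D) * sqrt m" "j \<le> u" "u < v" "v \<le> k" for u v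
    proof -
      have "\<bar>Q V u v\<bar> = \<bar>T_loc u v V\<bar> * (V v - V u)" using that Q_T_loc[of u v] strict[of u v] kN by (simp add: abs_mult)
      also have "\<dots> \<le> (\<beta> (Suc D) * sqrt m) * (V k - V j)"
        using that mono[of j u] mono[of v k] strict[of u v] kN \<beta> m0 by (intro mult_mono) auto
      finally show ?thesis .
    qed
    have "\<bar>s\<bar> = (real N / m) * \<bar>Q V j k - Q V j i - Q V i k\<bar>" unfolding s_def using m0 by (simp add: abs_mult)
    also have "\<dots> \<le> (real N / m) * (3 * (\<beta> (Suc D) * sqrt m * (V k - V j)))"
      using bQ[OF T(1)] bQ[OF T(2)] bQ[OF T(3)] ji m0 by (intro mult_left_mono) auto
    also have "\<dots> = (real N * (V k - V j) / m) * (3 * \<beta> (Suc D) * sqrt m)" by simp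
    also have "\<dots> \<le> 2 * (3 * \<beta> (Suc D) * sqrt m)"
      using R2 m0 \<beta> by (intro mult_right_mono) (auto simp: field_simps)
    also have "\<dots> \<le> 2 * (3 * \<beta> (Suc D) * (11/10 * sqrt (len D)))" using sq \<beta> by (intro mult_left_mono) auto
    finally show ?thesis by (simp add: mult_ac)
  qed
  have s2: "sqrt (len D) \<le> 14143/10000 * sqrt (len (Suc D))"
  proof -
    have "len D \<le> (14143/10000)\<^sup>2 * len (Suc D)" using len_pos[of D] by (simp add: len_Suc power2_eq_square)
    then have "sqrt (len D) \<le> sqrt ((14143/10000)\<^sup>2 * len (Suc D))" by simp
    then show ?thesis by (simp add: real_sqrt_mult)
  qed
  have frac: "\<bar>y / m\<bar> \<le> 6/10" if "len D / 2 - 1 < y" "y < len D / 2 + 1" for y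
  proof -
    have "0 \<le> y" "y \<le> 6/10 * m" using that m L by linarith+
    then show ?thesis using m0 by (simp add: divide_le_eq)
  qed
  have main: "\<bar>(y / m) * (W k - W j)\<bar> + \<bar>s\<bar> \<le> 80 * \<beta> (Suc D) * sqrt (len (Suc D))" if "len D / 2 - 1 < y" "y < len D / 2 + 1" for y
  proof -
    have "\<bar>(y / m) * (W k - W j)\<bar> \<le> (6/10) * (80 * \<beta> D * sqrt (len D))"
      unfolding abs_mult using frac[OF that] IH by (intro mult_mono) auto
    also have "\<dots> \<le> (6/10) * (80 * \<beta> (Suc D) * sqrt (len D))"
      using \<beta> len_pos[of D] by (intro mult_left_mono mult_right_mono) auto
    finally have "\<bar>(y / m) * (W k - W j)\<bar> + \<bar>s\<bar> \<le> (48 + 66/10) * \<beta> (Suc D) * sqrt (len D)"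
      using s by (simp add: algebra_simps)
    also have "\<dots> \<le> (48 + 66/10) * \<beta> (Suc D) * (14143/10000 * sqrt (len (Suc D)))"
      using s2 \<beta> by (intro mult_left_mono) auto
    also have "\<dots> = (48 + 66/10) * (14143/10000) * (\<beta> (Suc D) * sqrt (len (Suc D)))" by simp
    also have "\<dots> \<le> 80 * (\<beta> (Suc D) * sqrt (len (Suc D)))"
      using \<beta> len_pos[of "Suc D"] by (intro mult_right_mono) auto
    finally show ?thesis by simp
  qed
  have "a = 2 * a' \<or> a = 2 * a' + 1" by (auto simp: a'_def)
  then show ?case
  proof
    assume a: "a = 2 * a'"
    have "\<bar>W i - W j\<bar> \<le> \<bar>(x / m) * (W k - W j)\<bar> + \<bar>s\<bar>" unfolding Wi by (rule abs_triangle_ineq)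
    then show ?thesis using main[OF x(1,2)] a by (simp add: jk' i_def)
  next
    assume a: "a = 2 * a' + 1"
    have "W k - W i = ((m - x) / m) * (W k - W j) - s" using Wi m0 by (simp add: field_simps)
    then have "\<bar>W k - W i\<bar> \<le> \<bar>((m - x) / m) * (W k - W j)\<bar> + \<bar>s\<bar>"
      using abs_triangle_ineq4[of "((m - x) / m) * (W k - W j)" s] by (simp only:)
    then show ?thesis using main[OF x(3,4)] a by (simp add: jk' i_def)
  qed
qed

lemma \<beta>_len_decay: "\<beta> (Suc D) * sqrt (len (Suc D)) \<le> 3/4 * (\<beta> D * sqrt (len D))"
proof -
  have "(real (Suc D) + 8) * len (Suc D) \<le> (3/4)\<^sup>2 * ((real D + 8) * len D)"
    using len_pos[of D] by (simp add: len_Suc power2_eq_square algebra_simps)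
  then have "sqrt ((real (Suc D) + 8) * len (Suc D)) \<le> sqrt ((3/4)\<^sup>2 * ((real D + 8) * len D))" by simp
  then have "K * (sqrt (real (Suc D) + 8) * sqrt (len (Suc D))) \<le> K * (3/4 * (sqrt (real D + 8) * sqrt (len D)))"
    using K by (intro mult_left_mono) (auto simp: real_sqrt_mult)
  then show ?thesis by (simp add: \<beta>_def)
qed

text \<open>
  Chaining from level \<open>D\<close> down to level \<open>R\<close>: the node increments decay geometrically with ratio
  \<open>3/4\<close>, hence sum to a multiple of the first one. Below level \<open>R\<close> the monotonicity of the points
  bounds the oscillation by the mesh size.
\<close>

lemma node_oscillation:
  assumes "D \<le> R" "a < 2 ^ D" "grid D a \<le> i" "i \<le> grid D (a + 1)"
  shows "\<bar>W i - W (grid D a)\<bar> \<le> 2 * len R + 240 * (\<beta> D * sqrt (len D))"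
  using assms
proof (induction "R - D" arbitrary: D a)
  case 0
  then have D: "D = R" by simp
  define j k where "j = grid D a" and "k = grid D (a + 1)"
  have kN: "k \<le> N" unfolding k_def using 0 by (intro grid_le) auto
  have f: "\<bar>W k - W j\<bar> \<le> len D / 8" using node_fluctuation[OF 0(2,3)] fluct_small[OF 0(2)] by (simp add: j_def k_def)
  have g: "real k - real j < len D + 1" using grid_len[OF 0(2), of a] by (simp add: j_def k_def)
  have "real N * (V i - V j) \<le> real N * (V k - V j)" using mono[of i k] kN 0 by (intro mult_left_mono) (auto simp: k_def)
  also have "\<dots> = (real k - real j) + (W k - W j)" by (simp add: W_def algebra_simps)
  finally have 1: "real N * (V i - V j) \<le> 2 * len D" using f g len_ge[OF 0(2)] by linarith
  have 2: "0 \<le> real N * (V i - V j)" using mono[of j i] kN 0 by (intro mult_nonneg_nonneg) (auto simp: j_def k_def)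
  have "W i - W j = real N * (V i - V j) - (real i - real j)" by (simp add: W_def algebra_simps)
  moreover have "0 \<le> real i - real j" "real i - real j \<le> 2 * len D" using 0 g len_ge[OF 0(2)] by (auto simp: j_def k_def)
  ultimately have "\<bar>W i - W j\<bar> \<le> 2 * len D" using 1 2 by linarith
  moreover have "0 \<le> \<beta> D * sqrt (len D)" using \<beta>_ge[of D] len_pos[of D] by simp
  ultimately show ?case by (simp add: j_def D)
next
  case (Suc e)
  have SD: "Suc D \<le> R" "e = R - Suc D" using Suc by auto
  have c: "2 * a < 2 ^ Suc D" "2 * a + 1 < 2 ^ Suc D" using Suc.prems by auto
  have dec: "240 * (\<beta> (Suc D) * sqrt (len (Suc D))) \<le> 180 * (\<beta> D * sqrt (len D))" using \<beta>_len_decay[of D] by linarith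
  have nn: "0 \<le> \<beta> D * sqrt (len D)" using \<beta>_ge[of D] len_pos[of D] by simp
  have e: "grid (Suc D) (2 * a) = grid D a" "grid (Suc D) (2 * a + 1 + 1) = grid D (a + 1)"
    using grid_double[of D a] grid_double[of D "a + 1"] by simp_all
  show ?case
  proof (cases "i \<le> grid (Suc D) (2 * a + 1)")
    case True
    then have "\<bar>W i - W (grid (Suc D) (2 * a))\<bar> \<le> 2 * len R + 240 * (\<beta> (Suc D) * sqrt (len (Suc D)))"
      using Suc.prems by (intro Suc.hyps(1)[OF SD(2,1) c(1)]) (auto simp: e)
    then show ?thesis using dec nn by (simp add: e)
  next
    case False
    then have "\<bar>W i - W (grid (Suc D) (2 * a + 1))\<bar> \<le> 2 * len R + 240 * (\<beta> (Suc D) * sqrt (len (Suc D)))"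
      using Suc.prems e by (intro Suc.hyps(1)[OF SD(2,1) c(2)]) auto
    moreover have "\<bar>W (grid (Suc D) (2 * a + 1)) - W (grid D a)\<bar> \<le> 60 * (\<beta> D * sqrt (len D))"
      using node_fluctuation[OF SD(1) c(1)] \<beta>_len_decay[of D] by (simp add: e)
    ultimately show ?thesis using dec by linarith
  qed
qed

end

context controlled_points
begin

text \<open>
  A bound for the deviation within a cell, relative to either of its end points: the oscillation
  from the left node plus the increment over the whole cell.
\<close>

definition \<theta> :: "nat \<Rightarrow> real" where "\<theta> D = 2 * len R + 320 * (\<beta> D * sqrt (len D))"

lemma \<theta>_le: "D \<le> R \<Longrightarrow> \<theta> D \<le> 3 * len D"
  using fluct_small[of D] len_antimono[of D R] len_pos[of D] by (simp add: \<theta>_def)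

lemma grid_above:
  assumes "D \<le> R" "j \<le> N"
  obtains a where "a \<le> 2 ^ D" "j \<le> grid D a" "real (grid D a) - real j \<le> 2 * len D"
    "\<And>i. j \<le> i \<Longrightarrow> i \<le> grid D a \<Longrightarrow> \<bar>W i - W (grid D a)\<bar> \<le> \<theta> D"
proof -
  define a where "a = (LEAST a. j \<le> grid D a)"
  have ex: "j \<le> grid D (2 ^ D)" using assms by simp
  have ja: "j \<le> grid D a" unfolding a_def by (rule LeastI[of "\<lambda>a. j \<le> grid D a", OF ex])
  have a2: "a \<le> 2 ^ D" unfolding a_def by (rule Least_le[of "\<lambda>a. j \<le> grid D a", OF ex])
  have nn: "0 \<le> \<theta> D" using \<beta>_ge[of D] len_pos[of D] len_pos[of R] by (simp add: \<theta>_def)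
  show ?thesis
  proof (cases a)
    case 0
    then have "j = 0" using ja by simp
    then show ?thesis using that[of a] 0 nn len_pos[of D] by simp
  next
    case (Suc a')
    then have lt: "grid D a' < j" using not_less_Least[of a' "\<lambda>a. j \<le> grid D a"] by (simp add: a_def)
    have a': "a' < 2 ^ D" using a2 Suc by simp
    show ?thesis
    proof (rule that[OF a2 ja])
      show "real (grid D a) - real j \<le> 2 * len D"
        using grid_len(2)[OF assms(1), of a'] lt len_ge[OF assms(1)] Suc by simp
      fix i assume i: "j \<le> i" "i \<le> grid D a"
      have "\<bar>W i - W (grid D a')\<bar> \<le> 2 * len R + 240 * (\<beta> D * sqrt (len D))"
        using i lt Suc by (intro node_oscillation[OF assms(1) a']) auto
      then show "\<bar>W i - W (grid D a)\<bar> \<le> \<theta> D"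
        using node_fluctuation[OF assms(1) a'] Suc by (simp add: \<theta>_def)
    qed
  qed
qed

lemma grid_below:
  assumes "D \<le> R" "k \<le> N"
  obtains b where "b \<le> 2 ^ D" "grid D b \<le> k" "real k - real (grid D b) \<le> 2 * len D"
    "\<And>i. grid D b \<le> i \<Longrightarrow> i \<le> k \<Longrightarrow> \<bar>W i - W (grid D b)\<bar> \<le> \<theta> D"
proof -
  have nn: "0 \<le> \<beta> D * sqrt (len D)" using \<beta>_ge[of D] len_pos[of D] by simp
  define b where "b = (GREATEST b. b \<le> 2 ^ D \<and> grid D b \<le> k)"
  have b: "b \<le> 2 ^ D \<and> grid D b \<le> k" unfolding b_def
    by (rule GreatestI_nat[of "\<lambda>b. b \<le> 2 ^ D \<and> grid D b \<le> k" 0 "2 ^ D"]) auto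
  have max: "c \<le> b" if "c \<le> 2 ^ D" "grid D c \<le> k" for c unfolding b_def
    by (rule Greatest_le_nat[of "\<lambda>b. b \<le> 2 ^ D \<and> grid D b \<le> k" c "2 ^ D"]) (use that in auto)
  show ?thesis
  proof (cases "b = 2 ^ D")
    case True
    then have "grid D b = N" by simp
    then have "k = grid D b" using b assms by simp
    moreover have "0 \<le> \<theta> D" using nn len_pos[of R] by (simp add: \<theta>_def)
    ultimately show ?thesis using that[of b] b len_pos[of D] by auto
  next
    case False
    then have b': "b < 2 ^ D" using b by simp
    then have lt: "k < grid D (b + 1)" using max[of "b + 1"] by (cases "k < grid D (b + 1)") auto
    show ?thesis
    proof (rule that)
      show "b \<le> 2 ^ D" "grid D b \<le> k" using b by auto
      show "real k - real (grid D b) \<le> 2 * len D"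
        using grid_len(2)[OF assms(1), of b] lt len_ge[OF assms(1)] by simp
      fix i assume i: "grid D b \<le> i" "i \<le> k"
      then have "\<bar>W i - W (grid D b)\<bar> \<le> 2 * len R + 240 * (\<beta> D * sqrt (len D))"
        using lt by (intro node_oscillation[OF assms(1) b']) auto
      then show "\<bar>W i - W (grid D b)\<bar> \<le> \<theta> D" using nn by (simp add: \<theta>_def)
    qed
  qed
qed

lemma grid_fluctuation:
  assumes "D \<le> R" "a \<le> b" "b \<le> 2 ^ D"
  shows "\<bar>W (grid D b) - W (grid D a)\<bar> \<le> (real b - real a) * (80 * \<beta> D * sqrt (len D))"
  using assms(2,3)
proof (induction b rule: dec_induct)
  case (step b)
  then have "\<bar>W (grid D (b + 1)) - W (grid D b)\<bar> \<le> 80 * \<beta> D * sqrt (len D)"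
    by (intro node_fluctuation[OF assms(1)]) auto
  then show ?case using step by (simp add: algebra_simps)
qed simp

text \<open>
  The indices \<open>j\<close> and \<open>k\<close> are moved to the next nodes inside the interval. On the two pieces that are
  cut off, \<open>W\<close> varies by at most \<open>\<theta> D\<close>, so that both the numerator and the denominator of the statistic
  change little.
\<close>

lemma T_loc_approx:
  assumes "D \<le> R" "j < k" "k \<le> N" and m: "16 * (real D + 8) * len D \<le> real k - real j"
  obtains a b where "a < b" "b \<le> 2 ^ D" "j \<le> grid D a" "grid D b \<le> k"
    "real k - real j \<le> 2 * (real (grid D b) - real (grid D a))" "real b - real a \<le> 2 * (real k - real j) / len D"
    "\<bar>T_loc j k V\<bar> \<le> \<bar>T_loc (grid D a) (grid D b) V\<bar> + 10 * \<theta> D"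
proof -
  have jN: "j \<le> N" using assms by simp
  obtain a where a: "a \<le> 2 ^ D" "j \<le> grid D a" "real (grid D a) - real j \<le> 2 * len D"
    "\<And>i. j \<le> i \<Longrightarrow> i \<le> grid D a \<Longrightarrow> \<bar>W i - W (grid D a)\<bar> \<le> \<theta> D"
    using grid_above[OF assms(1) jN] by blast
  obtain b where b: "b \<le> 2 ^ D" "grid D b \<le> k" "real k - real (grid D b) \<le> 2 * len D"
    "\<And>i. grid D b \<le> i \<Longrightarrow> i \<le> k \<Longrightarrow> \<bar>W i - W (grid D b)\<bar> \<le> \<theta> D"
    using grid_below[OF assms(1,3)] by blast
  define j' k' m where "j' = grid D a" and "k' = grid D b" and "m = real k - real j"
  define l where "l = len D"
  define w where "w = 80 * \<beta> D * sqrt (len D)"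
  have l: "1000 \<le> l" using len_ge[OF assms(1)] by (simp add: l_def)
  have w0: "0 \<le> w" using \<beta>_ge[of D] len_pos[of D] by (simp add: w_def)
  have w: "w \<le> l / 8" using fluct_small[OF assms(1)] by (simp add: w_def l_def)
  have th: "4 * w \<le> \<theta> D" "\<theta> D \<le> 3 * l" using \<theta>_le[OF assms(1)] len_pos[of R] by (auto simp: \<theta>_def w_def l_def)
  have ml: "128 * l \<le> m"
  proof -
    have "16 * 8 * len D \<le> 16 * (real D + 8) * len D" using len_pos[of D] by (intro mult_right_mono) auto
    then show ?thesis using m by (simp add: l_def m_def)
  qed
  have jj: "j \<le> j'" "real j' - real j \<le> 2 * l" and kk: "k' \<le> k" "real k - real k' \<le> 2 * l"
    using a b by (auto simp: j'_def k'_def l_def)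
  have jk': "j' < k'" using jj kk ml l by (simp add: m_def)
  have ab: "a < b" using jk' grid_mono[of b a D] by (auto simp: j'_def k'_def not_less[symmetric])
  define P where "P = real k' - real j'"
  have P: "m \<le> 2 * P" "P \<le> m" using jj kk ml l by (auto simp: P_def m_def)
  have ba: "(real b - real a) * l < m + 1"
    using grid_diff[of a b D] ab P by (auto simp: P_def j'_def k'_def l_def abs_if split: if_splits)
  have bw: "(real b - real a) * w * l \<le> 2 * m * w"
  proof -
    have "(real b - real a) * l * w \<le> (2 * m) * w" using ba ml l w0 by (intro mult_right_mono) auto
    then show ?thesis by (simp add: mult_ac)
  qed
  have Wjk': "\<bar>W k' - W j'\<bar> \<le> (real b - real a) * w"
    using grid_fluctuation[OF assms(1) _ b(1), of a] ab by (simp add: j'_def k'_def w_def)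
  have Wj: "\<bar>W i - W j'\<bar> \<le> \<theta> D" if "j \<le> i" "i \<le> j'" for i using a(4)[of i] that by (simp add: j'_def)
  have Wk: "\<bar>W i - W k'\<bar> \<le> \<theta> D" if "k' \<le> i" "i \<le> k" for i using b(4)[of i] that by (simp add: k'_def)
  have th0: "0 \<le> \<theta> D" using th w0 by linarith
  have lth: "l * \<theta> D \<le> m * \<theta> D / 128" using mult_right_mono[OF ml th0] by simp
  have mth0: "0 \<le> m * \<theta> D" using th0 ml l by simp
  have Q1: "\<bar>Q W j j'\<bar> \<le> m * \<theta> D / 16"
  proof -
    have "\<bar>Q W j j'\<bar> \<le> 4 * \<theta> D * (real j' - real j)" by (rule abs_Q_le[OF Wj jj(1)])
    also have "\<dots> \<le> 4 * \<theta> D * (2 * l)" using jj th0 by (intro mult_left_mono) auto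
    finally show ?thesis using lth by (simp add: mult_ac)
  qed
  have Q2: "\<bar>Q W k' k\<bar> \<le> m * \<theta> D / 16"
  proof -
    have "\<bar>Q W k' k\<bar> \<le> 4 * \<theta> D * (real k - real k')" by (rule abs_Q_le[OF Wk kk(1)])
    also have "\<dots> \<le> 4 * \<theta> D * (2 * l)" using kk th0 by (intro mult_left_mono) auto
    finally show ?thesis using lth by (simp add: mult_ac)
  qed
  have big_term: "2 * l * \<bar>W k' - W j'\<bar> \<le> m * \<theta> D"
  proof -
    have "2 * l * \<bar>W k' - W j'\<bar> \<le> 2 * l * ((real b - real a) * w)" using Wjk' l by (intro mult_left_mono) auto
    also have "\<dots> = 2 * ((real b - real a) * w * l)" by (simp only: mult_ac)
    also have "\<dots> \<le> 2 * (2 * m * w)" using bw by linarith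
    also have "\<dots> = m * (4 * w)" by simp
    also have "\<dots> \<le> m * \<theta> D" using th ml l by (intro mult_left_mono) auto
    finally show ?thesis .
  qed
  have X1: "\<bar>(real k - real j') * (W j' - W j)\<bar> \<le> m * \<theta> D"
    unfolding abs_mult using Wj[of j] jj jk' kk by (intro mult_mono) (auto simp: m_def)
  have X2: "\<bar>(real j' - real j) * (W k - W j')\<bar> \<le> m * \<theta> D + m * \<theta> D / 16"
  proof -
    have "\<bar>(real j' - real j) * (W k - W j')\<bar> \<le> (2 * l) * (\<bar>W k' - W j'\<bar> + \<theta> D)"
      unfolding abs_mult using Wk[of k] jj kk l by (intro mult_mono) auto
    then show ?thesis using big_term lth mth0 by (simp add: distrib_left)
  qed
  have X3: "\<bar>(real k - real k') * (W k' - W j')\<bar> \<le> m * \<theta> D"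
  proof -
    have "\<bar>(real k - real k') * (W k' - W j')\<bar> \<le> (2 * l) * \<bar>W k' - W j'\<bar>"
      unfolding abs_mult using kk l by (intro mult_mono) auto
    then show ?thesis using big_term by simp
  qed
  have X4: "\<bar>(real k' - real j') * (W k - W k')\<bar> \<le> m * \<theta> D"
    unfolding abs_mult using Wk[of k] P jk' kk by (intro mult_mono) (auto simp: P_def)
  have "Q W j k = Q W j j' + Q W j' k + (real k - real j') * (W j' - W j) - (real j' - real j) * (W k - W j')"
    using jj jk' kk by (intro Q_split) auto
  moreover have "Q W j' k = Q W j' k' + Q W k' k + (real k - real k') * (W k' - W j') - (real k' - real j') * (W k - W k')"
    using jj jk' kk by (intro Q_split) auto
  ultimately have "Q W j k - Q W j' k' = Q W j j' + Q W k' k + (real k - real j') * (W j' - W j) - (real j' - real j) * (W k - W j')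
      + (real k - real k') * (W k' - W j') - (real k' - real j') * (W k - W k')" by linarith
  then have "\<bar>Q W j k - Q W j' k'\<bar> \<le> 5 * (m * \<theta> D)"
    using Q1[THEN abs_le_D1] Q1[THEN abs_le_D2] Q2[THEN abs_le_D1] Q2[THEN abs_le_D2] X1[THEN abs_le_D1] X1[THEN abs_le_D2]
      X2[THEN abs_le_D1] X2[THEN abs_le_D2] X3[THEN abs_le_D1] X3[THEN abs_le_D2] X4[THEN abs_le_D1] X4[THEN abs_le_D2] mth0
    by (intro abs_leI) linarith+
  then have QV: "\<bar>real N * Q V j k\<bar> \<le> \<bar>real N * Q V j' k'\<bar> + 5 * (m * \<theta> D)" unfolding Q_W by linarith
  have NV: "m / 2 \<le> real N * (V k - V j)"
  proof -
    have "\<bar>W k' - W j'\<bar> \<le> m / 4"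
    proof -
      have "\<bar>W k' - W j'\<bar> \<le> (real b - real a) * (l / 8)" using order.trans[OF Wjk' mult_left_mono[OF w]] ab by simp
      then show ?thesis using ba ml l by simp
    qed
    then have "\<bar>W k - W j\<bar> \<le> m / 2" using Wj[of j] Wk[of k] jj kk th ml l by linarith
    moreover have "real N * (V k - V j) = m + (W k - W j)" by (simp add: W_def m_def algebra_simps)
    ultimately show ?thesis by linarith
  qed
  have m0: "0 < m" using ml l by simp
  have Vjk: "V j < V k" using strict assms by simp
  have "\<bar>T_loc j k V\<bar> = \<bar>real N * Q V j k\<bar> / (real N * (V k - V j))"
    using T_loc_Q[OF assms(2,3)] Npos Vjk by (simp add: abs_mult)
  also have "\<dots> \<le> (\<bar>real N * Q V j' k'\<bar> + 5 * (m * \<theta> D)) / (real N * (V k - V j))"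
    using QV NV m0 by (intro divide_right_mono) auto
  also have "\<dots> = \<bar>real N * Q V j' k'\<bar> / (real N * (V k - V j)) + 5 * (m * \<theta> D) / (real N * (V k - V j))"
    by (simp add: add_divide_distrib)
  also have "\<dots> \<le> \<bar>T_loc j' k' V\<bar> + 10 * \<theta> D"
  proof (rule add_mono)
    have "\<bar>real N * Q V j' k'\<bar> / (real N * (V k - V j)) \<le> \<bar>real N * Q V j' k'\<bar> / (real N * (V k' - V j'))"
      using mono[of j j'] mono[of k' k] strict[OF jk'] jj kk jk' assms Npos by (intro divide_left_mono mult_left_mono mult_pos_pos) auto
    also have "\<dots> = \<bar>T_loc j' k' V\<bar>"
      using T_loc_Q[OF jk'] Npos strict[OF jk'] kk assms by (simp add: abs_mult)
    finally show "\<bar>real N * Q V j' k'\<bar> / (real N * (V k - V j)) \<le> \<bar>T_loc j' k' V\<bar>" .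
    have "5 * (m * \<theta> D) / (real N * (V k - V j)) \<le> 5 * (m * \<theta> D) / (m / 2)"
      using NV m0 mth0 by (intro divide_left_mono) auto
    then show "5 * (m * \<theta> D) / (real N * (V k - V j)) \<le> 10 * \<theta> D" using m0 by simp
  qed
  finally have T: "\<bar>T_loc j k V\<bar> \<le> \<bar>T_loc j' k' V\<bar> + 10 * \<theta> D" .
  have "real b - real a \<le> 2 * m / l" using ba ml l by (simp add: pos_le_divide_eq)
  then show ?thesis
    using that[OF ab b(1)] T P jj kk by (simp add: j'_def k'_def P_def m_def l_def)
qed

end

text \<open>
  The square of the penalty grows by \<open>2 log 2\<close> when the argument is halved, while the penalty itself
  is at least \<open>sqrt 2\<close> on \<open>(0,1]\<close>.
\<close>

lemma pen_half:
  assumes "0 < x" "x \<le> 2 * y" "0 < y" "x \<le> 1"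
  shows "pen y \<le> pen x + 2"
proof -
  have "ln (exp 1 / y) \<le> ln (2 * (exp 1 / x))" using assms by (subst ln_le_cancel_iff) (auto simp: field_simps)
  also have "\<dots> = ln 2 + ln (exp 1 / x)" using assms by (subst ln_mult) auto
  finally have "2 * ln (exp 1 / y) \<le> 4 + 2 * ln (exp 1 / x)" using ln_2_less_1 by linarith
  then have "pen y \<le> sqrt (4 + 2 * ln (exp 1 / x))" unfolding pen_def by simp
  also have "\<dots> \<le> sqrt 4 + sqrt (2 * ln (exp 1 / x))"
  proof -
    have "ln x \<le> 0" using assms by simp
    moreover have "ln (exp 1 / x) = 1 - ln x" using assms(1) by (subst ln_div) simp_all
    ultimately have "0 \<le> 2 * ln (exp 1 / x)" by linarith
    then show ?thesis by (intro sqrt_add_le_add_sqrt) auto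
  qed
  finally show ?thesis by (simp add: pen_def)
qed

text \<open>
  For a long pair the level \<open>D\<close> is chosen such that its length is of order \<open>(D + 8) * len D\<close>. Then it
  spans so few cells that the corresponding grid pair belongs to the controlled collection, and the
  approximation error \<open>\<theta> D\<close> is of the order of the square root of the length, which is the scale of
  the statistic.
\<close>

lemma (in increasing_points) multiscale_extension:
  fixes K :: real and R :: nat
  defines "ok \<equiv> \<lambda>j k. j + 1 < k \<longrightarrow> sqrt (3 / (real k - real j - 1)) * \<bar>T_loc j k V\<bar> - pen ((real k - real j) / real N) \<le> K"
  assumes K: "0 \<le> K" and big: "\<And>D. D \<le> R \<Longrightarrow> 640 * ((K + 2) * sqrt (real D + 8)) \<le> sqrt (len D)"
    and grids: "\<And>D a b. D \<le> R \<Longrightarrow> a < b \<Longrightarrow> b \<le> 2 ^ D \<Longrightarrow> real b - real a \<le> 64 * (real D + 8) \<Longrightarrow> ok (grid D a) (grid D b)"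
    and short: "\<And>j k. j + 1 < k \<Longrightarrow> k \<le> N \<Longrightarrow> real k - real j < max (4 * (len R)\<^sup>2) (16 * (real R + 8) * len R) \<Longrightarrow> ok j k"
    and jk: "j + 1 < k" "k \<le> N"
  shows "sqrt (3 / (real k - real j - 1)) * \<bar>T_loc j k V\<bar> - pen ((real k - real j) / real N) \<le> 2100 * (K + 3)"
proof (cases "real k - real j < max (4 * (len R)\<^sup>2) (16 * (real R + 8) * len R)")
  case True
  then show ?thesis using short[OF jk True] jk K by (simp add: ok_def)
next
  case False
  have len1: "1280 * 1280 \<le> len D" if "D \<le> R" for D
  proof -
    have "2 \<le> sqrt (real D + 8)" by (rule real_le_rsqrt) simp
    then have "2 * 2 \<le> (K + 2) * sqrt (real D + 8)" using K by (intro mult_mono) auto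
    then have "1280 \<le> sqrt (len D)" using big[OF that] by linarith
    then show ?thesis using real_sqrt_pow2[of "len D"] len_pos[of D]
      mult_mono[of 1280 "sqrt (len D)" 1280 "sqrt (len D)"] by (simp add: power2_eq_square)
  qed
  interpret controlled_points V N R "K + 2"
  proof
    fix D a :: nat assume D: "D \<le> R" and a: "a < 2 ^ D"
    define m where "m = real (grid D (a + 1)) - real (grid D a)"
    have m: "len D - 1 < m" "m < len D + 1"
      using grid_diff[of a "a + 1" D] by (auto simp: m_def abs_if split: if_splits)
    have L: "1280 * 1280 \<le> len D" by (rule len1[OF D])
    have lt: "grid D a + 1 < grid D (a + 1)" using m L unfolding m_def by linarith
    have "ok (grid D a) (grid D (a + 1))" using a by (intro grids D) auto
    then have T: "sqrt (3 / (m - 1)) * \<bar>T_loc (grid D a) (grid D (a + 1)) V\<bar> \<le> K + pen (m / real N)"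
      using lt by (simp add: ok_def m_def)
    have "pen (m / real N) \<le> 2 * sqrt (real D + 8)"
    proof -
      have "exp 1 / (m / real N) \<le> exp 1 * 2 ^ Suc D"
      proof -
        have "real N \<le> m * 2 ^ Suc D" using m L Npos by (simp add: len_def field_simps)
        then show ?thesis using m L by (simp add: field_simps)
      qed
      then have "ln (exp 1 / (m / real N)) \<le> ln (exp 1 * 2 ^ Suc D)"
        using m L Npos by (subst ln_le_cancel_iff) auto
      also have "\<dots> = 1 + real (Suc D) * ln 2" by (subst ln_mult) (auto simp: ln_realpow simp del: power_Suc)
      also have "\<dots> \<le> 1 + real (Suc D) * 1" using ln_2_less_1 by (intro add_left_mono mult_left_mono) auto
      finally have "2 * ln (exp 1 / (m / real N)) \<le> 2\<^sup>2 * (real D + 8)" by simp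
      then have "pen (m / real N) \<le> sqrt (2\<^sup>2 * (real D + 8))" unfolding pen_def by (rule real_sqrt_le_mono)
      also have "\<dots> = 2 * sqrt (real D + 8)" by (subst real_sqrt_mult) simp
      finally show ?thesis .
    qed
    moreover have "K * 1 \<le> K * sqrt (real D + 8)" using K by (intro mult_left_mono) auto
    ultimately have "sqrt (3 / (m - 1)) * \<bar>T_loc (grid D a) (grid D (a + 1)) V\<bar> \<le> (K + 2) * sqrt (real D + 8)"
      using T by (simp add: algebra_simps)
    moreover have "sqrt (1 / m) \<le> sqrt (3 / (m - 1))" using m L by (simp add: divide_simps)
    ultimately have "sqrt (1 / m) * \<bar>T_loc (grid D a) (grid D (a + 1)) V\<bar> \<le> (K + 2) * sqrt (real D + 8)"
      by (meson abs_ge_zero mult_right_mono order.trans)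
    then have "\<bar>T_loc (grid D a) (grid D (a + 1)) V\<bar> \<le> (K + 2) * sqrt (real D + 8) * sqrt m"
      using m L by (simp add: real_sqrt_divide field_simps)
    then show "\<bar>T_loc (grid D a) (grid D (a + 1)) V\<bar> \<le> (K + 2) * sqrt (real D + 8) * sqrt (real (grid D (a + 1)) - real (grid D a))"
      unfolding m_def .
  qed (use K big in auto)
  define m where "m = real k - real j"
  have mR: "4 * (len R)\<^sup>2 \<le> m" "16 * (real R + 8) * len R \<le> m" using False by (auto simp: m_def)
  (* the coarsest level whose cells are short enough; minimality bounds the number of cells spanned *)
  define D where "D = (LEAST D. 16 * (real D + 8) * len D \<le> m)"
  have D: "16 * (real D + 8) * len D \<le> m" unfolding D_def by (rule LeastI[of "\<lambda>D. 16 * (real D + 8) * len D \<le> m", OF mR(2)])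
  have DR: "D \<le> R" unfolding D_def by (rule Least_le[of "\<lambda>D. 16 * (real D + 8) * len D \<le> m", OF mR(2)])
  have mN: "m \<le> real N" "0 < m" using jk by (auto simp: m_def)
  have "D \<noteq> 0"
  proof
    assume "D = 0"
    then have "128 * real N \<le> m" using D by (simp add: len_def)
    then show False using mN by linarith
  qed
  then obtain D' where D': "D = Suc D'" by (cases D) auto
  have "\<not> 16 * (real D' + 8) * len D' \<le> m"
    using not_less_Least[of D' "\<lambda>D. 16 * (real D + 8) * len D \<le> m"] D' by (simp add: D_def)
  then have mup: "m \<le> 32 * (real D + 8) * len D" using len_pos[of D] by (simp add: D' len_Suc algebra_simps)
  have L: "1280 * 1280 \<le> len D" by (rule len1[OF DR])
  have D8: "128 * len D \<le> 16 * (real D + 8) * len D" using L by (intro mult_right_mono) auto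
  have m1: "128 * 1280 \<le> m" using D D8 L by linarith
  obtain a b where ab: "a < b" "b \<le> 2 ^ D" "j \<le> grid D a" "grid D b \<le> k"
    "m \<le> 2 * (real (grid D b) - real (grid D a))" "real b - real a \<le> 2 * m / len D"
    "\<bar>T_loc j k V\<bar> \<le> \<bar>T_loc (grid D a) (grid D b) V\<bar> + 10 * \<theta> D"
    using T_loc_approx[OF DR _ jk(2), of j] jk D unfolding m_def by auto
  define P where "P = real (grid D b) - real (grid D a)"
  have P: "P \<le> m" "m \<le> 2 * P" using ab by (auto simp: P_def m_def)
  have "2 * m / len D \<le> 64 * (real D + 8)" 
  proof -
    have "64 * (real D + 8) * len D = 2 * (32 * (real D + 8) * len D)" by simp
    then have "2 * m \<le> 64 * (real D + 8) * len D" using mup by linarith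
    then show ?thesis using L by (subst pos_divide_le_eq) auto
  qed
  then have "ok (grid D a) (grid D b)" using ab by (intro grids DR) auto
  moreover have "grid D a + 1 < grid D b"
  proof -
    have "real (grid D a) + 1 < real (grid D b)" using P m1 by (simp add: P_def)
    then show ?thesis by linarith
  qed
  ultimately have TP: "sqrt (3 / (P - 1)) * \<bar>T_loc (grid D a) (grid D b) V\<bar> \<le> K + pen (P / real N)"
    by (simp add: ok_def P_def)
  have "pen (P / real N) \<le> pen (m / real N) + 2"
    using P m1 mN by (intro pen_half) (auto simp: divide_simps)
  moreover have "sqrt (3 / (m - 1)) * \<bar>T_loc (grid D a) (grid D b) V\<bar> \<le> sqrt (3 / (P - 1)) * \<bar>T_loc (grid D a) (grid D b) V\<bar>"
    using P m1 by (intro mult_right_mono) (auto simp: frac_le)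
  moreover have "sqrt (3 / (m - 1)) * (10 * \<theta> D) \<le> 25 + 2000 * (K + 2)"
  proof -
    have "2 * len R \<le> sqrt m" using mR(1) by (intro real_le_rsqrt) (simp add: power_mult_distrib)
    moreover have "\<beta> D * sqrt (len D) \<le> (K + 2) * (sqrt m / 4)"
    proof -
      have "(real D + 8) * len D \<le> m / 4\<^sup>2" using D by (simp add: algebra_simps)
      then have "sqrt ((real D + 8) * len D) \<le> sqrt (m / 4\<^sup>2)" by simp
      then show ?thesis using K by (simp add: \<beta>_def real_sqrt_mult real_sqrt_divide mult.assoc mult_left_mono)
    qed
    ultimately have th: "\<theta> D \<le> sqrt m * (1 + 80 * (K + 2))" unfolding \<theta>_def by (simp add: algebra_simps)
    have s: "sqrt (3 / (m - 1)) \<le> 5 / 2 / sqrt m"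
    proof -
      have "3 / (m - 1) \<le> (5/2)\<^sup>2 / m" using m1 by (simp add: divide_simps power2_eq_square)
      then have "sqrt (3 / (m - 1)) \<le> sqrt ((5/2)\<^sup>2 / m)" by simp
      then show ?thesis by (simp add: real_sqrt_divide)
    qed
    have "0 \<le> \<theta> D" using \<beta>_ge[of D] len_pos[of D] len_pos[of R] by (simp add: \<theta>_def)
    then have "sqrt (3 / (m - 1)) * (10 * \<theta> D) \<le> (5 / 2 / sqrt m) * (10 * (sqrt m * (1 + 80 * (K + 2))))"
      using s th mN by (intro mult_mono) auto
    also have "\<dots> = 25 + 2000 * (K + 2)" using mN by simp
    finally show ?thesis .
  qed
  moreover have "sqrt (3 / (m - 1)) * \<bar>T_loc j k V\<bar> \<le> sqrt (3 / (m - 1)) * (\<bar>T_loc (grid D a) (grid D b) V\<bar> + 10 * \<theta> D)"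
    using ab m1 by (intro mult_left_mono) auto
  ultimately show ?thesis using TP K by (simp add: m_def distrib_left)
qed

section \<open>Boundedness of the critical values\<close>

lemma pen_antimono: "0 < x \<Longrightarrow> x \<le> y \<Longrightarrow> pen y \<le> pen x"
  unfolding pen_def by (auto simp: frac_le)

definition excess :: "nat \<Rightarrow> real \<Rightarrow> nat \<Rightarrow> nat \<Rightarrow> (nat \<Rightarrow> real) set" where
  "excess n K j k = {u \<in> space (sample_law 0 1 n (indicator {0..1})).
     K < sqrt (3 / (real k - real j - 1)) * \<bar>T_loc j k (ordered_vector 0 1 n u)\<bar> - pen ((real k - real j) / (real n + 1))}"

lemma sets_excess: "j + 1 < k \<Longrightarrow> k \<le> n + 1 \<Longrightarrow> excess n K j k \<in> sets (sample_law 0 1 n (indicator {0..1}))"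
proof -
  assume jk: "j + 1 < k" "k \<le> n + 1"
  have [measurable]: "(\<lambda>u. T_loc j k (ordered_vector 0 1 n u)) \<in> borel_measurable (sample_law 0 1 n (indicator {0..1}))"
    using measurable_T_loc[of j k n 0 1] jk unfolding measurable_cong_sets[OF sets_sample_law refl] by simp
  show ?thesis unfolding excess_def by measurable
qed

text \<open>
  Expanding \<open>(K + pen r)\<^sup>2 / 2\<close>, the square of the penalty gives the factor \<open>r\<close>, which compensates the
  number of pairs of relative length \<open>r\<close>. The mixed term \<open>K * pen r\<close> gives the additional factor
  \<open>exp (- pen r)\<close> that makes the sum over all scales converge.
\<close>

lemma prob_excess:
  assumes jk: "j + 1 < k" "k \<le> n + 1" and K: "1 \<le> K" and \<rho>: "(real k - real j) / (real n + 1) \<le> \<rho>"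
  shows "measure (sample_law 0 1 n (indicator {0..1})) (excess n K j k) \<le> 2 * exp (- K\<^sup>2 / 2) * (\<rho> * exp (- pen \<rho>))"
proof -
  let ?P = "sample_law 0 1 n (indicator {0..1})"
  interpret P: prob_space ?P by (rule prob_space_sample_law[OF uniform_density])
  define r where "r = (real k - real j) / (real n + 1)"
  have r: "0 < r" "r \<le> 1" using jk by (auto simp: r_def)
  define G where "G = pen r"
  have "ln r \<le> ln 1" using r by (subst ln_le_cancel_iff) auto
  then have "ln r < 1" unfolding ln_one by (rule le_less_trans) simp
  then have pos: "0 \<le> 2 * (1 - ln r)" by simp
  have "ln (exp 1 / r) = 1 - ln r" using r by (subst ln_div) auto
  then have Gs: "G = sqrt (2 * (1 - ln r))" by (simp only: G_def pen_def)
  have G: "0 \<le> G" "G\<^sup>2 = 2 * (1 - ln r)"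
    unfolding Gs by (rule real_sqrt_ge_zero[OF pos], rule real_sqrt_pow2[OF pos])
  define f where "f u = sqrt (3 / (real k - real j - 1)) * \<bar>T_loc j k (ordered_vector 0 1 n u)\<bar>" for u
  have [measurable]: "f \<in> borel_measurable ?P"
    using measurable_T_loc[of j k n 0 1] jk unfolding f_def measurable_cong_sets[OF sets_sample_law refl] by simp
  have "excess n K j k \<subseteq> {u \<in> space ?P. K + G \<le> f u}"
    unfolding excess_def f_def G_def r_def by auto
  then have "measure ?P (excess n K j k) \<le> measure ?P {u \<in> space ?P. K + G \<le> f u}"
    by (rule P.finite_measure_mono) measurable
  also have "\<dots> \<le> 2 * exp (- (K + G)\<^sup>2 / 2)" unfolding f_def using K G(1) by (intro T_loc_tail jk) linarith
  also have "- (K + G)\<^sup>2 / 2 = - K\<^sup>2 / 2 + ((ln r - 1) + - K * G)"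
  proof -
    have "(K + G)\<^sup>2 = K\<^sup>2 + 2 * (1 - ln r) + 2 * K * G" by (simp only: power2_sum G(2))
    then show ?thesis by (simp only:) argo
  qed
  also have "exp (- K\<^sup>2 / 2 + ((ln r - 1) + - K * G)) = exp (- K\<^sup>2 / 2) * (exp (ln r - 1) * exp (- K * G))"
    by (simp only: exp_add)
  also have "2 * (exp (- K\<^sup>2 / 2) * (exp (ln r - 1) * exp (- K * G))) \<le> 2 * (exp (- K\<^sup>2 / 2) * (\<rho> * exp (- pen \<rho>)))"
  proof (intro mult_left_mono mult_mono)
    have "exp (ln r - 1) \<le> exp (ln r)" by simp
    also have "\<dots> = r" using r by simp
    finally show "exp (ln r - 1) \<le> \<rho>" using \<rho> by (simp add: r_def)
    have "1 * G \<le> K * G" using K G by (intro mult_right_mono) auto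
    moreover have "pen \<rho> \<le> G" unfolding G_def using r \<rho> by (intro pen_antimono) (auto simp: r_def)
    ultimately show "exp (- K * G) \<le> exp (- pen \<rho>)" by simp
    show "0 \<le> \<rho>" using r \<rho> by (simp add: r_def)
  qed auto
  finally show ?thesis by simp
qed

lemma ordered_vector_increasing_points:
  assumes "distinct (points 0 1 n u)" "\<forall>i<n. 0 \<le> u i \<and> u i \<le> 1"
  shows "increasing_points (ordered_vector 0 1 n u) (n + 1)"
proof
  let ?V = "ordered_vector 0 1 n u"
  have set: "set (points 0 1 n u) = {0, 1} \<union> u ` {..<n}"
    by (auto simp: points_def)
  have in01: "0 \<le> ?V i \<and> ?V i \<le> 1" if "i \<le> n + 1" for i
  proof -
    have "?V i \<in> set (points 0 1 n u)" unfolding ordered_vector_image[symmetric] using that by auto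
    then show ?thesis using assms(2) set by auto
  qed
  have "0 \<in> ?V ` {..n+1}" "1 \<in> ?V ` {..n+1}" unfolding ordered_vector_image set by auto
  then obtain i k where ik: "i \<le> n + 1" "?V i = 0" "k \<le> n + 1" "?V k = 1" by auto
  have "?V 0 \<le> ?V i" "?V k \<le> ?V (n + 1)" using ik(1,3) by (intro ordered_vector_mono; simp)+
  then show "?V 0 = 0" "?V (n + 1) = 1" using ik in01[of 0] in01[of "n + 1"] by auto
  show "?V i < ?V j" if "i < j" "j \<le> n + 1" for i j
    using ordered_vector_strict_mono[OF assms(1)] that by auto
qed simp

definition pairs :: "nat \<Rightarrow> (nat \<times> nat) set" where "pairs n = {(j,k). j + 1 < k \<and> k \<le> n + 1}"

lemma finite_pairs: "finite (pairs n)"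
  by (rule finite_subset[of _ "{..n+1} \<times> {..n+1}"]) (auto simp: pairs_def)

lemma pairs_nonempty: "1 \<le> n \<Longrightarrow> (0, 2) \<in> pairs n"
  by (simp add: pairs_def)

lemma T_max_le_iff:
  assumes "1 \<le> n"
  shows "T_max n V \<le> x \<longleftrightarrow> (\<forall>(j,k)\<in>pairs n. sqrt (3 / (real k - real j - 1)) * \<bar>T_loc j k V\<bar>
      - pen ((real k - real j) / (real n + 1)) \<le> x)"
  unfolding T_max_def pairs_def[symmetric] using finite_pairs[of n] pairs_nonempty[OF assms]
  by (subst Max_le_iff) auto

text \<open>
  A quantile is bounded by any point at which the distribution function exceeds its level; the set
  in the infimum is bounded below because the penalised maximum is at least minus the penalty of one
  fixed pair.
\<close>

lemma kappa_le:
  assumes "1 \<le> n" "\<alpha> < 1"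
    and "1 - \<alpha> \<le> measure (sample_law 0 1 n (indicator {0..1}))
      {u \<in> space (sample_law 0 1 n (indicator {0..1})). T_max n (ordered_vector 0 1 n u) \<le> x}"
  shows "kappa n \<alpha> \<le> x"
  unfolding kappa_def
proof (rule cInf_lower)
  let ?S = "{x. 1 - \<alpha> \<le> measure (sample_law 0 1 n (indicator {0..1}))
     {u \<in> space (sample_law 0 1 n (indicator {0..1})). T_max n (ordered_vector 0 1 n u) \<le> x}}"
  show "x \<in> ?S" using assms by simp
  show "bdd_below ?S"
  proof (rule bdd_belowI)
    fix y assume y: "y \<in> ?S"
    show "- pen (2 / (real n + 1)) \<le> y"
    proof (rule ccontr)
      assume "\<not> - pen (2 / (real n + 1)) \<le> y"
      then have "\<not> T_max n V \<le> y" for V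
      proof -
        have "0 \<le> sqrt (3 / (real 2 - real 0 - 1)) * \<bar>T_loc 0 2 V\<bar>" by (intro mult_nonneg_nonneg) auto
        then have "\<not> sqrt (3 / (real 2 - real 0 - 1)) * \<bar>T_loc 0 2 V\<bar> - pen ((real 2 - real 0) / (real n + 1)) \<le> y"
          using \<open>\<not> - pen (2 / (real n + 1)) \<le> y\<close> by (simp only: of_nat_numeral of_nat_0 diff_zero)
        then show ?thesis
          using T_max_le_iff[OF assms(1), of V y] pairs_nonempty[OF assms(1)] by blast
      qed
      then have "{u \<in> space (sample_law 0 1 n (indicator {0..1})). T_max n (ordered_vector 0 1 n u) \<le> y} = {}" by auto
      moreover have "1 - \<alpha> \<le> measure (sample_law 0 1 n (indicator {0..1}))
         {u \<in> space (sample_law 0 1 n (indicator {0..1})). T_max n (ordered_vector 0 1 n u) \<le> y}" using y by (rule CollectD)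
      ultimately have "1 - \<alpha> \<le> 0" by (simp only: measure_empty)
      then show False using assms by simp
    qed
  qed
qed

text \<open>
  The union bound over all selected pairs of level \<open>D\<close>, without the factor \<open>exp (- K\<^sup>2 / 2)\<close>: there
  are \<open>64 (D + 8) 2^D\<close> pairs, each of relative length at most \<open>65 (D + 8) / 2^D\<close>.
\<close>

definition grid_sum :: "nat \<Rightarrow> real" where
  "grid_sum D = 2 * (64 * (real D + 8)) * (65 * (real D + 8)) * exp (- pen (65 * (real D + 8) / 2 ^ D))"

text \<open>
  The polynomial factors are harmless since \<open>exp (- pen (c / 2^D))\<close> decays like
  \<open>exp (- c' sqrt D)\<close>.
\<close>

lemma summable_grid_sum: "summable grid_sum"
proof (rule summable_comparison_test_bigo)
  show "summable (\<lambda>n. norm (inverse (real n ^ 2)))" using inverse_power_summable[of 2] by simp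
  show "grid_sum \<in> O(\<lambda>n. inverse (real n ^ 2))"
    unfolding grid_sum_def[abs_def] pen_def by real_asymp
qed

lemma grid_sum_nonneg: "0 \<le> grid_sum D"
  by (simp add: grid_sum_def)

lemma (in prob_space) prob_UN_le:
  assumes "finite I" "\<And>i. i \<in> I \<Longrightarrow> A i \<in> events" "\<And>i. i \<in> I \<Longrightarrow> prob (A i) \<le> c" "real (card I) \<le> m" "0 \<le> c"
  shows "prob (\<Union>i\<in>I. A i) \<le> m * c"
proof -
  have "prob (\<Union>i\<in>I. A i) \<le> (\<Sum>i\<in>I. prob (A i))" using assms by (intro finite_measure_subadditive_finite) auto
  also have "\<dots> \<le> (\<Sum>i\<in>I. c)" by (intro sum_mono assms)
  also have "\<dots> = real (card I) * c" by simp
  also have "\<dots> \<le> m * c" using assms by (intro mult_right_mono) auto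
  finally show ?thesis .
qed

text \<open>
  Here \<open>L\<close> is the binary logarithm of \<open>n + 1\<close>, rounded down, and the grids stop at a mesh size of order
  \<open>L\<^sup>2\<close>. The grid pairs and all pairs of length at most \<open>L^5\<close> each contribute at most \<open>\<alpha> / 2\<close> to the probability of
  an excess; off these events the deterministic extension bounds the whole statistic.
\<close>

lemma kappa_bounded_aux:
  fixes n L s :: nat and K \<alpha> :: real
  assumes n: "1 \<le> n" and L: "2 ^ L \<le> n + 1" "n + 1 < 2 ^ (L + 1)" and s: "L\<^sup>2 \<le> 2 ^ s" "2 ^ s \<le> 2 * L\<^sup>2" "s \<le> L"
    and L1: "640 * ((K + 2) * sqrt (real L + 8)) \<le> real L" "64 * real L ^ 4 \<le> real L ^ 5" "64 * (real L + 8) * real L ^ 2 \<le> real L ^ 5"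
    and small: "2 * real L ^ 10 * exp (- pen (real L ^ 5 / 2 ^ L)) \<le> \<alpha> / 2"
    and K: "1 \<le> K" "exp (- K\<^sup>2 / 2) * suminf grid_sum \<le> \<alpha> / 2" and \<alpha>: "\<alpha> < 1"
  shows "kappa n \<alpha> \<le> 2100 * (K + 3)"
proof -
  let ?P = "sample_law 0 1 n (indicator {0..1})"
  interpret P: prob_space ?P by (rule prob_space_sample_law[OF uniform_density])
  define N where "N = n + 1"
  interpret lin: increasing_points "\<lambda>i. real i / real N" N
    by standard (auto simp: N_def divide_strict_right_mono)
  have N0: "real N > 0" by (simp add: N_def)
  have NR: "real N = real n + 1" by (simp add: N_def)
  define R where "R = L - s"
  have lenR: "2 ^ s \<le> lin.len R" "lin.len R \<le> 2 * 2 ^ s"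
  proof -
    have "(2::real) ^ L = 2 ^ R * 2 ^ s" unfolding R_def using s by (simp flip: power_add)
    moreover have "2 ^ L \<le> real N" "real N \<le> 2 * 2 ^ L"
      using L of_nat_mono[OF L(1), where 'a = real] of_nat_mono[OF less_imp_le[OF L(2)], where 'a = real]
      by (simp_all add: N_def)
    ultimately show "2 ^ s \<le> lin.len R" "lin.len R \<le> 2 * 2 ^ s" by (simp_all add: lin.len_def field_simps)
  qed
  have s': "(real L)\<^sup>2 \<le> 2 ^ s" "2 ^ s \<le> 2 * (real L)\<^sup>2"
    using of_nat_mono[OF s(1), where 'a = real] of_nat_mono[OF s(2), where 'a = real] by simp_all
  have lenL: "(real L)\<^sup>2 \<le> lin.len R" "lin.len R \<le> 4 * (real L)\<^sup>2" using lenR s' by linarith+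
  have RL: "R \<le> L" by (simp add: R_def)
  have len1: "1 \<le> lin.len D" if "D \<le> R" for D
    using lin.len_antimono[OF that] lenR(1) one_le_power[of "2::real" s] by linarith
  define E where "E D = {(a,b). a < b \<and> b \<le> (2::nat) ^ D \<and> real b - real a \<le> 64 * (real D + 8) \<and> lin.grid D a + 1 < lin.grid D b}" for D
  have finE: "finite (E D)" for D
    by (rule finite_subset[of _ "{..2^D} \<times> {..2^D}"]) (auto simp: E_def)
  have cardE: "real (card (E D)) \<le> 2 ^ D * (64 * (real D + 8))" for D
  proof -
    have "card (E D) \<le> card ({..<(2::nat) ^ D} \<times> {..<64 * (D + 8)})"
    proof (rule card_inj_on_le)
      show "inj_on (\<lambda>(a,b). (a, b - a - 1)) (E D)" by (auto simp: inj_on_def E_def)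
      show "(\<lambda>(a,b). (a, b - a - 1)) ` E D \<subseteq> {..<(2::nat) ^ D} \<times> {..<64 * (D + 8)}"
      proof clarify
        fix a b assume "(a, b) \<in> E D"
        then have ab: "a < b" "b \<le> 2 ^ D" "real b - real a \<le> 64 * (real D + 8)" by (auto simp: E_def)
        have "real (b - a) \<le> real (64 * (D + 8))" using ab by (simp add: of_nat_diff)
        then have "b - a \<le> 64 * (D + 8)" unfolding of_nat_le_iff .
        then show "a \<in> {..<(2::nat) ^ D} \<and> b - a - 1 \<in> {..<64 * (D + 8)}" using ab by auto
      qed
    qed auto
    then have "real (card (E D)) \<le> real (2 ^ D * (64 * (D + 8)))" by (simp only: card_cartesian_product card_lessThan of_nat_le_iff)
    then show ?thesis by simp
  qed
  define G where "G D = (\<Union>(a,b)\<in>E D. excess n K (lin.grid D a) (lin.grid D b))" for D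
  (* B1: excess on a grid pair; B2: excess on a short pair *)
  define B1 where "B1 = (\<Union>D\<in>{..R}. G D)"
  define S where "S = {(j,k). j + 1 < k \<and> k \<le> N \<and> real k - real j \<le> real L ^ 5}"
  define B2 where "B2 = (\<Union>(j,k)\<in>S. excess n K j k)"
  have ev1: "(case c of (a, b) \<Rightarrow> excess n K (lin.grid D a) (lin.grid D b)) \<in> P.events" if "c \<in> E D" for c D
    using that lin.grid_le[of "snd c" D] by (auto simp: E_def N_def intro!: sets_excess split: prod.splits)
  have ev1D: "G D \<in> P.events" for D
    unfolding G_def using finE ev1 by (intro sets.finite_UN) auto
  have "P.prob (G D) \<le> exp (- K\<^sup>2 / 2) * grid_sum D" if D: "D \<le> R" for D
  proof -
    define \<rho> where "\<rho> = 65 * (real D + 8) / 2 ^ D"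
    have "P.prob (G D) \<le> (2 ^ D * (64 * (real D + 8))) * (2 * exp (- K\<^sup>2 / 2) * (\<rho> * exp (- pen \<rho>)))"
      unfolding G_def
    proof (rule P.prob_UN_le[OF finE ev1 _ cardE])
      fix c assume c: "c \<in> E D"
      then obtain a b where ab: "c = (a,b)" "a < b" "b \<le> 2 ^ D" "real b - real a \<le> 64 * (real D + 8)" "lin.grid D a + 1 < lin.grid D b"
        by (auto simp: E_def)
      have "real (lin.grid D b) - real (lin.grid D a) \<le> (real b - real a) * lin.len D + 1"
        using lin.grid_diff[of a b D] ab by (auto simp: abs_if split: if_splits)
      also have "\<dots> \<le> (64 * (real D + 8)) * lin.len D + lin.len D"
        using ab len1[OF D] by (intro add_mono mult_right_mono) auto
      also have "\<dots> \<le> 65 * (real D + 8) * lin.len D" using len1[OF D] by (simp add: algebra_simps)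
      finally have "(real (lin.grid D b) - real (lin.grid D a)) / real N \<le> 65 * (real D + 8) * lin.len D / real N"
        using N0 by (intro divide_right_mono) auto
      also have "\<dots> = \<rho>" using N0 by (simp add: \<rho>_def lin.len_def)
      finally have \<rho>: "(real (lin.grid D b) - real (lin.grid D a)) / (real n + 1) \<le> \<rho>" by (simp only: NR)
      show "P.prob (case c of (a, b) \<Rightarrow> excess n K (lin.grid D a) (lin.grid D b)) \<le> 2 * exp (- K\<^sup>2 / 2) * (\<rho> * exp (- pen \<rho>))"
        using prob_excess[OF ab(5) _ K(1) \<rho>] lin.grid_le[OF ab(3)] by (simp add: ab(1) N_def)
    qed (auto simp: \<rho>_def)
    also have "\<dots> = exp (- K\<^sup>2 / 2) * grid_sum D" by (simp add: grid_sum_def \<rho>_def)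
    finally show ?thesis .
  qed
  note probG = this
  have "P.prob B1 \<le> (\<Sum>D\<le>R. P.prob (G D))"
    unfolding B1_def using ev1D by (intro P.finite_measure_subadditive_finite) auto
  also have "\<dots> \<le> (\<Sum>D\<le>R. exp (- K\<^sup>2 / 2) * grid_sum D)"
    by (intro sum_mono probG) simp
  also have "\<dots> = exp (- K\<^sup>2 / 2) * (\<Sum>D\<in>{..R}. grid_sum D)" by (simp add: sum_distrib_left)
  also have "\<dots> \<le> exp (- K\<^sup>2 / 2) * suminf grid_sum"
    by (intro mult_left_mono sum_le_suminf summable_grid_sum) (auto simp: grid_sum_nonneg)
  finally have B1: "P.prob B1 \<le> \<alpha> / 2" using K by simp
  have finS: "finite S" by (rule finite_subset[of _ "{..N} \<times> {..N}"]) (auto simp: S_def)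
  have cardS: "real (card S) \<le> real N * real L ^ 5"
  proof -
    have "card S \<le> card ({..<N} \<times> {..<L ^ 5})"
    proof (rule card_inj_on_le)
      show "inj_on (\<lambda>(a,b). (a, b - a - 1)) S" by (auto simp: inj_on_def S_def)
      show "(\<lambda>(a,b). (a, b - a - 1)) ` S \<subseteq> {..<N} \<times> {..<L ^ 5}"
      proof clarify
        fix a b assume "(a, b) \<in> S"
        then have ab: "a + 1 < b" "b \<le> N" "real b - real a \<le> real L ^ 5" by (auto simp: S_def)
        have "real (b - a) \<le> real (L ^ 5)" using ab by (simp add: of_nat_diff)
        then have "b - a \<le> L ^ 5" unfolding of_nat_le_iff .
        then show "a \<in> {..<N} \<and> b - a - 1 \<in> {..<L ^ 5}" using ab by auto
      qed
    qed auto
    then have "real (card S) \<le> real (N * L ^ 5)" by (simp only: card_cartesian_product card_lessThan of_nat_le_iff)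
    then show ?thesis by simp
  qed
  have ev2: "(case c of (j, k) \<Rightarrow> excess n K j k) \<in> P.events" if "c \<in> S" for c
    using that by (auto simp: S_def N_def intro!: sets_excess)
  define r where "r = real L ^ 5 / real N"
  have "P.prob B2 \<le> (real N * real L ^ 5) * (2 * exp (- K\<^sup>2 / 2) * (r * exp (- pen r)))"
    unfolding B2_def
  proof (rule P.prob_UN_le[OF finS ev2 _ cardS])
    fix c assume "c \<in> S"
    then obtain j k where jk: "c = (j,k)" "j + 1 < k" "k \<le> N" "real k - real j \<le> real L ^ 5" by (auto simp: S_def)
    then have "(real k - real j) / (real n + 1) \<le> r" unfolding r_def NR by (simp add: divide_right_mono)
    then show "P.prob (case c of (j, k) \<Rightarrow> excess n K j k) \<le> 2 * exp (- K\<^sup>2 / 2) * (r * exp (- pen r))"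
      using prob_excess[OF jk(2) _ K(1)] jk by (simp add: N_def)
  qed (auto simp: r_def)
  also have "\<dots> = (2 * real L ^ 10 * exp (- pen r)) * exp (- K\<^sup>2 / 2)"
  proof -
    have Nr: "real N * r = real L ^ 5" using N0 by (simp add: r_def)
    have "(real N * real L ^ 5) * (2 * exp (- K\<^sup>2 / 2) * (r * exp (- pen r)))
      = 2 * (real L ^ 5 * (real N * r)) * exp (- pen r) * exp (- K\<^sup>2 / 2)" by (simp only: mult_ac)
    also have "real L ^ 5 * (real N * r) = real L ^ 10" unfolding Nr power_add[symmetric] by simp
    finally show ?thesis .
  qed
  also have "\<dots> \<le> (2 * real L ^ 10 * exp (- pen (real L ^ 5 / 2 ^ L))) * 1"
  proof (intro mult_mono)
    show "exp (- pen r) \<le> exp (- pen (real L ^ 5 / 2 ^ L))"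
    proof (cases "L = 0")
      case False
      have "2 ^ L \<le> real N" using of_nat_mono[OF L(1), where 'a = real] by (simp add: N_def)
      then have "r \<le> real L ^ 5 / 2 ^ L" unfolding r_def by (intro divide_left_mono) (auto simp: N_def)
      moreover have "0 < r" using False N0 by (simp add: r_def)
      ultimately show ?thesis using pen_antimono by simp
    qed (simp add: r_def)
  qed auto
  finally have B2: "P.prob B2 \<le> \<alpha> / 2" using small by simp
  have evB: "B1 \<in> P.events" "B2 \<in> P.events"
    unfolding B1_def B2_def by (rule sets.finite_UN[OF _ ev1D], simp) (rule sets.finite_UN[OF finS ev2])
  have "P.prob (B1 \<union> B2) \<le> \<alpha>" using B1 B2 evB measure_Un_le[OF evB] by simp
  let ?T = "{u \<in> space ?P. T_max n (ordered_vector 0 1 n u) \<le> 2100 * (K + 3)}"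
  have evT: "?T \<in> P.events"
  proof -
    have "?T = space ?P - (\<Union>(j,k)\<in>pairs n. excess n (2100 * (K + 3)) j k)"
      unfolding T_max_le_iff[OF n] excess_def by (auto simp: not_less)
    moreover have "(\<Union>(j,k)\<in>pairs n. excess n (2100 * (K + 3)) j k) \<in> P.events"
      using finite_pairs by (intro sets.finite_UN) (auto simp: pairs_def intro!: sets_excess)
    ultimately show ?thesis by simp
  qed
  have good: "T_max n (ordered_vector 0 1 n u) \<le> 2100 * (K + 3)"
    if u: "u \<in> space ?P" "u \<notin> B1" "u \<notin> B2" "distinct (points 0 1 n u)" "\<forall>i<n. 0 \<le> u i \<and> u i \<le> 1" for u
  proof -
    define V where "V = ordered_vector 0 1 n u"
    interpret V: increasing_points V N
      unfolding V_def N_def by (rule ordered_vector_increasing_points[OF u(4,5)])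
    have "sqrt (3 / (real k - real j - 1)) * \<bar>T_loc j k V\<bar> - pen ((real k - real j) / real N) \<le> 2100 * (K + 3)"
      if jk: "j + 1 < k" "k \<le> N" for j k
    proof (rule V.multiscale_extension[where R = R])
      show "0 \<le> K" using K by simp
      fix D assume D: "D \<le> R"
      show "640 * ((K + 2) * sqrt (real D + 8)) \<le> sqrt (V.len D)"
      proof -
        have "640 * ((K + 2) * sqrt (real D + 8)) \<le> 640 * ((K + 2) * sqrt (real L + 8))"
          using D RL K by (intro mult_left_mono) auto
        also have "\<dots> \<le> real L" by (rule L1)
        also have "\<dots> \<le> sqrt (lin.len R)" using lenL by (intro real_le_rsqrt) auto
        also have "\<dots> \<le> sqrt (lin.len D)" using lin.len_antimono[OF D] by simp
        finally show ?thesis .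
      qed
    next
      fix D a b assume h: "D \<le> R" "a < b" "b \<le> 2 ^ D" "real b - real a \<le> 64 * (real D + 8)"
      show "V.grid D a + 1 < V.grid D b \<longrightarrow> sqrt (3 / (real (V.grid D b) - real (V.grid D a) - 1)) * \<bar>T_loc (V.grid D a) (V.grid D b) V\<bar> -
          pen ((real (V.grid D b) - real (V.grid D a)) / real N) \<le> K"
      proof
        assume "V.grid D a + 1 < V.grid D b"
        then have "(a, b) \<in> E D" using h by (simp add: E_def)
        then have "u \<notin> excess n K (lin.grid D a) (lin.grid D b)" using u(2) h by (auto simp: B1_def G_def)
        then show "sqrt (3 / (real (V.grid D b) - real (V.grid D a) - 1)) * \<bar>T_loc (V.grid D a) (V.grid D b) V\<bar> -
          pen ((real (V.grid D b) - real (V.grid D a)) / real N) \<le> K"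
          using u(1) by (simp add: excess_def V_def NR not_less)
      qed
    next
      fix j k assume h: "j + 1 < k" "k \<le> N" "real k - real j < max (4 * (V.len R)\<^sup>2) (16 * (real R + 8) * V.len R)"
      have "4 * (lin.len R)\<^sup>2 \<le> 4 * (4 * (real L)\<^sup>2)\<^sup>2" using lenL lin.len_pos[of R] by (intro mult_left_mono power_mono) auto
      also have "\<dots> = 64 * real L ^ 4" by (simp add: power2_eq_square power4_eq_xxxx)
      finally have m1: "4 * (lin.len R)\<^sup>2 \<le> real L ^ 5" using L1 by simp
      have "16 * (real R + 8) * lin.len R \<le> 16 * (real L + 8) * (4 * (real L)\<^sup>2)"
        using lenL RL lin.len_pos[of R] by (intro mult_mono) auto
      also have "\<dots> = 64 * (real L + 8) * real L ^ 2" by simp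
      also have "\<dots> \<le> real L ^ 5" by (rule L1)
      finally have m2: "16 * (real R + 8) * lin.len R \<le> real L ^ 5" .
      have "(j, k) \<in> S" using h m1 m2 by (auto simp: S_def)
      then have "u \<notin> excess n K j k" using u(3) by (auto simp: B2_def)
      then show "j + 1 < k \<longrightarrow> sqrt (3 / (real k - real j - 1)) * \<bar>T_loc j k V\<bar> - pen ((real k - real j) / real N) \<le> K"
        using u(1) by (simp add: excess_def V_def NR not_less)
    qed (rule jk)+
    then show ?thesis unfolding T_max_le_iff[OF n] NR by (auto simp: pairs_def V_def N_def)
  qed
  have "1 - \<alpha> \<le> 1 - P.prob (B1 \<union> B2)" using \<open>P.prob (B1 \<union> B2) \<le> \<alpha>\<close> by simp
  also have "\<dots> = P.prob (space ?P - (B1 \<union> B2))" using evB by (subst P.prob_compl) auto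
  also have "\<dots> \<le> P.prob ?T"
  proof (rule P.finite_measure_mono_AE[OF _ evT])
    have "AE u in ?P. distinct (points 0 1 n u) \<and> (\<forall>i<n. 0 \<le> u i \<and> u i \<le> 1)"
      using AE_uniform_sample[of n] unfolding sample_law_eq sample_size_01 .
    then show "AE u in ?P. u \<in> space ?P - (B1 \<union> B2) \<longrightarrow> u \<in> ?T"
      by eventually_elim (use good in auto)
  qed
  finally show ?thesis by (rule kappa_le[OF n \<alpha>])
qed

theorem kappa_bounded:
  fixes \<alpha> :: real
  assumes "0 < \<alpha>" "\<alpha> < 1"
  shows "\<exists>K. \<forall>\<^sub>F n in sequentially. kappa n \<alpha> \<le> K"
proof -
  have "((\<lambda>K. exp (- K\<^sup>2 / 2) * suminf grid_sum) \<longlongrightarrow> 0 * suminf grid_sum) at_top"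
    by (intro tendsto_mult tendsto_const) real_asymp
  then have "\<forall>\<^sub>F K in at_top. exp (- K\<^sup>2 / 2) * suminf grid_sum < \<alpha> / 2"
    using assms by (intro order_tendstoD) auto
  then have "\<forall>\<^sub>F K in at_top. 1 \<le> K \<and> exp (- K\<^sup>2 / 2) * suminf grid_sum < \<alpha> / 2"
    by (intro eventually_conj eventually_ge_at_top)
  then obtain K :: real where K: "1 \<le> K" "exp (- K\<^sup>2 / 2) * suminf grid_sum \<le> \<alpha> / 2"
    by (auto simp: eventually_at_top_linorder intro: less_imp_le)
  have "\<forall>\<^sub>F L in sequentially. 640 * ((K + 2) * sqrt (real L + 8)) \<le> real L"
    by real_asymp
  moreover have "\<forall>\<^sub>F L in sequentially. 64 * real L ^ 4 \<le> real L ^ 5" by real_asymp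
  moreover have "\<forall>\<^sub>F L in sequentially. 64 * (real L + 8) * real L ^ 2 \<le> real L ^ 5" by real_asymp
  moreover have "\<forall>\<^sub>F L in sequentially. 2 * real L ^ 2 \<le> 2 ^ L" by real_asymp
  moreover have "\<forall>\<^sub>F L in sequentially. 2 * real L ^ 10 * exp (- pen (real L ^ 5 / 2 ^ L)) \<le> \<alpha> / 2"
  proof -
    have "(\<lambda>L. 2 * real L ^ 10 * exp (- pen (real L ^ 5 / 2 ^ L))) \<longlonglongrightarrow> 0" unfolding pen_def by real_asymp
    then have "\<forall>\<^sub>F L in sequentially. 2 * real L ^ 10 * exp (- pen (real L ^ 5 / 2 ^ L)) < \<alpha> / 2"
      using assms by (intro order_tendstoD) auto
    then show ?thesis by eventually_elim simp
  qed
  moreover have "\<forall>\<^sub>F L in sequentially. 1 \<le> (L::nat)" by (rule eventually_ge_at_top)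
  ultimately have "\<forall>\<^sub>F L in sequentially. 640 * ((K + 2) * sqrt (real L + 8)) \<le> real L \<and> 64 * real L ^ 4 \<le> real L ^ 5 \<and>
     64 * (real L + 8) * real L ^ 2 \<le> real L ^ 5 \<and> 2 * real L ^ 2 \<le> 2 ^ L \<and>
     2 * real L ^ 10 * exp (- pen (real L ^ 5 / 2 ^ L)) \<le> \<alpha> / 2 \<and> 1 \<le> L" by eventually_elim simp
  then obtain L0 where L0: "\<And>L. L0 \<le> L \<Longrightarrow> 640 * ((K + 2) * sqrt (real L + 8)) \<le> real L \<and> 64 * real L ^ 4 \<le> real L ^ 5 \<and>
     64 * (real L + 8) * real L ^ 2 \<le> real L ^ 5 \<and> 2 * real L ^ 2 \<le> 2 ^ L \<and>
     2 * real L ^ 10 * exp (- pen (real L ^ 5 / 2 ^ L)) \<le> \<alpha> / 2 \<and> 1 \<le> L"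
    unfolding eventually_sequentially by blast
  have "kappa n \<alpha> \<le> 2100 * (K + 3)" if n: "2 ^ L0 \<le> n" "1 \<le> n" for n
  proof -
    obtain L where L: "2 ^ L \<le> n + 1" "n + 1 < 2 ^ (L + 1)" using ex_power_ivl1[of 2 "n + 1"] by auto
    have "L0 \<le> L"
    proof (rule ccontr)
      assume "\<not> L0 \<le> L"
      then have "(2::nat) ^ (L + 1) \<le> 2 ^ L0" by (intro power_increasing) auto
      then show False using L n by simp
    qed
    note h = L0[OF this]
    obtain s where s: "2 ^ s \<le> L\<^sup>2" "L\<^sup>2 < 2 ^ (s + 1)" using ex_power_ivl1[of 2 "L\<^sup>2"] h by auto
    have "s + 1 \<le> L"
    proof -
      have "real (2 ^ (s + 1)) \<le> real (2 * L\<^sup>2)" using s by (intro of_nat_mono) simp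
      also have "\<dots> \<le> 2 ^ L" using h by simp
      finally have "(2::real) ^ (s + 1) \<le> 2 ^ L" by simp
      then show ?thesis by (simp only: power_increasing_iff one_less_numeral_iff semiring_norm)
    qed
    then show ?thesis
      using h s by (intro kappa_bounded_aux[OF n(2) L _ _ _ _ _ _ _ K \<open>\<alpha> < 1\<close>, of "s + 1"]) auto
  qed
  then show ?thesis
    by (intro exI[of _ "2100 * (K + 3)"] eventually_sequentiallyI[of "1 + 2 ^ L0"]) auto
qed

section \<open>Likelihood ratios and steep densities\<close>

lemma test_measurable:
  assumes "is_test n \<phi>"
  shows "(\<lambda>y. \<phi> (ordered_vector a b n y)) \<in> borel_measurable (sample_law a b n f)"
  using assms measurable_compose[OF measurable_ordered_vector, of \<phi> n borel a b]
  unfolding measurable_cong_sets[OF sets_sample_law refl] by (simp add: is_test_def)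

lemma test_bounds:
  assumes "is_test n \<phi>"
  shows "0 \<le> \<phi> (ordered_vector a b n y)" "\<phi> (ordered_vector a b n y) \<le> 1"
proof -
  have "ordered_vector a b n y \<in> space (PiM {..n+1} (\<lambda>_. borel :: real measure))"
    by (auto simp: space_PiM ordered_vector_def)
  then show "0 \<le> \<phi> (ordered_vector a b n y)" "\<phi> (ordered_vector a b n y) \<le> 1"
    using assms unfolding is_test_def by blast+
qed

lemma test_integrable:
  assumes "is_test n \<phi>" "f \<in> densities a' b'"
  shows "integrable (sample_law a b n f) (\<lambda>y. \<phi> (ordered_vector a b n y))"
proof -
  interpret prob_space "sample_law a b n f" by (rule prob_space_sample_law[OF assms(2)])
  show ?thesis
    by (rule integrable_const_bound[of _ 1]) (auto simp: test_bounds[OF assms(1)] intro: test_measurable[OF assms(1)])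
qed

definition lik :: "nat \<Rightarrow> (real \<Rightarrow> real) \<Rightarrow> (nat \<Rightarrow> real) \<Rightarrow> real" where
  "lik m \<rho> y = (\<Prod>i<m. \<rho> (y i))"

lemma lik_nonneg: "(\<And>x. 0 \<le> \<rho> x) \<Longrightarrow> 0 \<le> lik m \<rho> y"
  by (simp add: lik_def prod_nonneg)

lemma measurable_lik:
  assumes [measurable]: "\<rho> \<in> borel_measurable borel"
  shows "lik (sample_size a b n) \<rho> \<in> borel_measurable (sample_law a b n f)"
proof -
  have "lik (sample_size a b n) \<rho> \<in> borel_measurable (PiM {..<sample_size a b n} (\<lambda>_. borel))"
    unfolding lik_def by measurable
  then show ?thesis unfolding measurable_cong_sets[OF sets_sample_law refl] .
qed

lemma sample_law_density:
  assumes "f \<in> densities a' b'" "g \<in> densities a' b'" "\<rho> \<in> borel_measurable borel" "\<And>x. 0 \<le> \<rho> x"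
    and "\<And>x. g x = f x * \<rho> x"
  shows "sample_law a b n g = density (sample_law a b n f) (\<lambda>y. ennreal (lik (sample_size a b n) \<rho> y))"
  unfolding sample_law_eq lik_def by (rule PiM_law_density[OF assms]) auto

lemma integral_sample_law_density:
  fixes \<psi> :: "(nat \<Rightarrow> real) \<Rightarrow> real"
  assumes "f \<in> densities a' b'" "g \<in> densities a' b'" "\<rho> \<in> borel_measurable borel" "\<And>x. 0 \<le> \<rho> x"
    and "\<And>x. g x = f x * \<rho> x" and \<psi>: "\<psi> \<in> borel_measurable (sample_law a b n f)"
  shows "(LINT y|sample_law a b n g. \<psi> y) = (LINT y|sample_law a b n f. lik (sample_size a b n) \<rho> y * \<psi> y)"
    "integrable (sample_law a b n g) \<psi> \<longleftrightarrow> integrable (sample_law a b n f) (\<lambda>y. lik (sample_size a b n) \<rho> y * \<psi> y)"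
  unfolding sample_law_density[OF assms(1-5)]
  using \<psi> measurable_lik[OF assms(3), of a b n f] lik_nonneg[of \<rho>, OF assms(4)]
  by (simp_all add: integral_density integrable_density)

lemma nn_integral_lik:
  fixes \<rho> :: "real \<Rightarrow> ennreal"
  assumes f: "f \<in> densities a' b'" and [measurable]: "\<rho> \<in> borel_measurable borel"
  shows "(\<integral>\<^sup>+ y. (\<Prod>i<sample_size a b n. \<rho> (y i)) \<partial>sample_law a b n f) = (\<integral>\<^sup>+ x. ennreal (f x) * \<rho> x \<partial>lborel) ^ sample_size a b n"
proof -
  interpret prob_space "law f" by (rule prob_space_law[OF f])
  interpret product_sigma_finite "\<lambda>_::nat. law f" by standard
  have "(\<integral>\<^sup>+ y. (\<Prod>i<sample_size a b n. \<rho> (y i)) \<partial>sample_law a b n f) = (\<Prod>i<sample_size a b n. \<integral>\<^sup>+ x. \<rho> x \<partial>law f)"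
    unfolding sample_law_eq by (intro product_nn_integral_prod) auto
  also have "(\<integral>\<^sup>+ x. \<rho> x \<partial>law f) = (\<integral>\<^sup>+ x. ennreal (f x) * \<rho> x \<partial>lborel)"
    unfolding law_def using densitiesD(1)[OF f] by (intro nn_integral_density) auto
  finally show ?thesis by simp
qed

lemma integrable_density_fun:
  assumes "f \<in> densities a b" shows "integrable lborel f"
  using densitiesD[OF assms] by (intro integrableI_nonneg) auto

lemma nn_mass:
  assumes f: "f \<in> densities a b" and I: "I \<in> sets borel"
  shows "(\<integral>\<^sup>+ x. ennreal (f x) * indicator I x \<partial>lborel) = ennreal (mass f I)"
proof -
  have "integrable lborel (\<lambda>x. indicator I x *\<^sub>R f x)"
    using integrable_density_fun[OF f] I by (intro integrable_mult_indicator) auto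
  then have "(\<integral>\<^sup>+ x. ennreal (indicator I x *\<^sub>R f x) \<partial>lborel) = ennreal (mass f I)"
    unfolding mass_def set_lebesgue_integral_def using densitiesD(2)[OF f]
    by (intro nn_integral_eq_integral) auto
  moreover have "ennreal (indicator I x *\<^sub>R f x) = ennreal (f x) * indicator I x" for x
    by (cases "x \<in> I") auto
  ultimately show ?thesis by simp
qed

lemma mass_nonneg: "f \<in> densities a b \<Longrightarrow> 0 \<le> mass f I"
  unfolding mass_def set_lebesgue_integral_def using densitiesD(2)[of f a b] by (intro integral_nonneg_AE) auto

lemma mass_eqI:
  assumes f: "f \<in> densities a b" and I: "I \<in> sets borel" and "0 \<le> \<delta>"
    "(\<integral>\<^sup>+ x. ennreal (f x) * indicator I x \<partial>lborel) = ennreal \<delta>"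
  shows "mass f I = \<delta>"
  using nn_mass[OF f I] assms mass_nonneg[OF f] by simp

text \<open>
  All alternatives and null densities for the lower bounds arise by redistributing the mass on one
  interval.
\<close>

lemma replace_density:
  assumes g: "g \<in> densities a b" and I: "I \<in> sets borel" and p: "p \<in> borel_measurable borel" "\<And>x. x \<in> I \<Longrightarrow> 0 \<le> p x"
    and mp: "(\<integral>\<^sup>+ x. ennreal (p x) * indicator I x \<partial>lborel) = ennreal (mass g I)"
    and supp: "\<And>x. x \<in> I \<Longrightarrow> \<not> (a \<le> ereal x \<and> ereal x \<le> b) \<Longrightarrow> p x = 0"
  shows "(\<lambda>x. if x \<in> I then p x else g x) \<in> densities a b" "mass (\<lambda>x. if x \<in> I then p x else g x) I = mass g I"
proof -
  note [measurable] = p(1) I densitiesD(1)[OF g]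
  let ?f = "\<lambda>x. if x \<in> I then p x else g x"
  have "(\<integral>\<^sup>+ x. ennreal (?f x) \<partial>lborel) = (\<integral>\<^sup>+ x. ennreal (p x) * indicator I x + ennreal (g x) * indicator (- I) x \<partial>lborel)"
    by (intro nn_integral_cong) (auto simp: indicator_def)
  also have "\<dots> = ennreal (mass g I) + (\<integral>\<^sup>+ x. ennreal (g x) * indicator (- I) x \<partial>lborel)"
    by (subst nn_integral_add) (auto simp: mp)
  also have "\<dots> = (\<integral>\<^sup>+ x. ennreal (g x) * indicator I x + ennreal (g x) * indicator (- I) x \<partial>lborel)"
    unfolding nn_mass[OF g I, symmetric] by (subst nn_integral_add) auto
  also have "\<dots> = (\<integral>\<^sup>+ x. ennreal (g x) \<partial>lborel)"
    by (intro nn_integral_cong) (auto simp: indicator_def)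
  finally have 1: "(\<integral>\<^sup>+ x. ennreal (?f x) \<partial>lborel) = 1" using densitiesD(3)[OF g] by simp
  show f: "?f \<in> densities a b"
    unfolding densities_def using 1 densitiesD(2)[OF g] p(2) densitiesD(4)[OF g] supp by auto
  have "(\<integral>\<^sup>+ x. ennreal (?f x) * indicator I x \<partial>lborel) = (\<integral>\<^sup>+ x. ennreal (p x) * indicator I x \<partial>lborel)"
    by (intro nn_integral_cong) (auto simp: indicator_def)
  then show "mass ?f I = mass g I" using mp mass_nonneg[OF g] by (intro mass_eqI[OF f I]) auto
qed

text \<open>
  The end points are excluded because the antiderivative may be a square root that vanishes there.
\<close>

lemma nn_integral_interior_FTC:
  fixes f F :: "real \<Rightarrow> real"
  assumes [measurable]: "f \<in> borel_measurable borel" and "l \<le> r" "continuous_on {l..r} F"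
    and F: "\<And>x. x \<in> {l<..<r} \<Longrightarrow> (F has_real_derivative f x) (at x)" "\<And>x. x \<in> {l<..<r} \<Longrightarrow> 0 \<le> f x"
  shows "(\<integral>\<^sup>+ x. ennreal (f x) * indicator {l<..<r} x \<partial>lborel) = ennreal (F r - F l)"
proof -
  have "(f has_integral (F r - F l)) {l..r}"
    using assms by (intro fundamental_theorem_of_calculus_interior) (auto simp: has_real_derivative_iff_has_vector_derivative)
  then have "(f has_integral (F r - F l)) {l<..<r}"
    by (simp add: has_integral_Icc_iff_Ioo)
  then have "((\<lambda>x. if x \<in> {l<..<r} then f x else 0) has_integral (F r - F l)) UNIV"
    by (subst has_integral_restrict_UNIV)
  then have "(\<integral>\<^sup>+ x. ennreal (if x \<in> {l<..<r} then f x else 0) \<partial>lborel) = ennreal (F r - F l)"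
    using F(2) by (intro nn_integral_has_integral_lborel) auto
  moreover have "(\<integral>\<^sup>+ x. ennreal (if x \<in> {l<..<r} then f x else 0) \<partial>lborel) = (\<integral>\<^sup>+ x. ennreal (f x) * indicator {l<..<r} x \<partial>lborel)"
    by (intro nn_integral_cong) (auto simp: indicator_def)
  ultimately show ?thesis by simp
qed

text \<open>
  Since \<open>0 < \<delta>\<close>, the factor of the infimum in the definition of \<open>H\<close> is positive and finite and can be
  divided out.
\<close>

lemma F_class_slope:
  assumes f: "f \<in> F_class a b {l<..<r} \<delta> \<eta>" and "l < r" "0 < \<delta>" and xy: "l < x" "x < y" "y < r"
  shows "\<eta> * sqrt \<delta> / (r - l)\<^sup>2 * (y - x) \<le> f y - f x"
proof -
  define c where "c = (r - l)\<^sup>2 / sqrt \<delta>"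
  have c: "0 < c" using assms by (simp add: c_def)
  have "ereal \<eta> \<le> inf_slope f {l<..<r} * ereal c"
    using f \<open>l < r\<close> by (auto simp: F_class_def H_def c_def)
  also have "\<dots> \<le> ereal ((f y - f x) / (y - x)) * ereal c"
    unfolding inf_slope_def using c xy by (intro ereal_mult_right_mono INF_lower2[of "(x, y)"]) auto
  finally have "\<eta> \<le> (f y - f x) / (y - x) * c" by simp
  then have "\<eta> / c * (y - x) \<le> f y - f x" using c xy by (simp add: field_simps)
  then show ?thesis by (simp add: c_def)
qed

lemma F_classI:
  assumes "f \<in> densities a b" "mass f {l<..<r} = \<delta>" "l < r" "0 < \<delta>"
    and sl: "\<And>x y. l < x \<Longrightarrow> x < y \<Longrightarrow> y < r \<Longrightarrow> \<eta> * sqrt \<delta> / (r - l)\<^sup>2 * (y - x) \<le> f y - f x"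
  shows "f \<in> F_class a b {l<..<r} \<delta> \<eta>"
proof -
  define c where "c = (r - l)\<^sup>2 / sqrt \<delta>"
  have c: "0 < c" using assms by (simp add: c_def)
  have "ereal (\<eta> / c) \<le> inf_slope f {l<..<r}"
    unfolding inf_slope_def
  proof (intro INF_greatest)
    fix z assume "z \<in> {(x, y). x \<in> {l<..<r} \<and> y \<in> {l<..<r} \<and> x < y}"
    then obtain x y where z: "z = (x, y)" "l < x" "x < y" "y < r" by auto
    have "\<eta> / c * (y - x) \<le> f y - f x" using sl[OF z(2-4)] by (simp add: c_def)
    then show "ereal (\<eta> / c) \<le> (case z of (x, y) \<Rightarrow> ereal ((f y - f x) / (y - x)))"
      using z by (simp add: pos_le_divide_eq)
  qed
  then have "ereal (\<eta> / c) * ereal c \<le> inf_slope f {l<..<r} * ereal c"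
    using c by (intro ereal_mult_right_mono) auto
  then have "ereal \<eta> \<le> inf_slope f {l<..<r} * ereal c" using c by simp
  then show ?thesis using assms by (simp add: F_class_def H_def c_def)
qed

lemma AE_zero_interval:
  fixes P :: "real \<Rightarrow> bool"
  assumes "AE x in lborel. P x" "u < v"
  obtains x where "u < x" "x < v" "P x"
proof (rule ccontr)
  assume "\<not> thesis"
  then have no: "\<And>x. u < x \<Longrightarrow> x < v \<Longrightarrow> \<not> P x" using that by blast
  have "AE x in lborel. x \<notin> {u<..<v}" using assms(1) by eventually_elim (use no in auto)
  then have "emeasure lborel {u<..<v} = 0" by (subst (asm) AE_iff_measurable[of "{u<..<v}"]) auto
  then show False using assms(2) by simp
qed

text \<open>
  A strictly increasing nonnegative function is positive to the right of each point of the interval,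
  so no part of the interval can leave the known support.
\<close>

lemma steep_support:
  assumes f: "f \<in> densities a b" and \<sigma>: "0 < \<sigma>"
    and sl: "\<And>x y. l < x \<Longrightarrow> x < y \<Longrightarrow> y < r \<Longrightarrow> \<sigma> * (y - x) \<le> f y - f x" and x: "l < x" "x < r"
  shows "a < ereal x" "ereal x < b"
proof -
  have pos: "0 < f y" if "l < y" "y < r" for y
  proof -
    have "\<sigma> * (y - (l + y) / 2) \<le> f y - f ((l + y) / 2)" using that by (intro sl) auto
    moreover have "0 < \<sigma> * (y - (l + y) / 2)" using that \<sigma> by (intro mult_pos_pos) auto
    ultimately show ?thesis using densitiesD(2)[OF f, of "(l + y) / 2"] by linarith
  qed
  show "a < ereal x"
  proof (rule ccontr)
    assume "\<not> a < ereal x"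
    then have ax: "ereal x \<le> a" by simp
    obtain y where y: "l < y" "y < x" "\<not> (a \<le> ereal y \<and> ereal y \<le> b) \<longrightarrow> f y = 0"
      using AE_zero_interval[OF densitiesD(4)[OF f] x(1)] by blast
    have "ereal y < ereal x" using y by simp
    then have "\<not> a \<le> ereal y" using ax by (meson leD less_le_trans)
    then show False using y pos[of y] x by simp
  qed
  show "ereal x < b"
  proof (rule ccontr)
    assume "\<not> ereal x < b"
    then have ax: "b \<le> ereal x" by simp
    obtain y where y: "x < y" "y < r" "\<not> (a \<le> ereal y \<and> ereal y \<le> b) \<longrightarrow> f y = 0"
      using AE_zero_interval[OF densitiesD(4)[OF f] x(2)] by blast
    have "ereal x < ereal y" using y by simp
    then have "\<not> ereal y \<le> b" using ax by (meson leD le_less_trans)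
    then show False using y pos[of y] x by simp
  qed
qed

lemma min_power_le:
  "f \<in> A \<Longrightarrow> min_power a b n \<phi> A \<le> ereal (expect_test a b n \<phi> f)"
  unfolding min_power_def by (rule INF_lower)

lemma sample_size_bounds: "n \<le> sample_size a b n" "sample_size a b n \<le> n + 2"
  by (auto simp: sample_size_def)

section \<open>Necessity of diverging steepness and mass\<close>

text \<open>
  The left-hand side is the mean of \<open>1 / sqrt (1 + h x)\<close> for \<open>x\<close> uniform on \<open>[-1/2,1/2]\<close>. It has a finite
  value even for \<open>h = 2\<close>, where the likelihood ratio vanishes at an end point.
\<close>

lemma two_div_sqrt_sum_le:
  fixes h :: real
  assumes "0 < h" "h \<le> 2"
  shows "(2 / h) * (sqrt (1 + h / 2) - sqrt (1 - h / 2)) \<le> 1 + h\<^sup>2 / 4"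
proof -
  define s t y where "s = sqrt (1 + h / 2)" and "t = sqrt (1 - h / 2)" and "y = h / 2"
  have y: "0 < y" "y \<le> 1" using assms by (auto simp: y_def)
  have s2: "s\<^sup>2 = 1 + y" and t2: "t\<^sup>2 = 1 - y" using assms by (auto simp: s_def t_def y_def)
  have st0: "0 < s" "0 \<le> t" using assms by (auto simp: s_def t_def)
  have y2: "y\<^sup>2 \<le> 1" "0 < y\<^sup>2" using y by (auto simp: power_le_one)
  have "(1 - y\<^sup>2) * (1 - y\<^sup>2) \<le> 1 * (1 - y\<^sup>2)" using y2 by (intro mult_right_mono) auto
  also have "\<dots> = (s * t)\<^sup>2" unfolding power_mult_distrib s2 t2 by (simp add: power2_eq_square algebra_simps)
  finally have st: "1 - y\<^sup>2 \<le> s * t" using st0 by (intro power2_le_imp_le[of "1 - y\<^sup>2"]) (auto simp: power2_eq_square)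
  have sum2: "4 - 2 * y\<^sup>2 \<le> (s + t)\<^sup>2" using st by (simp add: power2_sum s2 t2)
  have "2\<^sup>2 \<le> (4 - 2 * y\<^sup>2) * (1 + y\<^sup>2)\<^sup>2"
  proof -
    define z where "z = y\<^sup>2"
    have z: "0 < z" "z \<le> 1" using y2 by (auto simp: z_def)
    have "z * (z * z) \<le> 1 * (1 * z)" using z by (intro mult_mono) auto
    then have "0 \<le> 6 * z - 2 * z * z * z" using z by simp
    then show ?thesis unfolding z_def[symmetric] by (simp add: power2_eq_square algebra_simps)
  qed
  also have "\<dots> \<le> (s + t)\<^sup>2 * (1 + y\<^sup>2)\<^sup>2" using sum2 by (intro mult_right_mono) auto
  also have "\<dots> = ((s + t) * (1 + y\<^sup>2))\<^sup>2" by (simp add: power_mult_distrib)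
  finally have "2 \<le> (s + t) * (1 + y\<^sup>2)" using st0 y2 by (intro power2_le_imp_le[of 2]) auto
  moreover have "(2 / h) * (s - t) * (s + t) = 2"
  proof -
    have "(s - t) * (s + t) = h" using s2 t2 by (simp add: power2_eq_square algebra_simps y_def)
    then show ?thesis using assms by (simp only: mult.assoc) simp
  qed
  ultimately have "((2 / h) * (s - t)) * (s + t) \<le> (1 + y\<^sup>2) * (s + t)" by (simp add: mult.commute)
  then have "(2 / h) * (s - t) \<le> 1 + y\<^sup>2" by (rule mult_right_le_imp_le) (use st0 in simp)
  then show ?thesis by (simp add: s_def t_def y_def power2_eq_square)
qed

text \<open>
  With slope bound \<open>0\<close> the class contains a density of the null hypothesis: spread the mass of the
  interval evenly over the part of it that lies to the right of \<open>a\<close>.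
\<close>

lemma min_power_zero_slope:
  assumes lr: "l < r" and \<delta>: "0 < \<delta>" and ab: "a < b" and ne: "g \<in> F_class a b {l<..<r} \<delta> 0"
    and level: "level_test a b n \<alpha> (nonincreasing_densities_on a b {l<..<r}) \<phi>"
  shows "min_power a b n \<phi> (F_class a b {l<..<r} \<delta> 0) \<le> ereal \<alpha>"
proof -
  let ?I = "{l<..<r}"
  have g: "g \<in> densities a b" and m: "mass g ?I = \<delta>" using ne by (auto simp: F_class_def)
  have mono: "g x \<le> g y" if "l < x" "x < y" "y < r" for x y
    using F_class_slope[OF ne lr \<delta> that] by simp
  have not0: "\<not> (AE x in lborel. x \<in> ?I \<longrightarrow> g x = 0)"
  proof
    assume *: "AE x in lborel. x \<in> ?I \<longrightarrow> g x = 0"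
    have "(\<integral>\<^sup>+ x. ennreal (g x) * indicator ?I x \<partial>lborel) = (\<integral>\<^sup>+ (x::real). 0 \<partial>lborel)"
      by (rule nn_integral_cong_AE) (use * in \<open>eventually_elim, auto simp: indicator_def\<close>)
    then show False using nn_mass[OF g, of ?I] m \<delta> by simp
  qed
  have rb: "ereal r \<le> b"
  proof (rule ccontr)
    assume "\<not> ereal r \<le> b"
    then have br: "b < ereal r" by simp
    then obtain c where c: "b = ereal c" using ab by (cases b) auto
    have "g z = 0" if z: "z \<in> ?I" for z
    proof -
      have "max z c < r" using z br c by auto
      then obtain y where y: "max z c < y" "y < r" "\<not> (a \<le> ereal y \<and> ereal y \<le> b) \<longrightarrow> g y = 0"
        using AE_zero_interval[OF densitiesD(4)[OF g]] by blast
      then have "g y = 0" by (auto simp: c)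
      moreover have "g z \<le> g y" using z y by (intro mono) auto
      ultimately show ?thesis using densitiesD(2)[OF g, of z] by simp
    qed
    then show False using not0 by auto
  qed
  define l' where "l' = (if a = -\<infinity> then l else max l (real_of_ereal a))"
  have al': "ereal x < a \<Longrightarrow> x < l'" "a < ereal x \<Longrightarrow> l < x \<Longrightarrow> l' < x" for x
    using ab by (cases a; auto simp: l'_def)+
  have l'r: "l' < r"
  proof (rule ccontr)
    assume n: "\<not> l' < r"
    then obtain c where c: "a = ereal c" "r \<le> c" using lr ab by (cases a) (auto simp: l'_def split: if_splits)
    have "AE x in lborel. x \<in> ?I \<longrightarrow> g x = 0"
      using densitiesD(4)[OF g] by eventually_elim (use c in auto)
    then show False using not0 by simp
  qed
  have ll': "l \<le> l'" by (simp add: l'_def)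
  define p where "p x = (if l' < x then \<delta> / (r - l') else 0)" for x
  define f where "f x = (if x \<in> ?I then p x else g x)" for x
  have [measurable]: "p \<in> borel_measurable borel" unfolding p_def by measurable
  have "(\<integral>\<^sup>+ x. ennreal (p x) * indicator ?I x \<partial>lborel) = (\<integral>\<^sup>+ x. ennreal (\<delta> / (r - l')) * indicator {l'<..<r} x \<partial>lborel)"
    using ll' by (intro nn_integral_cong) (auto simp: p_def indicator_def)
  also have "\<dots> = ennreal (\<delta> / (r - l')) * ennreal (r - l')" using l'r by (subst nn_integral_cmult_indicator) auto
  also have "\<dots> = ennreal (mass g ?I)" using l'r \<delta> by (simp add: ennreal_mult[symmetric] m)
  finally have mp: "(\<integral>\<^sup>+ x. ennreal (p x) * indicator ?I x \<partial>lborel) = ennreal (mass g ?I)" .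
  have supp: "p x = 0" if "x \<in> ?I" "\<not> (a \<le> ereal x \<and> ereal x \<le> b)" for x
  proof -
    have "ereal x < ereal r" using that by simp
    then have "ereal x \<le> b" using rb by (meson less_imp_le order.trans)
    then have "x < l'" using that al' by (simp add: not_le)
    then show ?thesis by (simp add: p_def)
  qed
  have fd: "f \<in> densities a b" "mass f ?I = \<delta>"
    using replace_density[OF g _ _ _ mp supp] l'r \<delta> m unfolding f_def[abs_def] by (auto simp: p_def)
  have "f \<in> F_class a b ?I \<delta> 0"
    using l'r \<delta> by (intro F_classI fd lr \<delta>) (auto simp: f_def p_def)
  moreover have "f \<in> nonincreasing_densities_on a b ?I"
    unfolding nonincreasing_densities_on_def using fd al' by (auto simp: monotone_on_def f_def p_def)
  then have "expect_test a b n \<phi> f \<le> \<alpha>" using level by (auto simp: level_test_def)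
  ultimately show ?thesis using min_power_le[of f] by (meson ereal_less_eq(3) order.trans)
qed

text \<open>
  The null density \<open>f0\<close> is constant on the interval and the alternative \<open>f1\<close> is linear there with the
  smallest admissible slope; both agree with \<open>g\<close> elsewhere. If \<open>L\<close> is their likelihood ratio, then
  \<open>1 - \<phi>\<close> is at most \<open>L (1 - \<phi>) / \<epsilon>\<close> where \<open>L \<ge> \<epsilon>\<close>, and at most \<open>sqrt (\<epsilon> / L)\<close> elsewhere. Taking
  expectations under \<open>f0\<close>, a small type II error under \<open>f1\<close> would contradict the level, because
  the expectation of \<open>1 / sqrt L\<close> is bounded.
\<close>

lemma contiguity_bound:
  assumes lr: "l < r" and \<delta>: "0 < \<delta>" and n: "1 \<le> n"
    and \<beta>: "0 < \<beta>" "\<beta> \<le> 2 * sqrt (real n * \<delta>)" "\<beta> \<le> B" and ne: "g \<in> F_class a b {l<..<r} \<delta> (\<beta> / sqrt (real n))"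
    and level: "level_test a b n \<alpha> (nonincreasing_densities_on a b {l<..<r}) \<phi>"
    and \<epsilon>: "0 < \<epsilon>" "sqrt \<epsilon> * exp (3 * B\<^sup>2 / 4) \<le> (1 - \<alpha>) / 2"
  shows "min_power a b n \<phi> (F_class a b {l<..<r} \<delta> (\<beta> / sqrt (real n))) \<le> ereal (1 - \<epsilon> * (1 - \<alpha>) / 2)"
proof -
  let ?I = "{l<..<r}"
  define w c h where "w = r - l" and "c = (l + r) / 2" and "h = \<beta> / sqrt (real n * \<delta>)"
  have w: "0 < w" using lr by (simp add: w_def)
  have h: "0 < h" "h \<le> 2" using \<beta> n \<delta> by (auto simp: h_def divide_le_eq)
  have g: "g \<in> densities a b" and mg: "mass g ?I = \<delta>" using ne by (auto simp: F_class_def)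
  have \<sigma>: "\<beta> / sqrt (real n) * sqrt \<delta> / (r - l)\<^sup>2 = h * \<delta> / w\<^sup>2"
  proof -
    have "h * \<delta> = \<beta> / sqrt (real n) * (\<delta> / sqrt \<delta>)" by (simp add: h_def real_sqrt_mult)
    also have "\<delta> / sqrt \<delta> = sqrt \<delta>" using \<delta> by (simp add: real_div_sqrt)
    finally show ?thesis by (simp add: w_def)
  qed
  have slope: "h * \<delta> / w\<^sup>2 * (y - x) \<le> g y - g x" if "l < x" "x < y" "y < r" for x y
    using F_class_slope[OF ne lr \<delta> that] unfolding \<sigma> .
  have supp: "a < ereal x" "ereal x < b" if "l < x" "x < r" for x
    using steep_support[OF g _ slope that] h \<delta> w by auto
  define \<rho> where "\<rho> x = (if x \<in> ?I then 1 + h * ((x - c) / w) else 1)" for x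
  have half: "\<bar>(x - c) / w\<bar> < 1 / 2" if "l < x" "x < r" for x
  proof -
    have "x - c < w / 2" "- (x - c) < w / 2" using that unfolding c_def w_def by argo+
    then have "\<bar>x - c\<bar> < w / 2" by (simp only: abs_less_iff)
    then show ?thesis using w by (simp add: abs_divide field_simps)
  qed
  have \<rho>pos: "0 < \<rho> x" for x
  proof -
    show ?thesis
    proof (cases "x \<in> ?I")
      case True
      then have x: "l < x" "x < r" by auto
      have "h * \<bar>(x - c) / w\<bar> < 2 * (1 / 2)" using half[OF x] h by (intro mult_le_less_imp_less) auto
      then have "\<bar>h * ((x - c) / w)\<bar> < 1" using h by (simp only: abs_mult abs_of_pos)
      then have "- (h * ((x - c) / w)) < 1" by (simp only: abs_less_iff)
      then have "0 < 1 + h * ((x - c) / w)" by linarith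
      then show ?thesis using True by (simp only: \<rho>_def if_True)
    qed (auto simp: \<rho>_def)
  qed
  have [measurable]: "\<rho> \<in> borel_measurable borel" unfolding \<rho>_def by measurable
  define f0 where "f0 x = (if x \<in> ?I then \<delta> / w else g x)" for x
  define f1 where "f1 x = (if x \<in> ?I then \<delta> / w * \<rho> x else g x)" for x
  have f10: "f1 x = f0 x * \<rho> x" for x by (auto simp: f1_def f0_def \<rho>_def)
  have "(\<integral>\<^sup>+ x. ennreal (\<delta> / w) * indicator ?I x \<partial>lborel) = ennreal (mass g ?I)"
    using w \<delta> lr by (subst nn_integral_cmult_indicator) (auto simp: mg w_def ennreal_mult[symmetric])
  then have f0: "f0 \<in> densities a b" "mass f0 ?I = \<delta>"
    using replace_density[OF g, of ?I "\<lambda>_. \<delta> / w"] supp w \<delta> mg unfolding f0_def[abs_def]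
    by (auto simp: less_imp_le)
  have "(\<integral>\<^sup>+ x. ennreal (\<delta> / w * \<rho> x) * indicator ?I x \<partial>lborel) = (\<integral>\<^sup>+ x. ennreal (\<delta> / w * (1 + h * ((x - c) / w))) * indicator ?I x \<partial>lborel)"
    by (intro nn_integral_cong) (auto simp: \<rho>_def indicator_def)
  also have "\<dots> = ennreal ((\<lambda>x. \<delta> / w * (x + h / w * ((x - c)\<^sup>2 / 2))) r - (\<lambda>x. \<delta> / w * (x + h / w * ((x - c)\<^sup>2 / 2))) l)"
  proof (rule nn_integral_interior_FTC)
    fix x assume x: "x \<in> {l<..<r}"
    show "((\<lambda>x. \<delta> / w * (x + h / w * ((x - c)\<^sup>2 / 2))) has_real_derivative \<delta> / w * (1 + h * ((x - c) / w))) (at x)"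
    proof (rule DERIV_cmult)
      show "((\<lambda>x. x + h / w * ((x - c)\<^sup>2 / 2)) has_real_derivative 1 + h * ((x - c) / w)) (at x)"
        using w by (auto intro!: derivative_eq_intros simp: field_simps)
    qed
    show "0 \<le> \<delta> / w * (1 + h * ((x - c) / w))" using \<rho>pos[of x] x \<delta> w by (auto simp: \<rho>_def)
  qed (use lr w in \<open>auto intro!: continuous_intros\<close>)
  also have "(\<lambda>x. \<delta> / w * (x + h / w * ((x - c)\<^sup>2 / 2))) r - (\<lambda>x. \<delta> / w * (x + h / w * ((x - c)\<^sup>2 / 2))) l = \<delta>"
  proof -
    have "(r - c)\<^sup>2 = (l - c)\<^sup>2" by (simp add: c_def power2_eq_square field_simps)
    then have "(\<lambda>x. \<delta> / w * (x + h / w * ((x - c)\<^sup>2 / 2))) r - (\<lambda>x. \<delta> / w * (x + h / w * ((x - c)\<^sup>2 / 2))) l = \<delta> / w * (r - l)"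
      by (simp add: diff_divide_distrib right_diff_distrib distrib_left add_divide_distrib)
    then show ?thesis using w by (simp add: w_def)
  qed
  finally have f1m: "(\<integral>\<^sup>+ x. ennreal (\<delta> / w * \<rho> x) * indicator ?I x \<partial>lborel) = ennreal (mass g ?I)" by (simp add: mg)
  have f1: "f1 \<in> densities a b" "mass f1 ?I = \<delta>"
    using replace_density[OF g _ _ _ f1m] supp w \<delta> mg \<rho>pos unfolding f1_def[abs_def]
    by (auto simp: less_imp_le)
  have f1c: "f1 \<in> F_class a b ?I \<delta> (\<beta> / sqrt (real n))"
  proof (rule F_classI[OF f1 lr \<delta>])
    fix x y assume "l < x" "x < y" "y < r"
    then show "\<beta> / sqrt (real n) * sqrt \<delta> / (r - l)\<^sup>2 * (y - x) \<le> f1 y - f1 x"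
      unfolding \<sigma> using w by (simp add: f1_def \<rho>_def field_simps power2_eq_square)
  qed
  have f0n: "f0 \<in> nonincreasing_densities_on a b ?I"
    unfolding nonincreasing_densities_on_def using f0 by (auto simp: monotone_on_def f0_def)
  have test: "is_test n \<phi>" and lev: "expect_test a b n \<phi> f0 \<le> \<alpha>" using level f0n by (auto simp: level_test_def)
  define m where "m = sample_size a b n"
  define P0 where "P0 = sample_law a b n f0"
  define P1 where "P1 = sample_law a b n f1"
  interpret P0: prob_space P0 unfolding P0_def by (rule prob_space_sample_law[OF f0(1)])
  interpret P1: prob_space P1 unfolding P1_def by (rule prob_space_sample_law[OF f1(1)])
  define \<Phi> where "\<Phi> y = \<phi> (ordered_vector a b n y)" for y
  have \<Phi>01: "0 \<le> \<Phi> y" "\<Phi> y \<le> 1" for y using test_bounds[OF test] by (auto simp: \<Phi>_def)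
  have \<Phi>0: "integrable P0 \<Phi>" "\<Phi> \<in> borel_measurable P0" and \<Phi>1: "integrable P1 \<Phi>"
    unfolding P0_def P1_def \<Phi>_def using test_integrable[OF test f0(1)] test_integrable[OF test f1(1)] test_measurable[OF test] by auto
  define L where "L = lik m \<rho>"
  define M where "M = lik m (\<lambda>x. 1 / sqrt (\<rho> x))"
  have Lpos: "0 < L y" for y unfolding L_def lik_def by (intro prod_pos) (simp add: \<rho>pos)
  have M_eq: "M y = 1 / sqrt (L y)" for y
  proof -
    have "sqrt (\<Prod>i<k. \<rho> (y i)) = (\<Prod>i<k. sqrt (\<rho> (y i)))" for k by (induction k) (auto simp: real_sqrt_mult)
    then show ?thesis unfolding M_def L_def lik_def by (simp add: prod_dividef)
  qed
  have Mm: "M \<in> borel_measurable P0" unfolding M_def m_def P0_def by (intro measurable_lik) measurable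
  have one_minus: "(LINT y|P1. 1 - \<Phi> y) = (LINT y|P0. L y * (1 - \<Phi> y))" "integrable P0 (\<lambda>y. L y * (1 - \<Phi> y))"
  proof -
    have m: "(\<lambda>y. 1 - \<Phi> y) \<in> borel_measurable (sample_law a b n f0)" using \<Phi>0(2) unfolding P0_def by measurable
    note * = integral_sample_law_density[OF f0(1) f1(1) _ less_imp_le[OF \<rho>pos] f10 m]
    show "(LINT y|P1. 1 - \<Phi> y) = (LINT y|P0. L y * (1 - \<Phi> y))"
      unfolding P0_def P1_def L_def m_def by (rule *(1)) measurable
    have "integrable P1 (\<lambda>y. 1 - \<Phi> y)" using \<Phi>1 by auto
    then show "integrable P0 (\<lambda>y. L y * (1 - \<Phi> y))"
      unfolding P0_def P1_def L_def m_def by (subst (asm) *(2)) auto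
  qed
  have base: "(\<integral>\<^sup>+ x. ennreal (f0 x) * ennreal (1 / sqrt (\<rho> x)) \<partial>lborel) \<le> ennreal (1 + \<delta> * h\<^sup>2 / 4)"
  proof -
    have "(\<integral>\<^sup>+ x. ennreal (f0 x) * ennreal (1 / sqrt (\<rho> x)) \<partial>lborel)
      = (\<integral>\<^sup>+ x. ennreal (\<delta> / w * (1 / sqrt (1 + h * ((x - c) / w)))) * indicator ?I x + ennreal (g x) * indicator (- ?I) x \<partial>lborel)"
      using \<delta> w h \<rho>pos by (intro nn_integral_cong) (auto simp: f0_def \<rho>_def indicator_def ennreal_mult'[symmetric])
    also have "\<dots> = (\<integral>\<^sup>+ x. ennreal (\<delta> / w * (1 / sqrt (1 + h * ((x - c) / w)))) * indicator ?I x \<partial>lborel)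
       + (\<integral>\<^sup>+ x. ennreal (g x) * indicator (- ?I) x \<partial>lborel)"
      using densitiesD(1)[OF g] by (intro nn_integral_add) auto
    also have "(\<integral>\<^sup>+ x. ennreal (\<delta> / w * (1 / sqrt (1 + h * ((x - c) / w)))) * indicator ?I x \<partial>lborel)
       = ennreal ((\<lambda>x. \<delta> / w * ((2 * w / h) * sqrt (1 + h * ((x - c) / w)))) r - (\<lambda>x. \<delta> / w * ((2 * w / h) * sqrt (1 + h * ((x - c) / w)))) l)"
    proof (rule nn_integral_interior_FTC)
      fix x assume x: "x \<in> {l<..<r}"
      then have pos: "0 < 1 + h * ((x - c) / w)" using \<rho>pos[of x] by (auto simp: \<rho>_def)
      have d: "((\<lambda>x. 1 + h * ((x - c) / w)) has_real_derivative h / w) (at x)"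
        using w by (auto intro!: derivative_eq_intros)
      have "((\<lambda>x. \<delta> / w * ((2 * w / h) * sqrt (1 + h * ((x - c) / w)))) has_real_derivative
          \<delta> / w * ((2 * w / h) * (inverse (sqrt (1 + h * ((x - c) / w))) / 2 * (h / w)))) (at x)"
        by (intro DERIV_cmult DERIV_chain'[OF d] DERIV_real_sqrt pos)
      moreover have "\<delta> / w * ((2 * w / h) * (inverse (sqrt (1 + h * ((x - c) / w))) / 2 * (h / w))) = \<delta> / w * (1 / sqrt (1 + h * ((x - c) / w)))"
        using h w by (simp add: inverse_eq_divide)
      ultimately show "((\<lambda>x. \<delta> / w * ((2 * w / h) * sqrt (1 + h * ((x - c) / w)))) has_real_derivative
          \<delta> / w * (1 / sqrt (1 + h * ((x - c) / w)))) (at x)" by simp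
      show "0 \<le> \<delta> / w * (1 / sqrt (1 + h * ((x - c) / w)))" using \<delta> w pos by simp
    qed (use lr w h in \<open>auto intro!: continuous_intros\<close>)
    also have "(\<lambda>x. \<delta> / w * ((2 * w / h) * sqrt (1 + h * ((x - c) / w)))) r - (\<lambda>x. \<delta> / w * ((2 * w / h) * sqrt (1 + h * ((x - c) / w)))) l
       = \<delta> * ((2 / h) * (sqrt (1 + h / 2) - sqrt (1 - h / 2)))"
    proof -
      have rl: "(r - c) / w = 1 / 2" "(l - c) / w = - (1 / 2)" using w by (auto simp: c_def w_def field_simps)
      have "\<delta> / w * ((2 * w / h) * A) - \<delta> / w * ((2 * w / h) * B) = \<delta> * ((2 / h) * (A - B))" for A B
        using w h by (simp add: field_simps)
      then show ?thesis unfolding rl by simp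
    qed
    also have "ennreal (\<delta> * ((2 / h) * (sqrt (1 + h / 2) - sqrt (1 - h / 2)))) + (\<integral>\<^sup>+ x. ennreal (g x) * indicator (- ?I) x \<partial>lborel)
      \<le> ennreal (\<delta> + \<delta> * h\<^sup>2 / 4) + (\<integral>\<^sup>+ x. ennreal (g x) * indicator (- ?I) x \<partial>lborel)"
    proof (intro add_right_mono ennreal_leI)
      have "\<delta> * ((2 / h) * (sqrt (1 + h / 2) - sqrt (1 - h / 2))) \<le> \<delta> * (1 + h\<^sup>2 / 4)"
        using two_div_sqrt_sum_le[OF h] \<delta> by (intro mult_left_mono) auto
      then show "\<delta> * ((2 / h) * (sqrt (1 + h / 2) - sqrt (1 - h / 2))) \<le> \<delta> + \<delta> * h\<^sup>2 / 4" by (simp add: algebra_simps)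
    qed
    also have "\<dots> = (ennreal \<delta> + (\<integral>\<^sup>+ x. ennreal (g x) * indicator (- ?I) x \<partial>lborel)) + ennreal (\<delta> * h\<^sup>2 / 4)"
      using \<delta> by (simp add: ennreal_plus add_ac)
    also have "ennreal \<delta> + (\<integral>\<^sup>+ x. ennreal (g x) * indicator (- ?I) x \<partial>lborel) = 1"
    proof -
      have "ennreal \<delta> + (\<integral>\<^sup>+ x. ennreal (g x) * indicator (- ?I) x \<partial>lborel)
        = (\<integral>\<^sup>+ x. ennreal (g x) * indicator ?I x + ennreal (g x) * indicator (- ?I) x \<partial>lborel)"
        using nn_mass[OF g, of ?I] densitiesD(1)[OF g] by (subst nn_integral_add) (auto simp: mg)
      also have "\<dots> = (\<integral>\<^sup>+ x. ennreal (g x) \<partial>lborel)" by (intro nn_integral_cong) (auto simp: indicator_def)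
      finally show ?thesis using densitiesD(3)[OF g] by simp
    qed
    also have "1 + ennreal (\<delta> * h\<^sup>2 / 4) = ennreal (1 + \<delta> * h\<^sup>2 / 4)" using \<delta> by (simp add: ennreal_plus)
    finally show ?thesis .
  qed
  have nnM: "(\<integral>\<^sup>+ y. ennreal (M y) \<partial>P0) \<le> ennreal (exp (3 * B\<^sup>2 / 4))"
  proof -
    have "(\<integral>\<^sup>+ y. ennreal (M y) \<partial>P0) = (\<integral>\<^sup>+ y. (\<Prod>i<m. ennreal (1 / sqrt (\<rho> (y i)))) \<partial>P0)"
      unfolding M_def lik_def by (intro nn_integral_cong) (auto simp: prod_ennreal less_imp_le[OF \<rho>pos])
    also have "\<dots> = (\<integral>\<^sup>+ x. ennreal (f0 x) * ennreal (1 / sqrt (\<rho> x)) \<partial>lborel) ^ m"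
      unfolding P0_def m_def by (intro nn_integral_lik[OF f0(1)]) measurable
    also have "\<dots> \<le> ennreal (1 + \<delta> * h\<^sup>2 / 4) ^ m" by (intro power_mono base) auto
    also have "\<dots> = ennreal ((1 + \<delta> * h\<^sup>2 / 4) ^ m)" using \<delta> by (intro ennreal_power) auto
    also have "\<dots> \<le> ennreal (exp (3 * B\<^sup>2 / 4))"
    proof (rule ennreal_leI)
      have hh: "\<delta> * h\<^sup>2 = \<beta>\<^sup>2 / real n" using \<delta> n by (simp add: h_def power_divide)
      have "(1 + \<delta> * h\<^sup>2 / 4) ^ m \<le> exp (\<delta> * h\<^sup>2 / 4) ^ m" using \<delta> exp_ge_add_one_self[of "\<delta> * h\<^sup>2 / 4"] by (intro power_mono) auto
      also have "\<dots> = exp (real m * (\<delta> * h\<^sup>2 / 4))" by (rule exp_of_nat_mult[symmetric])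
      also have "\<dots> \<le> exp (3 * B\<^sup>2 / 4)"
      proof -
        have "real m \<le> 3 * real n" using sample_size_bounds(2)[of a b n] n unfolding m_def by linarith
        then have "real m * (\<delta> * h\<^sup>2 / 4) \<le> (3 * real n) * (\<delta> * h\<^sup>2 / 4)" using \<delta> by (intro mult_right_mono) auto
        also have "\<dots> = 3 * \<beta>\<^sup>2 / 4" unfolding hh using n by simp
        also have "\<dots> \<le> 3 * B\<^sup>2 / 4" using \<beta> by (simp add: power_mono)
        finally show ?thesis by simp
      qed
      finally show "(1 + \<delta> * h\<^sup>2 / 4) ^ m \<le> exp (3 * B\<^sup>2 / 4)" .
    qed
    finally show ?thesis .
  qed
  have M0: "0 \<le> M y" for y using Lpos[of y] by (simp add: M_eq)
  have iM: "integrable P0 M"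
    using Mm M0 nnM by (intro integrableI_nonneg) (auto intro: le_less_trans)
  have EM: "(LINT y|P0. M y) \<le> exp (3 * B\<^sup>2 / 4)"
    using nnM M0 by (subst (asm) nn_integral_eq_integral[OF iM]) auto
  (* the two cases of the pointwise bound are separated by the size of the likelihood ratio *)
  have pw: "1 - \<Phi> y \<le> L y * (1 - \<Phi> y) / \<epsilon> + sqrt \<epsilon> * M y" for y
  proof (cases "\<epsilon> \<le> L y")
    case True
    have "\<epsilon> * (1 - \<Phi> y) \<le> L y * (1 - \<Phi> y)" using True \<Phi>01[of y] by (intro mult_right_mono) auto
    then have "1 - \<Phi> y \<le> L y * (1 - \<Phi> y) / \<epsilon>" using \<epsilon>(1) by (simp add: field_simps)
    moreover have "0 \<le> sqrt \<epsilon> * M y" using M0 \<epsilon> by simp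
    ultimately show ?thesis by linarith
  next
    case False
    then have "1 \<le> sqrt \<epsilon> * M y" using Lpos[of y] by (simp add: M_eq)
    moreover have "0 \<le> L y * (1 - \<Phi> y) / \<epsilon>" using Lpos[of y] \<Phi>01[of y] \<epsilon> by simp
    ultimately show ?thesis using \<Phi>01[of y] by linarith
  qed
  have E1: "(LINT y|P1. 1 - \<Phi> y) = 1 - expect_test a b n \<phi> f1"
    using \<Phi>1 by (simp add: expect_test_def P1_def[symmetric] \<Phi>_def[symmetric] P1.prob_space)
  have "1 - \<alpha> \<le> 1 - (LINT y|P0. \<Phi> y)" using lev by (simp add: expect_test_def P0_def \<Phi>_def)
  also have "\<dots> = (LINT y|P0. 1 - \<Phi> y)" using \<Phi>0 by (simp add: P0.prob_space)
  also have "\<dots> \<le> (LINT y|P0. L y * (1 - \<Phi> y) / \<epsilon> + sqrt \<epsilon> * M y)"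
    using \<Phi>0 one_minus(2) iM pw by (intro integral_mono) auto
  also have "\<dots> = (LINT y|P0. L y * (1 - \<Phi> y)) / \<epsilon> + sqrt \<epsilon> * (LINT y|P0. M y)"
    using one_minus(2) iM by simp
  also have "\<dots> \<le> (1 - expect_test a b n \<phi> f1) / \<epsilon> + (1 - \<alpha>) / 2"
  proof -
    have "sqrt \<epsilon> * (LINT y|P0. M y) \<le> sqrt \<epsilon> * exp (3 * B\<^sup>2 / 4)" using EM \<epsilon> by (intro mult_left_mono) auto
    then show ?thesis using \<epsilon>(2) unfolding one_minus(1)[symmetric] E1 by linarith
  qed
  finally have "(1 - \<alpha>) / 2 \<le> (1 - expect_test a b n \<phi> f1) / \<epsilon>" by argo
  then have "\<epsilon> * (1 - \<alpha>) / 2 \<le> 1 - expect_test a b n \<phi> f1" using \<epsilon> by (simp add: field_simps)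
  then have "ereal (expect_test a b n \<phi> f1) \<le> ereal (1 - \<epsilon> * (1 - \<alpha>) / 2)" by simp
  then show ?thesis using min_power_le[OF f1c, of a b n \<phi>] by (rule order.trans[rotated])
qed

text \<open>
  If \<open>\<beta>\<close> does not diverge, it is bounded along a subsequence, and there the power stays below a
  constant \<open>q < 1\<close>.
\<close>

theorem consistency_necessary:
  fixes a b :: ereal
  assumes ab: "a < b" and \<delta>: "\<And>n. n \<ge> 1 \<Longrightarrow> 0 < \<delta> n" and \<alpha>: "0 < \<alpha>" "\<alpha> < 1"
    and H: "\<forall>n\<ge>1. I n \<in> bounded_open_intervals \<and>
           0 \<le> \<beta> n \<and> \<beta> n \<le> 2 * sqrt (real n * \<delta> n) \<and>
           level_test a b n \<alpha> (nonincreasing_densities_on a b (I n)) (\<phi> n)"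
    and power: "(\<lambda>n. min_power a b n (\<phi> n) (F_class a b (I n) (\<delta> n) (\<beta> n / sqrt (real n)))) \<longlonglongrightarrow> 1"
  shows "filterlim \<beta> at_top sequentially" "filterlim (\<lambda>n. real n * \<delta> n) at_top sequentially"
proof -
  show lim: "filterlim \<beta> at_top sequentially"
    unfolding filterlim_at_top
  proof (rule allI, rule ccontr)
    fix B0 :: real
    define B where "B = max B0 0"
    assume "\<not> (\<forall>\<^sub>F n in sequentially. B0 \<le> \<beta> n)"
    then have freq: "\<exists>\<^sub>F n in sequentially. \<beta> n < B0" by (simp add: not_eventually not_le)
    define \<epsilon> where "\<epsilon> = min 1 (((1 - \<alpha>) / 2 / exp (3 * B\<^sup>2 / 4))\<^sup>2)"
    have \<epsilon>: "0 < \<epsilon>" "\<epsilon> \<le> 1" using \<alpha> by (auto simp: \<epsilon>_def)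
    have "sqrt \<epsilon> \<le> sqrt (((1 - \<alpha>) / 2 / exp (3 * B\<^sup>2 / 4))\<^sup>2)"
      unfolding \<epsilon>_def by (rule real_sqrt_le_mono[OF min.cobounded2])
    also have "\<dots> = (1 - \<alpha>) / 2 / exp (3 * B\<^sup>2 / 4)" using \<alpha> by (subst real_sqrt_abs) simp
    finally have \<epsilon>2: "sqrt \<epsilon> * exp (3 * B\<^sup>2 / 4) \<le> (1 - \<alpha>) / 2" by (simp add: field_simps)
    define q where "q = 1 - \<epsilon> * (1 - \<alpha>) / 2"
    have q: "q < 1" using \<epsilon> \<alpha> by (simp add: q_def)
    have "\<epsilon> * (1 - \<alpha>) \<le> 1 * (1 - \<alpha>)" using \<epsilon> \<alpha> by (intro mult_right_mono) auto
    then have aq: "\<alpha> \<le> q" using \<alpha> unfolding q_def by argo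
    have "\<forall>\<^sub>F n in sequentially. min_power a b n (\<phi> n) (F_class a b (I n) (\<delta> n) (\<beta> n / sqrt (real n))) \<in> {ereal q<..<ereal 2}"
      using power q by (intro topological_tendstoD) (auto simp: one_ereal_def)
    then have "\<exists>\<^sub>F n in sequentially. \<beta> n < B0 \<and> min_power a b n (\<phi> n) (F_class a b (I n) (\<delta> n) (\<beta> n / sqrt (real n))) \<in> {ereal q<..<ereal 2} \<and> 1 \<le> n"
      using freq eventually_ge_at_top[of "1::nat"] by (auto elim!: frequently_rev_mp eventually_elim2)
    then obtain n where n: "\<beta> n < B0" "1 \<le> n" 
      and p: "ereal q < min_power a b n (\<phi> n) (F_class a b (I n) (\<delta> n) (\<beta> n / sqrt (real n)))"
        "min_power a b n (\<phi> n) (F_class a b (I n) (\<delta> n) (\<beta> n / sqrt (real n))) < ereal 2"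
      by (auto dest!: frequently_ex)
    obtain l r where I: "I n = {l<..<r}" "l < r" using H n by (auto simp: bounded_open_intervals_def)
    have "F_class a b (I n) (\<delta> n) (\<beta> n / sqrt (real n)) \<noteq> {}"
    proof
      assume "F_class a b (I n) (\<delta> n) (\<beta> n / sqrt (real n)) = {}"
      then show False using p(2) by (simp add: min_power_def top_ereal_def)
    qed
    then obtain g where g: "g \<in> F_class a b (I n) (\<delta> n) (\<beta> n / sqrt (real n))" by auto
    have lev: "level_test a b n \<alpha> (nonincreasing_densities_on a b {l<..<r}) (\<phi> n)" using H n I by auto
    have \<beta>: "0 \<le> \<beta> n" "\<beta> n \<le> 2 * sqrt (real n * \<delta> n)" using H n by auto
    have "min_power a b n (\<phi> n) (F_class a b (I n) (\<delta> n) (\<beta> n / sqrt (real n))) \<le> ereal q"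
    proof (cases "\<beta> n = 0")
      case True
      then have "min_power a b n (\<phi> n) (F_class a b (I n) (\<delta> n) (\<beta> n / sqrt (real n))) \<le> ereal \<alpha>"
        using min_power_zero_slope[OF I(2) \<delta>[OF n(2)] ab _ lev] g I by simp
      then show ?thesis using aq by (meson ereal_less_eq(3) order.trans)
    next
      case False
      have "\<beta> n \<le> B" using n by (simp add: B_def)
      then show ?thesis
        using contiguity_bound[OF I(2) \<delta>[OF n(2)] n(2) _ \<beta>(2) _ _ lev \<epsilon>(1) \<epsilon>2, of g] False \<beta> g I by (simp add: q_def)
    qed
    then show False using p by simp
  qed
  show "filterlim (\<lambda>n. real n * \<delta> n) at_top sequentially"
  proof (rule filterlim_at_top_mono)
    show "filterlim (\<lambda>n. \<beta> n * \<beta> n * (1/4)) at_top sequentially"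
      by (intro filterlim_at_top_mult_tendsto_pos[OF tendsto_const] filterlim_at_top_mult_at_top lim) auto
    show "\<forall>\<^sub>F n in sequentially. \<beta> n * \<beta> n * (1/4) \<le> real n * \<delta> n"
      using eventually_ge_at_top[of "1::nat"]
    proof eventually_elim
      case (elim n)
      have \<beta>: "0 \<le> \<beta> n" "\<beta> n \<le> 2 * sqrt (real n * \<delta> n)" using H elim by auto
      have "\<beta> n * \<beta> n \<le> (2 * sqrt (real n * \<delta> n)) * (2 * sqrt (real n * \<delta> n))" using \<beta> order.trans[OF \<beta>] by (intro mult_mono) auto
      also have "\<dots> = 4 * (real n * \<delta> n)"       proof -
        have "0 \<le> real n * \<delta> n" using \<delta>[OF elim] by (intro mult_nonneg_nonneg) auto
        then show ?thesis by simp
      qed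
      finally show ?case by simp
    qed
  qed
qed

section \<open>Optimality of the constant\<close>

text \<open>
  The null density for the lower bound. If a lower end point of the support is known, the interval has to
  start there, since otherwise the density would increase at its left end.
\<close>

lemma uniform_base_density:
  fixes a b :: ereal
  assumes "a < b"
  obtains A w :: real where "0 < w" "\<And>x. A < x \<Longrightarrow> x < A + w \<Longrightarrow> a < ereal x \<and> ereal x < b"
    "(\<lambda>x. indicator {A<..<A + w} x / w) \<in> nonincreasing_densities a b"
    "(\<lambda>x. indicator {A<..<A + w} x / w) \<in> densities a b"
proof -
  obtain A w where Aw: "0 < w" "a = -\<infinity> \<or> a = ereal A" "ereal (A + w) \<le> b" "a \<le> ereal A"
  proof (cases a; cases b)
    fix x y assume "a = ereal x" "b = ereal y"
    then show thesis using that[of "y - x" x] assms by simp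
  next
    fix x assume "a = ereal x" "b = \<infinity>"
    then show thesis using that[of 1 x] by simp
  next
    fix y assume "a = -\<infinity>" "b = ereal y"
    then show thesis using that[of 1 "y - 1"] by simp
  next
    assume "a = -\<infinity>" "b = \<infinity>"
    then show thesis using that[of 1 0] by simp
  qed (use assms in auto)
  define f where "f x = indicator {A<..<A + w} x / w" for x
  have inside: "ereal A < ereal x \<and> a < ereal x \<and> ereal x < b" if "A < x" "x < A + w" for x
  proof -
    have "ereal A < ereal x" "ereal x < ereal (A + w)" using that by simp_all
    then show ?thesis using Aw(3,4) by (meson le_less_trans less_le_trans)
  qed
  have f: "f \<in> densities a' b" if a': "\<And>x. A < x \<Longrightarrow> x < A + w \<Longrightarrow> a' < ereal x" for a'
  proof -
    have "(\<integral>\<^sup>+ x. ennreal (f x) \<partial>lborel) = (\<integral>\<^sup>+ x. ennreal (1 / w) * indicator {A<..<A + w} x \<partial>lborel)"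
      by (intro nn_integral_cong) (auto simp: f_def indicator_def)
    also have "\<dots> = 1" using Aw(1) by (subst nn_integral_cmult_indicator) (auto simp: ennreal_mult[symmetric])
    finally have "(\<integral>\<^sup>+ x. ennreal (f x) \<partial>lborel) = 1" .
    moreover have "f x = 0" if "\<not> (a' \<le> ereal x \<and> ereal x \<le> b)" for x
      using that inside[of x] a'[of x] by (cases "A < x \<and> x < A + w") (auto simp: f_def indicator_def less_imp_le)
    moreover have "f \<in> borel_measurable lborel" unfolding f_def by measurable
    ultimately show ?thesis using Aw(1) unfolding densities_def by (auto simp: f_def)
  qed
  have "f \<in> nonincreasing_densities a b"
    unfolding nonincreasing_densities_def
  proof (intro CollectI exI conjI)
    show "a = -\<infinity> \<or> a = ereal A" by (rule Aw)
    show "f \<in> densities (ereal A) b" using inside by (intro f) auto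
    show "antimono_on {x. A < x \<and> ereal x < b} f"
      using Aw(1) by (auto simp: monotone_on_def f_def indicator_def)
  qed
  then show ?thesis using that[OF Aw(1), of A] inside f[of a] by (auto simp: f_def[abs_def])
qed

lemma ln_one_plus_le:
  fixes x :: real
  assumes "-1 < x"
  shows "ln (1 + x) \<le> x - x\<^sup>2 / 2 + x ^ 3 / 3"
proof -
  define G where "G y = y - y\<^sup>2 / 2 + y ^ 3 / 3 - ln (1 + y)" for y :: real
  have d: "(G has_real_derivative y ^ 3 / (1 + y)) (at y)" if "-1 < y" for y
  proof -
    have "(G has_real_derivative 1 - y + y\<^sup>2 - 1 / (1 + y)) (at y)"
      unfolding G_def using that by (auto intro!: derivative_eq_intros simp: power2_eq_square divide_simps) (simp add: algebra_simps)
    moreover have "1 - y + y\<^sup>2 - 1 / (1 + y) = y ^ 3 / (1 + y)"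
      using that by (simp add: field_simps power2_eq_square power3_eq_cube)
    ultimately show ?thesis by simp
  qed
  have "0 \<le> G x"
  proof (cases "0 \<le> x")
    case True
    have "G 0 \<le> G x"
    proof (rule DERIV_nonneg_imp_nondecreasing[OF True])
      fix y assume "0 \<le> y" "y \<le> x"
      then show "\<exists>z. (G has_real_derivative z) (at y) \<and> 0 \<le> z"
        using d[of y] by (intro exI[of _ "y ^ 3 / (1 + y)"]) auto
    qed
    then show ?thesis by (simp add: G_def)
  next
    case False
    have "G 0 \<le> G x"
    proof (rule DERIV_nonpos_imp_nonincreasing[of x 0 G])
      show "x \<le> 0" using False by simp
      fix y assume "x \<le> y" "y \<le> 0"
      then show "\<exists>z. (G has_real_derivative z) (at y) \<and> z \<le> 0"
        using d[of y] assms by (intro exI[of _ "y ^ 3 / (1 + y)"]) (auto simp: divide_nonpos_pos power3_eq_cube mult_nonneg_nonpos mult_nonpos_nonpos)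
    qed
    then show ?thesis by (simp add: G_def)
  qed
  then show ?thesis by (simp add: G_def)
qed

lemma xlogx_le:
  fixes x :: real
  assumes "\<bar>x\<bar> \<le> 1 / 2"
  shows "(1 + x) * ln (1 + x) \<le> x + x\<^sup>2 / 2 - x ^ 3 / 6 + x ^ 4 / 3"
proof -
  have "(1 + x) * ln (1 + x) \<le> (1 + x) * (x - x\<^sup>2 / 2 + x ^ 3 / 3)"
    using assms by (intro mult_left_mono ln_one_plus_le) auto
  also have "\<dots> = x + x\<^sup>2 / 2 - x ^ 3 / 6 + x ^ 4 / 3"
    by (simp add: field_simps power2_eq_square power3_eq_cube power4_eq_xxxx)
  finally show ?thesis .
qed

lemma xlog2_le:
  fixes x :: real
  assumes "\<bar>x\<bar> \<le> 1 / 2"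
  shows "(1 + x) * (ln (1 + x))\<^sup>2 \<le> 8 * x\<^sup>2"
proof -
  have "\<bar>ln (1 + x) - x\<bar> \<le> 2 * x\<^sup>2" by (rule abs_ln_one_plus_x_minus_x_bound[OF assms])
  moreover have "2 * x\<^sup>2 \<le> \<bar>x\<bar>"
  proof -
    have "\<bar>x\<bar> * \<bar>x\<bar> \<le> 1 / 2 * \<bar>x\<bar>" using assms by (intro mult_right_mono) auto
    then show ?thesis by (simp add: power2_eq_square abs_mult_self_eq)
  qed
  ultimately have "\<bar>ln (1 + x)\<bar> \<le> 2 * \<bar>x\<bar>" by linarith
  then have "\<bar>ln (1 + x)\<bar>\<^sup>2 \<le> (2 * \<bar>x\<bar>)\<^sup>2" by (rule power_mono) auto
  then have "(ln (1 + x))\<^sup>2 \<le> 4 * x\<^sup>2" by (simp add: power_mult_distrib)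
  then have "(1 + x) * (ln (1 + x))\<^sup>2 \<le> 2 * (4 * x\<^sup>2)" using assms by (intro mult_mono) auto
  then show ?thesis by simp
qed

lemma (in prob_space) integral_abs_le_sqrt:
  fixes X :: "'a \<Rightarrow> real"
  assumes [measurable]: "random_variable borel X" and "integrable M (\<lambda>x. (X x)\<^sup>2)"
  shows "expectation (\<lambda>x. \<bar>X x\<bar>) \<le> sqrt (expectation (\<lambda>x. (X x)\<^sup>2))"
proof -
  have iX: "integrable M X" using assms by (rule square_integrable_imp_integrable)
  have "0 \<le> variance (\<lambda>x. \<bar>X x\<bar>)" by (rule variance_positive)
  also have "\<dots> = expectation (\<lambda>x. (X x)\<^sup>2) - (expectation (\<lambda>x. \<bar>X x\<bar>))\<^sup>2"
    using assms iX by (subst variance_eq) auto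
  finally show ?thesis by (intro real_le_rsqrt) simp
qed

text \<open>
  Truncated second moment method. The likelihood ratios are cut off at \<open>\<tau> * m\<close>, which removes little of
  their mass but makes the diagonal terms of the second moment of their average \<open>Z\<close> small; hence \<open>Z\<close> has
  variance at most \<open>\<tau> + 2 * e\<close>. Then \<open>Z\<close> is close in the mean to a constant that is at most \<open>1\<close>, and so a test has nearly the
  same expectation under the mixture as under the null.
\<close>

lemma (in prob_space) mixture_power_bound:
  fixes L :: "nat \<Rightarrow> 'a \<Rightarrow> real" and \<Phi> :: "'a \<Rightarrow> real"
  assumes Lm [measurable]: "\<And>j. L j \<in> borel_measurable M" and L0: "\<And>j x. 0 \<le> L j x"
    and iL: "\<And>j. integrable M (L j)" and EL: "\<And>j. j < m \<Longrightarrow> expectation (L j) = 1"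
    and iLL: "\<And>i j. integrable M (\<lambda>x. L i x * L j x)"
    and ELL: "\<And>i j. i < m \<Longrightarrow> j < m \<Longrightarrow> i \<noteq> j \<Longrightarrow> expectation (\<lambda>x. L i x * L j x) \<le> 1"
    and tail: "\<And>j. j < m \<Longrightarrow> expectation (\<lambda>x. L j x * indicator {x. \<tau> * real m < L j x} x) \<le> e"
    and \<Phi>m [measurable]: "\<Phi> \<in> borel_measurable M" and \<Phi>: "\<And>x. 0 \<le> \<Phi> x" "\<And>x. \<Phi> x \<le> 1" "expectation \<Phi> \<le> \<alpha>"
    and m: "0 < m" and \<tau>: "0 \<le> \<tau>" and e: "0 \<le> e" "e \<le> 1" and \<alpha>: "0 \<le> \<alpha>"
  shows "(\<Sum>j<m. expectation (\<lambda>x. L j x * \<Phi> x)) / real m \<le> \<alpha> + sqrt (\<tau> + 2 * e) + e"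
proof -
  define K where "K j x = L j x * indicator {x. L j x \<le> \<tau> * real m} x" for j x
  have Km [measurable]: "K j \<in> borel_measurable M" for j unfolding K_def by measurable
  have K0: "0 \<le> K j x" and KL: "K j x \<le> L j x" and K\<tau>: "K j x \<le> \<tau> * real m" for j x
    using L0[of j x] \<tau> by (auto simp: K_def indicator_def)
  have iK: "integrable M (K j)" for j by (rule Bochner_Integration.integrable_bound[OF iL[of j]]) (use K0 KL L0 in auto)
  have iKK: "integrable M (\<lambda>x. K i x * K j x)" for i j
    by (rule Bochner_Integration.integrable_bound[OF iLL[of i j]]) (use K0 KL L0 in \<open>auto intro!: mult_mono\<close>)
  have split: "L j x = K j x + L j x * indicator {x. \<tau> * real m < L j x} x" for j x
    by (auto simp: K_def indicator_def)
  have iT: "integrable M (\<lambda>x. L j x * indicator {x. \<tau> * real m < L j x} x)" for j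
    by (rule Bochner_Integration.integrable_bound[OF iL[of j]]) (use L0 in \<open>auto simp: indicator_def\<close>)
  have EK: "1 - e \<le> expectation (K j)" "expectation (K j) \<le> 1" if "j < m" for j
  proof -
    have "expectation (L j) = expectation (K j) + expectation (\<lambda>x. L j x * indicator {x. \<tau> * real m < L j x} x)"
      using iK iT by (subst Bochner_Integration.integral_add[symmetric]) (auto simp: split[symmetric])
    then show "1 - e \<le> expectation (K j)" using tail[OF that] EL[OF that] by simp
    have "expectation (K j) \<le> expectation (L j)" using iK iL KL by (intro integral_mono) auto
    then show "expectation (K j) \<le> 1" using EL[OF that] by simp
  qed
  define Z where "Z x = (\<Sum>j<m. K j x) / real m" for x
  define \<zeta> where "\<zeta> = expectation Z"
  have Zm [measurable]: "Z \<in> borel_measurable M" unfolding Z_def by measurable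
  have iZ: "integrable M Z" unfolding Z_def using iK by auto
  have \<zeta>_eq: "\<zeta> = (\<Sum>j<m. expectation (K j)) / real m" unfolding \<zeta>_def Z_def using iK by simp
  have \<zeta>1: "1 - e \<le> \<zeta>" "\<zeta> \<le> 1"
  proof -
    have "(\<Sum>j<m. 1 - e) \<le> (\<Sum>j<m. expectation (K j))" using EK by (intro sum_mono) auto
    then show "1 - e \<le> \<zeta>" using m by (simp add: \<zeta>_eq field_simps)
    have "(\<Sum>j<m. expectation (K j)) \<le> (\<Sum>j<m. 1)" using EK by (intro sum_mono) auto
    then show "\<zeta> \<le> 1" using m by (simp add: \<zeta>_eq field_simps)
  qed
  have Z2: "(Z x)\<^sup>2 = (\<Sum>i<m. \<Sum>j<m. K i x * K j x) / (real m)\<^sup>2" for x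
    by (simp add: Z_def power_divide power2_eq_square sum_product)
  have iZ2: "integrable M (\<lambda>x. (Z x)\<^sup>2)" unfolding Z2 using iKK by auto
  have "expectation (\<lambda>x. (Z x)\<^sup>2) = (\<Sum>i<m. \<Sum>j<m. expectation (\<lambda>x. K i x * K j x)) / (real m)\<^sup>2"
    unfolding Z2 using iKK by simp
  also have "\<dots> \<le> (\<Sum>i<m. \<Sum>j<m. (if i = j then \<tau> * real m else 0) + 1) / (real m)\<^sup>2"
  proof (intro divide_right_mono sum_mono)
    fix i j assume ij: "i \<in> {..<m}" "j \<in> {..<m}"
    show "expectation (\<lambda>x. K i x * K j x) \<le> (if i = j then \<tau> * real m else 0) + 1"
    proof (cases "i = j")
      case True
      have "expectation (\<lambda>x. K i x * K j x) \<le> expectation (\<lambda>x. (\<tau> * real m) * K j x)"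
        using iKK iK K0 K\<tau> by (intro integral_mono) (auto intro!: mult_right_mono)
      also have "\<dots> = (\<tau> * real m) * expectation (K j)" by simp
      also have "\<dots> \<le> (\<tau> * real m) * 1" using EK[of j] ij \<tau> by (intro mult_left_mono) auto
      finally show ?thesis using True by simp
    next
      case False
      have "expectation (\<lambda>x. K i x * K j x) \<le> expectation (\<lambda>x. L i x * L j x)"
        using iKK iLL K0 KL L0 by (intro integral_mono) (auto intro!: mult_mono)
      also have "\<dots> \<le> 1" using ELL ij False by auto
      finally show ?thesis using False by simp
    qed
  qed auto
  also have "\<dots> = \<tau> + 1" using m by (simp add: sum.distrib power2_eq_square field_simps)
  finally have EZ2: "expectation (\<lambda>x. (Z x)\<^sup>2) \<le> \<tau> + 1" .
  have "variance Z \<le> \<tau> + 2 * e"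
  proof -
    have "(1 - e) * (1 - e) \<le> \<zeta> * \<zeta>" using \<zeta>1 e by (intro mult_mono) auto
    then have "1 - 2 * e \<le> \<zeta>\<^sup>2" by (simp add: power2_eq_square algebra_simps) (use mult_nonneg_nonneg[OF e(1) e(1)] in linarith)
    then show ?thesis using variance_eq[OF iZ iZ2] EZ2 by (simp add: \<zeta>_def)
  qed
  moreover have "expectation (\<lambda>x. \<bar>Z x - \<zeta>\<bar>) \<le> sqrt (expectation (\<lambda>x. (Z x - \<zeta>)\<^sup>2))"
    using iZ iZ2 by (intro integral_abs_le_sqrt) (auto simp: power2_diff)
  ultimately have dev: "expectation (\<lambda>x. \<bar>Z x - \<zeta>\<bar>) \<le> sqrt (\<tau> + 2 * e)"
    unfolding \<zeta>_def by (meson order.trans real_sqrt_le_mono)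
  have i\<Phi>: "integrable M \<Phi>" by (rule integrable_const_bound[of _ 1]) (use \<Phi> in auto)
  have iZ\<Phi>: "integrable M (\<lambda>x. Z x * \<Phi> x)"
    by (rule Bochner_Integration.integrable_bound[OF iZ]) (use \<Phi> in \<open>auto simp: abs_mult mult_left_le\<close>)
  have "expectation (\<lambda>x. Z x * \<Phi> x) \<le> expectation (\<lambda>x. \<bar>Z x - \<zeta>\<bar> + \<zeta> * \<Phi> x)"
  proof (intro integral_mono iZ\<Phi>)
    show "integrable M (\<lambda>x. \<bar>Z x - \<zeta>\<bar> + \<zeta> * \<Phi> x)" using iZ i\<Phi> by auto
    fix x
    have "(Z x - \<zeta>) * \<Phi> x \<le> \<bar>Z x - \<zeta>\<bar> * 1" using \<Phi>(1,2)[of x] by (intro mult_mono) auto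
    then show "Z x * \<Phi> x \<le> \<bar>Z x - \<zeta>\<bar> + \<zeta> * \<Phi> x" by (simp add: algebra_simps)
  qed
  also have "\<dots> = expectation (\<lambda>x. \<bar>Z x - \<zeta>\<bar>) + \<zeta> * expectation \<Phi>" using iZ i\<Phi> by simp
  also have "\<dots> \<le> sqrt (\<tau> + 2 * e) + 1 * \<alpha>"
  proof (intro add_mono dev)
    have "0 \<le> expectation \<Phi>" using \<Phi> by (intro integral_nonneg_AE) auto
    then show "\<zeta> * expectation \<Phi> \<le> 1 * \<alpha>" using \<zeta>1 \<Phi>(3) e by (intro mult_mono) auto
  qed
  finally have main: "expectation (\<lambda>x. Z x * \<Phi> x) \<le> sqrt (\<tau> + 2 * e) + \<alpha>" by simp
  have each: "expectation (\<lambda>x. L j x * \<Phi> x) \<le> expectation (\<lambda>x. K j x * \<Phi> x) + e" if "j < m" for j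
  proof -
    have iK\<Phi>: "integrable M (\<lambda>x. K j x * \<Phi> x)"
      by (rule Bochner_Integration.integrable_bound[OF iK[of j]]) (use \<Phi> in \<open>auto simp: abs_mult mult_left_le\<close>)
    have iL\<Phi>: "integrable M (\<lambda>x. L j x * \<Phi> x)"
      by (rule Bochner_Integration.integrable_bound[OF iL[of j]]) (use \<Phi> in \<open>auto simp: abs_mult mult_left_le\<close>)
    have "expectation (\<lambda>x. L j x * \<Phi> x) \<le> expectation (\<lambda>x. K j x * \<Phi> x + L j x * indicator {x. \<tau> * real m < L j x} x)"
    proof (intro integral_mono iL\<Phi>)
      show "integrable M (\<lambda>x. K j x * \<Phi> x + L j x * indicator {x. \<tau> * real m < L j x} x)" using iK\<Phi> iT by auto
      fix x show "L j x * \<Phi> x \<le> K j x * \<Phi> x + L j x * indicator {x. \<tau> * real m < L j x} x"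
        using L0[of j x] \<Phi>(1,2)[of x] by (auto simp: K_def indicator_def mult_left_le)
    qed
    also have "\<dots> = expectation (\<lambda>x. K j x * \<Phi> x) + expectation (\<lambda>x. L j x * indicator {x. \<tau> * real m < L j x} x)"
      using iK\<Phi> iT by simp
    finally show ?thesis using tail[OF that] by simp
  qed
  have iK\<Phi>: "integrable M (\<lambda>x. K j x * \<Phi> x)" for j
    by (rule Bochner_Integration.integrable_bound[OF iK[of j]]) (use \<Phi> in \<open>auto simp: abs_mult mult_left_le\<close>)
  have "(\<Sum>j<m. expectation (\<lambda>x. L j x * \<Phi> x)) / real m \<le> (\<Sum>j<m. expectation (\<lambda>x. K j x * \<Phi> x) + e) / real m"
    using each by (intro divide_right_mono sum_mono) auto
  also have "\<dots> = expectation (\<lambda>x. Z x * \<Phi> x) + e"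
    using m iK\<Phi> by (simp add: Z_def sum.distrib add_divide_distrib sum_distrib_right sum_divide_distrib)
  finally show ?thesis using main by linarith
qed

lemma law_density_mult:
  assumes f: "f \<in> densities a b" and \<rho>: "\<rho> \<in> borel_measurable borel" "\<And>x. 0 \<le> \<rho> x" and fg: "\<And>x. g x = f x * \<rho> x"
  shows "law g = density (law f) (\<lambda>x. ennreal (\<rho> x))"
  unfolding law_def fg using densitiesD(1,2)[OF f] \<rho>
  by (subst density_density_eq) (auto simp: ennreal_mult' intro!: density_cong)

lemma integral_lik:
  fixes \<rho> :: "real \<Rightarrow> real"
  assumes f: "f \<in> densities a' b'" and i: "integrable (law f) \<rho>"
  shows "integrable (sample_law a b n f) (lik (sample_size a b n) \<rho>)"
    "(LINT y|sample_law a b n f. lik (sample_size a b n) \<rho> y) = (LINT x|law f. \<rho> x) ^ sample_size a b n"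
proof -
  interpret prob_space "law f" by (rule prob_space_law[OF f])
  interpret product_sigma_finite "\<lambda>_::nat. law f" by standard
  show "integrable (sample_law a b n f) (lik (sample_size a b n) \<rho>)"
    unfolding sample_law_eq lik_def by (rule product_integrable_prod) (use i in auto)
  show "(LINT y|sample_law a b n f. lik (sample_size a b n) \<rho> y) = (LINT x|law f. \<rho> x) ^ sample_size a b n"
    unfolding sample_law_eq lik_def by (subst product_integral_prod) (use i in auto)
qed

text \<open>
  The uniform density on \<open>(A, A + w)\<close>, split into cells of mass \<open>\<delta>\<close>, and for each cell an alternative with
  relative slope \<open>h\<close> there.
\<close>

locale bumps =
  fixes a b :: ereal and A w \<delta> h :: real
  assumes w: "0 < w" and \<delta>: "0 < \<delta>" "\<delta> \<le> 1" and h: "0 < h" "h \<le> 1"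
    and inside: "\<And>x. A < x \<Longrightarrow> x < A + w \<Longrightarrow> a < ereal x \<and> ereal x < b"
    and f0d: "(\<lambda>x. indicator {A<..<A + w} x / w) \<in> densities a b"
begin

definition f0 :: "real \<Rightarrow> real" where "f0 x = indicator {A<..<A + w} x / w"
definition v :: real where "v = \<delta> * w"
definition left :: "nat \<Rightarrow> real" where "left j = A + real j * v"
definition cell :: "nat \<Rightarrow> real set" where "cell j = {left j<..<left j + v}"
definition \<psi> :: "nat \<Rightarrow> real \<Rightarrow> real" where "\<psi> j x = indicator (cell j) x * ((x - (left j + v / 2)) / v)"
definition \<rho> :: "nat \<Rightarrow> real \<Rightarrow> real" where "\<rho> j x = 1 + h * \<psi> j x"
definition f :: "nat \<Rightarrow> real \<Rightarrow> real" where "f j x = f0 x * \<rho> j x"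
definition cells :: nat where "cells = nat \<lfloor>1 / \<delta>\<rfloor>"

lemma f0: "f0 \<in> densities a b" unfolding f0_def[abs_def] by (rule f0d)

sublocale base: prob_space "law f0" by (rule prob_space_law[OF f0])

lemma prob_UNIV: "base.prob UNIV = 1" using base.prob_space by simp

lemma v: "0 < v" using w \<delta> by (simp add: v_def)

lemma cell_subset:
  assumes "j < cells" "x \<in> cell j" shows "A < x" "x < A + w"
proof -
  have "real (j + 1) \<le> 1 / \<delta>"
  proof -
    have "int (j + 1) \<le> \<lfloor>1 / \<delta>\<rfloor>" using assms(1) by (simp add: cells_def)
    then show ?thesis by (simp add: le_floor_iff)
  qed
  then have "(real j + 1) * \<delta> \<le> 1" using \<delta> by (simp add: field_simps)
  then have "(real j + 1) * \<delta> * w \<le> 1 * w" using w by (intro mult_right_mono) auto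
  then have "left j + v \<le> A + w" by (simp add: left_def v_def algebra_simps)
  then show "x < A + w" using assms(2) by (simp add: cell_def)
  have "0 \<le> real j * v" using v by simp
  then show "A < x" using assms(2) unfolding cell_def left_def greaterThanLessThan_iff by linarith
qed

lemma disjoint_cells:
  assumes "i \<noteq> j" "x \<in> cell i" shows "x \<notin> cell j"
proof
  assume "x \<in> cell j"
  have "left i + v \<le> left j \<or> left j + v \<le> left i"
  proof -
    have "real (i + 1) * v \<le> real j * v" if "i < j" using that v by (intro mult_right_mono) auto
    moreover have "real (j + 1) * v \<le> real i * v" if "j < i" using that v by (intro mult_right_mono) auto
    ultimately show ?thesis using assms(1) by (cases i j rule: linorder_cases) (auto simp: left_def algebra_simps)
  qed
  then show False using assms(2) \<open>x \<in> cell j\<close> by (auto simp: cell_def)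
qed

lemma \<psi>_bound: "\<bar>\<psi> j x\<bar> \<le> 1 / 2"
proof (cases "x \<in> cell j")
  case True
  then have "x - (left j + v / 2) \<le> v / 2" "- (x - (left j + v / 2)) \<le> v / 2" unfolding cell_def greaterThanLessThan_iff by argo+
  then have "\<bar>x - (left j + v / 2)\<bar> \<le> v / 2" by (simp only: abs_le_iff)
  then show ?thesis using True v by (simp add: \<psi>_def abs_divide field_simps)
qed (simp add: \<psi>_def)

lemma h\<psi>_bound: "\<bar>h * \<psi> j x\<bar> \<le> 1 / 2"
proof -
  have "h * \<bar>\<psi> j x\<bar> \<le> 1 * (1 / 2)" using \<psi>_bound h by (intro mult_mono) auto
  then show ?thesis using h by (simp add: abs_mult)
qed

lemma \<rho>_bounds: "1 / 2 \<le> \<rho> j x" "\<rho> j x \<le> 2"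
  using h\<psi>_bound[of j x, THEN abs_le_D1] h\<psi>_bound[of j x, THEN abs_le_D2] unfolding \<rho>_def by linarith+

lemma \<rho>_pos: "0 < \<rho> j x" using \<rho>_bounds(1)[of j x] by linarith

lemma measurable_\<psi> [measurable]: "\<psi> j \<in> borel_measurable borel"
  unfolding \<psi>_def[abs_def] cell_def by measurable

lemma measurable_\<rho> [measurable]: "\<rho> j \<in> borel_measurable borel"
  unfolding \<rho>_def[abs_def] by measurable

lemma integrable_bounded_law:
  fixes g :: "real \<Rightarrow> real"
  assumes "g \<in> borel_measurable borel" "\<And>x. \<bar>g x\<bar> \<le> B"
  shows "integrable (law f0) g"
  by (rule base.integrable_const_bound[of _ B]) (use assms in auto)

lemma integrable_\<psi>_power: "integrable (law f0) (\<lambda>x. \<psi> j x ^ k)"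
proof (rule integrable_bounded_law[where B = 1])
  show "\<bar>\<psi> j x ^ k\<bar> \<le> 1" for x
    using \<psi>_bound[of j x] unfolding power_abs by (intro power_le_one) auto
qed measurable

text \<open>
  The perturbation is uniformly distributed on \<open>[-1/2,1/2]\<close> given the cell.
\<close>

lemma \<psi>_moment:
  assumes j: "j < cells" and k: "1 \<le> k"
  shows "(LINT x|law f0. \<psi> j x ^ k) = \<delta> * ((1 / 2) ^ (k + 1) - (- 1 / 2) ^ (k + 1)) / (real k + 1)"
proof -
  define l c where "l = left j" and "c = left j + v / 2"
  define F where "F x = v / (real k + 1) * ((x - c) / v) ^ (k + 1)" for x
  have "(LINT x|law f0. \<psi> j x ^ k) = (LINT x|lborel. f0 x *\<^sub>R \<psi> j x ^ k)"
    unfolding law_def using densitiesD(1,2)[OF f0] by (intro integral_density) auto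
  also have "\<dots> = (LINT x|lborel. (((x - c) / v) ^ k * indicator {l..l + v} x) / w)"
  proof (rule integral_cong_AE)
    have "AE x in lborel. x \<noteq> l \<and> x \<noteq> l + v" using AE_lborel_singleton[of l] AE_lborel_singleton[of "l + v"] by eventually_elim auto
    then show "AE x in lborel. f0 x *\<^sub>R \<psi> j x ^ k = (((x - c) / v) ^ k * indicator {l..l + v} x) / w"
    proof eventually_elim
      case (elim x)
      show ?case
      proof (cases "x \<in> cell j")
        case True
        then show ?thesis using cell_subset[OF j True] by (auto simp: f0_def \<psi>_def cell_def l_def c_def)
      next
        case False
        then have "x \<notin> {l..l + v}" using elim by (auto simp: cell_def l_def)
        then show ?thesis using False k by (simp add: \<psi>_def power_0_left)
      qed
    qed
    show "(\<lambda>x. f0 x *\<^sub>R \<psi> j x ^ k) \<in> borel_measurable lborel" using densitiesD(1)[OF f0] by measurable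
  qed measurable
  also have "\<dots> = (LINT x|lborel. ((x - c) / v) ^ k * indicator {l..l + v} x) / w" by simp
  also have "(LINT x|lborel. ((x - c) / v) ^ k * indicator {l..l + v} x) = F (l + v) - F l"
  proof (rule integral_FTC_Icc_real)
    show "l \<le> l + v" using v by simp
    fix x
    show "(F has_real_derivative ((x - c) / v) ^ k) (at x)"
    proof -
      have d: "((\<lambda>x. (x - c) / v) has_real_derivative 1 / v) (at x)"
        by (intro DERIV_cdivide) (auto intro!: derivative_eq_intros)
      have "(F has_real_derivative v / (real k + 1) * (real (k + 1) * (1 / v * ((x - c) / v) ^ (k + 1 - Suc 0)))) (at x)"
        unfolding F_def by (intro DERIV_cmult DERIV_power d)
      moreover have "v / (real k + 1) * (real (k + 1) * (1 / v * ((x - c) / v) ^ (k + 1 - Suc 0))) = ((x - c) / v) ^ k"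
      proof -
        have k1: "real (k + 1) = real k + 1" "k + 1 - Suc 0 = k" "real k + 1 \<noteq> 0" by auto
        have "v / (real k + 1) * ((real k + 1) * (1 / v * ((x - c) / v) ^ k)) = ((x - c) / v) ^ k"
          using v k1(3) by (simp only: mult.assoc[symmetric]) simp
        then show ?thesis unfolding k1(1,2) .
      qed
      ultimately show ?thesis by simp
    qed
    show "isCont (\<lambda>x. ((x - c) / v) ^ k) x" using v by (intro continuous_intros) auto
  qed
  also have "F (l + v) - F l = v / (real k + 1) * ((1 / 2) ^ (k + 1) - (- 1 / 2) ^ (k + 1))"
  proof -
    have "(l + v - c) / v = 1 / 2" "(l - c) / v = - 1 / 2" using v by (auto simp: l_def c_def field_simps)
    then show ?thesis unfolding F_def by (simp only: right_diff_distrib)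
  qed
  finally show ?thesis using w by (simp add: v_def)
qed

lemma \<psi>_moments:
  assumes "j < cells"
  shows "(LINT x|law f0. \<psi> j x) = 0" "(LINT x|law f0. (\<psi> j x)\<^sup>2) = \<delta> / 12" "(LINT x|law f0. (\<psi> j x) ^ 3) = 0"
    "(LINT x|law f0. (\<psi> j x) ^ 4) = \<delta> / 80"
  using \<psi>_moment[OF assms, of 1] \<psi>_moment[OF assms, of 2] \<psi>_moment[OF assms, of 3] \<psi>_moment[OF assms, of 4]
  by (simp_all add: power_numeral_reduce eval_nat_numeral)

lemma integrable_\<rho>: "integrable (law f0) (\<rho> j)"
proof (rule integrable_bounded_law[where B = 2])
  show "\<bar>\<rho> j x\<bar> \<le> 2" for x using \<rho>_bounds(2)[of j x] by (simp add: abs_of_pos[OF \<rho>_pos])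
qed measurable

lemma integral_\<rho>: "j < cells \<Longrightarrow> (LINT x|law f0. \<rho> j x) = 1"
  unfolding \<rho>_def using \<psi>_moments(1)[of j] integrable_\<psi>_power[of j 1] by (simp add: prob_UNIV)

lemma integrable_\<rho>\<rho>: "integrable (law f0) (\<lambda>x. \<rho> i x * \<rho> j x)"
proof (rule integrable_bounded_law[where B = "2 * 2"])
  show "\<bar>\<rho> i x * \<rho> j x\<bar> \<le> 2 * 2" for x
    using \<rho>_bounds[of i x] \<rho>_bounds[of j x] unfolding abs_mult by (intro mult_mono) auto
qed measurable

lemma integral_\<rho>\<rho>:
  assumes "i < cells" "j < cells" "i \<noteq> j"
  shows "(LINT x|law f0. \<rho> i x * \<rho> j x) = 1"
proof -
  have "\<psi> i x * \<psi> j x = 0" for x using disjoint_cells[OF assms(3), of x] by (auto simp: \<psi>_def indicator_def)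
  then have "\<rho> i x * \<rho> j x = 1 + (h * \<psi> i x + h * \<psi> j x)" for x
    using mult_zero_right[of "h * h"] by (simp add: \<rho>_def algebra_simps)
  then show ?thesis using \<psi>_moments(1)[OF assms(1)] \<psi>_moments(1)[OF assms(2)] integrable_\<psi>_power[of i 1] integrable_\<psi>_power[of j 1]
    by (simp add: prob_UNIV)
qed

lemma f_density:
  assumes j: "j < cells" shows "f j \<in> densities a b"
proof -
  note [measurable] = densitiesD(1)[OF f0]
  have "(\<integral>\<^sup>+ x. ennreal (f j x) \<partial>lborel) = (\<integral>\<^sup>+ x. ennreal (f0 x) * ennreal (\<rho> j x) \<partial>lborel)"
    using densitiesD(2)[OF f0] by (simp add: f_def ennreal_mult')
  also have "\<dots> = (\<integral>\<^sup>+ x. ennreal (\<rho> j x) \<partial>law f0)"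
    unfolding law_def by (intro nn_integral_density[symmetric]) auto
  also have "\<dots> = ennreal (LINT x|law f0. \<rho> j x)"
    using \<rho>_pos by (intro nn_integral_eq_integral integrable_\<rho>) (auto intro: less_imp_le)
  finally have "(\<integral>\<^sup>+ x. ennreal (f j x) \<partial>lborel) = 1" using integral_\<rho>[OF j] by simp
  moreover have "0 \<le> f j x" for x using densitiesD(2)[OF f0, of x] \<rho>_pos[of j x] by (simp add: f_def)
  moreover have "AE x in lborel. \<not> (a \<le> ereal x \<and> ereal x \<le> b) \<longrightarrow> f j x = 0"
    using densitiesD(4)[OF f0] by eventually_elim (simp add: f_def)
  moreover have "f j \<in> borel_measurable lborel" unfolding f_def[abs_def] by measurable
  ultimately show ?thesis unfolding densities_def by blast
qed

lemma f_F_class: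
  assumes j: "j < cells" shows "f j \<in> F_class a b (cell j) \<delta> (h * sqrt \<delta>)"
proof -
  define l c where "l = left j" and "c = left j + v / 2"
  have cell: "cell j = {l<..<l + v}" by (simp add: cell_def l_def)
  have fc: "f j x = 1 / w * (1 + h * ((x - c) / v))" if "x \<in> {l<..<l + v}" for x
    using that cell_subset[OF j, of x] by (simp add: f_def f0_def \<rho>_def \<psi>_def cell c_def)
  have "(\<integral>\<^sup>+ x. ennreal (f j x) * indicator {l<..<l + v} x \<partial>lborel)
      = (\<integral>\<^sup>+ x. ennreal (1 / w * (1 + h * ((x - c) / v))) * indicator {l<..<l + v} x \<partial>lborel)"
    by (intro nn_integral_cong) (use fc in \<open>auto simp: indicator_def\<close>)
  also have "\<dots> = ennreal ((\<lambda>x. 1 / w * (x + h / v * ((x - c)\<^sup>2 / 2))) (l + v) - (\<lambda>x. 1 / w * (x + h / v * ((x - c)\<^sup>2 / 2))) l)"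
  proof (rule nn_integral_interior_FTC)
    fix x assume x: "x \<in> {l<..<l + v}"
    show "((\<lambda>x. 1 / w * (x + h / v * ((x - c)\<^sup>2 / 2))) has_real_derivative 1 / w * (1 + h * ((x - c) / v))) (at x)"
    proof (rule DERIV_cmult)
      show "((\<lambda>x. x + h / v * ((x - c)\<^sup>2 / 2)) has_real_derivative 1 + h * ((x - c) / v)) (at x)"
        using v by (auto intro!: derivative_eq_intros simp: field_simps)
    qed
    show "0 \<le> 1 / w * (1 + h * ((x - c) / v))" using fc[OF x] densitiesD(2)[OF f_density[OF j], of x] by simp
  qed (use v w in \<open>auto intro!: continuous_intros\<close>)
  also have "(\<lambda>x. 1 / w * (x + h / v * ((x - c)\<^sup>2 / 2))) (l + v) - (\<lambda>x. 1 / w * (x + h / v * ((x - c)\<^sup>2 / 2))) l = \<delta>"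
  proof -
    have "(l + v - c)\<^sup>2 = (l - c)\<^sup>2" by (simp add: c_def l_def power2_eq_square field_simps)
    then have "(\<lambda>x. 1 / w * (x + h / v * ((x - c)\<^sup>2 / 2))) (l + v) - (\<lambda>x. 1 / w * (x + h / v * ((x - c)\<^sup>2 / 2))) l = 1 / w * v"
      by (simp add: diff_divide_distrib right_diff_distrib distrib_left add_divide_distrib)
    then show ?thesis using w by (simp add: v_def)
  qed
  finally have mass: "mass (f j) {l<..<l + v} = \<delta>"
    using \<delta> by (intro mass_eqI[OF f_density[OF j]]) auto
  show ?thesis unfolding cell
  proof (rule F_classI[OF f_density[OF j] mass _ \<delta>(1)])
    show "l < l + v" using v by simp
    fix x y assume xy: "l < x" "x < y" "y < l + v"
    have "f j y - f j x = 1 / w * (h * ((y - x) / v))"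
      using xy v w by (simp add: fc field_simps)
    moreover have "h * sqrt \<delta> * sqrt \<delta> / (l + v - l)\<^sup>2 * (y - x) = 1 / w * (h * ((y - x) / v))"
    proof -
      have "h * sqrt \<delta> * sqrt \<delta> = h * \<delta>" using \<delta> by (simp add: mult.assoc)
      then have "h * sqrt \<delta> * sqrt \<delta> / (l + v - l)\<^sup>2 * (y - x) = (h * \<delta> / v\<^sup>2) * (y - x)"
        by (simp only: add_diff_cancel_left')
      also have "h * \<delta> / v\<^sup>2 = h / (w * v)" using \<delta> w by (simp add: v_def power2_eq_square)
      finally show ?thesis by simp
    qed
    ultimately show "h * sqrt \<delta> * sqrt \<delta> / (l + v - l)\<^sup>2 * (y - x) \<le> f j y - f j x" by simp
  qed
qed

text \<open>
  The mean is a relative entropy: the leading term is half of the variance \<open>h\<^sup>2 \<delta> / 12\<close> of the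
  perturbation, the cubic term vanishes by symmetry. This \<open>24\<close> is the one in the optimal constant.
\<close>

lemma log_likelihood_moments:
  assumes j: "j < cells"
  shows "(LINT x|law (f j). ln (\<rho> j x)) \<le> h\<^sup>2 * \<delta> / 24 + h ^ 4 * \<delta> / 240"
    "(LINT x|law (f j). (ln (\<rho> j x))\<^sup>2) \<le> h\<^sup>2 * \<delta>"
    "integrable (law (f j)) (\<lambda>x. (ln (\<rho> j x))\<^sup>2)"
proof -
  have lawf: "law (f j) = density (law f0) (\<lambda>x. ennreal (\<rho> j x))"
    by (rule law_density_mult[OF f0]) (auto simp: f_def less_imp_le[OF \<rho>_pos])
  have E: "(LINT x|law (f j). g x) = (LINT x|law f0. \<rho> j x * g x)" if [measurable]: "g \<in> borel_measurable borel" for g :: "real \<Rightarrow> real"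
    unfolding lawf by (subst integral_density) (auto simp: less_imp_le[OF \<rho>_pos])
  have lnb: "\<bar>ln (\<rho> j x)\<bar> \<le> 1" for x
  proof -
    have "\<bar>ln (1 + h * \<psi> j x) - h * \<psi> j x\<bar> \<le> 2 * (h * \<psi> j x)\<^sup>2" by (rule abs_ln_one_plus_x_minus_x_bound[OF h\<psi>_bound])
    moreover have "(h * \<psi> j x)\<^sup>2 \<le> (1 / 2)\<^sup>2" using h\<psi>_bound[of j x] by (simp only: abs_le_square_iff[symmetric])
    ultimately show ?thesis using h\<psi>_bound[of j x] unfolding \<rho>_def by (simp add: power2_eq_square)
  qed
  have ip: "integrable (law f0) (\<lambda>x. (h * \<psi> j x) ^ k)" for k
    unfolding power_mult_distrib using integrable_\<psi>_power by auto
  have ip1: "integrable (law f0) (\<lambda>x. h * \<psi> j x)" using ip[of 1] by simp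
  have m: "(LINT x|law f0. h * \<psi> j x) = 0" "(LINT x|law f0. (h * \<psi> j x)\<^sup>2) = h\<^sup>2 * \<delta> / 12"
    "(LINT x|law f0. (h * \<psi> j x) ^ 3) = 0" "(LINT x|law f0. (h * \<psi> j x) ^ 4) = h ^ 4 * \<delta> / 80"
    unfolding power_mult_distrib using \<psi>_moments[OF j] by simp_all
  have "(LINT x|law f0. \<rho> j x * ln (\<rho> j x)) \<le> (LINT x|law f0. h * \<psi> j x + (h * \<psi> j x)\<^sup>2 / 2 - (h * \<psi> j x) ^ 3 / 6 + (h * \<psi> j x) ^ 4 / 3)"
  proof (rule integral_mono)
    show "integrable (law f0) (\<lambda>x. \<rho> j x * ln (\<rho> j x))"
    proof (rule integrable_bounded_law[where B = "2 * 1"])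
      show "\<bar>\<rho> j x * ln (\<rho> j x)\<bar> \<le> 2 * 1" for x
        unfolding abs_mult using lnb[of x] \<rho>_bounds[of j x] by (intro mult_mono) auto
    qed measurable
    show "integrable (law f0) (\<lambda>x. h * \<psi> j x + (h * \<psi> j x)\<^sup>2 / 2 - (h * \<psi> j x) ^ 3 / 6 + (h * \<psi> j x) ^ 4 / 3)"
      using ip1 ip[of 2] ip[of 3] ip[of 4] by auto
    show "\<rho> j x * ln (\<rho> j x) \<le> h * \<psi> j x + (h * \<psi> j x)\<^sup>2 / 2 - (h * \<psi> j x) ^ 3 / 6 + (h * \<psi> j x) ^ 4 / 3" for x
      unfolding \<rho>_def by (rule xlogx_le[OF h\<psi>_bound])
  qed
  also have "\<dots> = (LINT x|law f0. h * \<psi> j x) + (LINT x|law f0. (h * \<psi> j x)\<^sup>2) / 2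
      - (LINT x|law f0. (h * \<psi> j x) ^ 3) / 6 + (LINT x|law f0. (h * \<psi> j x) ^ 4) / 3"
    using ip1 ip[of 2] ip[of 3] ip[of 4] by simp
  also have "\<dots> = h\<^sup>2 * \<delta> / 24 + h ^ 4 * \<delta> / 240" unfolding m by simp
  finally show "(LINT x|law (f j). ln (\<rho> j x)) \<le> h\<^sup>2 * \<delta> / 24 + h ^ 4 * \<delta> / 240" by (subst E) auto
  have i2: "integrable (law f0) (\<lambda>x. \<rho> j x * (ln (\<rho> j x))\<^sup>2)"
  proof (rule integrable_bounded_law[where B = "2 * 1"])
    show "\<bar>\<rho> j x * (ln (\<rho> j x))\<^sup>2\<bar> \<le> 2 * 1" for x
      unfolding abs_mult using lnb[of x] \<rho>_bounds[of j x] by (intro mult_mono) (auto simp: abs_square_le_1)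
  qed measurable
  then show "integrable (law (f j)) (\<lambda>x. (ln (\<rho> j x))\<^sup>2)"
    unfolding lawf by (subst integrable_density) (auto simp: less_imp_le[OF \<rho>_pos])
  have "(LINT x|law f0. \<rho> j x * (ln (\<rho> j x))\<^sup>2) \<le> (LINT x|law f0. 8 * (h * \<psi> j x)\<^sup>2)"
  proof (rule integral_mono[OF i2])
    show "integrable (law f0) (\<lambda>x. 8 * (h * \<psi> j x)\<^sup>2)" using ip[of 2] by auto
    show "\<rho> j x * (ln (\<rho> j x))\<^sup>2 \<le> 8 * (h * \<psi> j x)\<^sup>2" for x
      unfolding \<rho>_def by (rule xlog2_le[OF h\<psi>_bound])
  qed
  also have "\<dots> = 8 * (LINT x|law f0. (h * \<psi> j x)\<^sup>2)" by simp
  also have "\<dots> = 8 * (h\<^sup>2 * \<delta> / 12)" by (simp only: m)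
  also have "\<dots> \<le> h\<^sup>2 * \<delta>" using h \<delta> by simp
  finally show "(LINT x|law (f j). (ln (\<rho> j x))\<^sup>2) \<le> h\<^sup>2 * \<delta>" by (subst E) auto
qed

text \<open>
  Expectations weighted by the likelihood ratio are expectations under the alternative, where the
  log likelihood ratio is a sum of independent variables and obeys Chebyshev's inequality.
\<close>

lemma likelihood_tail:
  assumes j: "j < cells" and K: "0 < K" and gap: "0 < gap" and m: "m = sample_size a b n"
    "gap \<le> ln K - real m * (h\<^sup>2 * \<delta> / 24 + h ^ 4 * \<delta> / 240)" "real m * (h\<^sup>2 * \<delta>) \<le> e * gap\<^sup>2"
  shows "(LINT y|sample_law a b n f0. lik m (\<rho> j) y * indicator {y. K < lik m (\<rho> j) y} y) \<le> e"
proof -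
  interpret lf: prob_space "law (f j)" by (rule prob_space_law[OF f_density[OF j]])
  let ?P = "sample_law a b n (f j)"
  interpret P: prob_space ?P by (rule prob_space_sample_law[OF f_density[OF j]])
  have likm: "lik m (\<rho> j) \<in> borel_measurable (sample_law a b n g)" for g unfolding m by (rule measurable_lik) measurable
  define S where "S = {y \<in> space ?P. gap \<le> \<bar>(\<Sum>i<m. ln (\<rho> j (y i))) - real m * (LINT x|law (f j). ln (\<rho> j x))\<bar>}"
  have Sm: "S \<in> P.events"
  proof -
    have "(\<lambda>y. \<Sum>i<m. ln (\<rho> j (y i))) \<in> borel_measurable (PiM {..<m} (\<lambda>_. borel))" by measurable
    then have [measurable]: "(\<lambda>y. \<Sum>i<m. ln (\<rho> j (y i))) \<in> borel_measurable ?P"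
      unfolding m measurable_cong_sets[OF sets_sample_law refl] .
    show ?thesis unfolding S_def by measurable
  qed
  have "(LINT y|sample_law a b n f0. lik m (\<rho> j) y * indicator {y. K < lik m (\<rho> j) y} y)
     = (LINT y|?P. indicator {y. K < lik m (\<rho> j) y} y)"
    unfolding m
    by (rule integral_sample_law_density(1)[OF f0 f_density[OF j] _ less_imp_le[OF \<rho>_pos], symmetric])
      (use likm[unfolded m] in \<open>auto simp: f_def\<close>)
  also have "\<dots> = P.prob ({y. K < lik m (\<rho> j) y} \<inter> space ?P)" by simp
  also have "\<dots> \<le> P.prob S"
  proof (rule P.finite_measure_mono[OF _ Sm])
    show "{y. K < lik m (\<rho> j) y} \<inter> space ?P \<subseteq> S"
    proof
      fix y assume y: "y \<in> {y. K < lik m (\<rho> j) y} \<inter> space ?P"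
      have "ln K < ln (lik m (\<rho> j) y)" using y K by simp
      also have "\<dots> = (\<Sum>i<m. ln (\<rho> j (y i)))" unfolding lik_def by (rule ln_prod) (auto simp: less_imp_neq[OF \<rho>_pos, symmetric])
      finally have "ln K < (\<Sum>i<m. ln (\<rho> j (y i)))" .
      moreover have "real m * (LINT x|law (f j). ln (\<rho> j x)) \<le> real m * (h\<^sup>2 * \<delta> / 24 + h ^ 4 * \<delta> / 240)"
        using log_likelihood_moments(1)[OF j] by (intro mult_left_mono) auto
      ultimately show "y \<in> S" using m(2) y unfolding S_def by (auto simp: abs_if)
    qed
  qed
  also have "\<dots> \<le> real m * (LINT x|law (f j). (ln (\<rho> j x))\<^sup>2) / gap\<^sup>2"
    unfolding S_def sample_law_eq m
    by (rule lf.Chebyshev_iid_sum[OF _ log_likelihood_moments(3)[OF j] gap]) measurable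
  also have "\<dots> \<le> real m * (h\<^sup>2 * \<delta>) / gap\<^sup>2"
    using log_likelihood_moments(2)[OF j] by (intro divide_right_mono mult_left_mono) auto
  also have "\<dots> \<le> e" using m(3) gap by (simp add: pos_divide_le_eq)
  finally show ?thesis .
qed

lemma min_power_mixture:
  assumes test: "is_test n \<phi>" and lev: "expect_test a b n \<phi> f0 \<le> \<alpha>" and \<alpha>: "0 \<le> \<alpha>" and \<tau>: "0 < \<tau>" and gap: "0 < gap"
    and m: "m = sample_size a b n" "gap \<le> ln (\<tau> * real cells) - real m * (h\<^sup>2 * \<delta> / 24 + h ^ 4 * \<delta> / 240)"
     "real m * (h\<^sup>2 * \<delta>) \<le> e * gap\<^sup>2" and e: "0 \<le> e" "e \<le> 1"
  shows "min_power a b n \<phi> (F_union a b \<delta> (h * sqrt \<delta>)) \<le> ereal (\<alpha> + sqrt (\<tau> + 2 * e) + e)"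
proof -
  let ?P = "sample_law a b n f0"
  interpret P: prob_space ?P by (rule prob_space_sample_law[OF f0])
  have cells: "0 < cells" using \<delta> by (simp add: cells_def)
  define \<Phi> where "\<Phi> y = \<phi> (ordered_vector a b n y)" for y
  have \<Phi>: "\<Phi> \<in> borel_measurable ?P" "\<And>y. 0 \<le> \<Phi> y" "\<And>y. \<Phi> y \<le> 1" "P.expectation \<Phi> \<le> \<alpha>"
    using test_measurable[OF test] test_bounds[OF test] lev by (auto simp: \<Phi>_def[abs_def] expect_test_def)
  have lik2: "lik m (\<rho> i) y * lik m (\<rho> j) y = lik m (\<lambda>x. \<rho> i x * \<rho> j x) y" for i j y
    by (simp add: lik_def prod.distrib)
  have avg: "(\<Sum>j<cells. P.expectation (\<lambda>y. lik m (\<rho> j) y * \<Phi> y)) / real cells \<le> \<alpha> + sqrt (\<tau> + 2 * e) + e"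
  proof (rule P.mixture_power_bound[OF _ _ _ _ _ _ _ \<Phi>(1,2,3,4) cells less_imp_le[OF \<tau>] e \<alpha>])
    show "lik m (\<rho> j) \<in> borel_measurable ?P" for j unfolding m by (rule measurable_lik) measurable
    show "0 \<le> lik m (\<rho> j) y" for j y by (rule lik_nonneg) (rule less_imp_le[OF \<rho>_pos])
    show "integrable ?P (lik m (\<rho> j))" for j unfolding m by (rule integral_lik(1)[OF f0 integrable_\<rho>])
    show "P.expectation (lik m (\<rho> j)) = 1" if "j < cells" for j
      unfolding m using integral_lik(2)[OF f0 integrable_\<rho>[of j], of a b n] integral_\<rho>[OF that] by simp
    show "integrable ?P (\<lambda>x. lik m (\<rho> i) x * lik m (\<rho> j) x)" for i j
      unfolding lik2 unfolding m by (rule integral_lik(1)[OF f0 integrable_\<rho>\<rho>])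
    show "P.expectation (\<lambda>x. lik m (\<rho> i) x * lik m (\<rho> j) x) \<le> 1" if "i < cells" "j < cells" "i \<noteq> j" for i j
      unfolding lik2 unfolding m using integral_lik(2)[OF f0 integrable_\<rho>\<rho>[of i j], of a b n] integral_\<rho>\<rho>[OF that] by simp
    show "P.expectation (\<lambda>y. lik m (\<rho> j) y * indicator {y. \<tau> * real cells < lik m (\<rho> j) y} y) \<le> e" if "j < cells" for j
      using \<tau> cells by (intro likelihood_tail[OF that _ gap m]) auto
  qed
  have each: "P.expectation (\<lambda>y. lik m (\<rho> j) y * \<Phi> y) = expect_test a b n \<phi> (f j)" if "j < cells" for j
    unfolding expect_test_def \<Phi>_def[symmetric] m
    by (rule integral_sample_law_density(1)[OF f0 f_density[OF that] _ less_imp_le[OF \<rho>_pos] _ \<Phi>(1), symmetric])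
      (auto simp: f_def)
  have "\<exists>j<cells. expect_test a b n \<phi> (f j) \<le> \<alpha> + sqrt (\<tau> + 2 * e) + e"
  proof (rule ccontr)
    assume "\<not> (\<exists>j<cells. expect_test a b n \<phi> (f j) \<le> \<alpha> + sqrt (\<tau> + 2 * e) + e)"
    then have "(\<Sum>j<cells. \<alpha> + sqrt (\<tau> + 2 * e) + e) < (\<Sum>j<cells. P.expectation (\<lambda>y. lik m (\<rho> j) y * \<Phi> y))"
      using cells by (intro sum_strict_mono) (auto simp: each not_le)
    then have "real cells * (\<alpha> + sqrt (\<tau> + 2 * e) + e) < (\<Sum>j<cells. P.expectation (\<lambda>y. lik m (\<rho> j) y * \<Phi> y))" by simp
    then show False using avg cells by (simp add: pos_divide_le_eq mult.commute)
  qed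
  then obtain j where j: "j < cells" "expect_test a b n \<phi> (f j) \<le> \<alpha> + sqrt (\<tau> + 2 * e) + e" by blast
  have "f j \<in> F_union a b \<delta> (h * sqrt \<delta>)"
    unfolding F_union_def
  proof (rule UN_I)
    show "f j \<in> F_class a b (cell j) \<delta> (h * sqrt \<delta>)" by (rule f_F_class[OF j(1)])
    have "left j < left j + v" using v by simp
    then show "cell j \<in> bounded_open_intervals" unfolding bounded_open_intervals_def cell_def by blast
  qed
  then show ?thesis using min_power_le[of "f j"] j(2) by (meson ereal_less_eq(3) order.trans)
qed

end

text \<open>
  With \<open>\<epsilon> = 1 - c n / sqrt 24\<close> the mean of the log likelihood ratio is at most \<open>(1 - \<epsilon>) log (e/\<delta>)\<close> up to a
  constant, and there are about \<open>1/\<delta>\<close> cells. On the logarithmic scale the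
  truncation level, about \<open>(1 - \<epsilon>/2) log (e/\<delta>)\<close>, lies half way between the two. This leaves a gap of many
  standard deviations because \<open>\<epsilon> sqrt (log (e/\<delta>))\<close> diverges.
\<close>

theorem optimality:
  fixes a b :: ereal and \<delta> c :: "nat \<Rightarrow> real" and \<alpha> :: real
  assumes ab: "a < b" and \<delta>: "\<And>n. n \<ge> 1 \<Longrightarrow> 0 < \<delta> n \<and> \<delta> n \<le> 1" and c: "\<And>n. n \<ge> 1 \<Longrightarrow> 0 < c n \<and> c n < sqrt 24"
    and \<alpha>: "0 < \<alpha>" and level: "\<forall>n\<ge>1. level_test a b n \<alpha> (nonincreasing_densities a b) (\<phi> n)"
    and \<delta>log: "\<forall>n\<ge>1. (ln (real n))\<^sup>2 / real n \<le> \<delta> n"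
    and lim: "filterlim (\<lambda>n. (sqrt 24 - c n) * sqrt (ln (exp 1 / \<delta> n))) at_top sequentially"
  shows "\<exists>r :: nat \<Rightarrow> real. r \<longlonglongrightarrow> 0 \<and> (\<forall>\<^sub>F n in sequentially.
      min_power a b n (\<phi> n) (F_union a b (\<delta> n) (c n * sqrt (ln (exp 1 / \<delta> n) / real n))) \<le> ereal (\<alpha> + r n))"
proof -
  define X where "X n = (1 - c n / sqrt 24) * sqrt (ln (exp 1 / \<delta> n))" for n
  have X: "filterlim X at_top sequentially"
  proof -
    have "X n = (1 / sqrt 24) * ((sqrt 24 - c n) * sqrt (ln (exp 1 / \<delta> n)))" for n by (simp add: X_def field_simps)
    then have "X = (\<lambda>n. (1 / sqrt 24) * ((sqrt 24 - c n) * sqrt (ln (exp 1 / \<delta> n))))" by auto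
    then show ?thesis using filterlim_tendsto_pos_mult_at_top[OF tendsto_const _ lim, of "1 / sqrt 24"] by simp
  qed
  define e where "e x = 72 / (x / 2 - 33)\<^sup>2" for x :: real
  define R where "R x = sqrt (exp (- x / 2) + 2 * e x) + e x" for x
  have "(R \<longlongrightarrow> 0) at_top" unfolding R_def e_def by real_asymp
  then have Rlim: "(\<lambda>n. R (X n)) \<longlonglongrightarrow> 0" using X by (rule filterlim_compose)
  have "\<forall>\<^sub>F n in sequentially. 1000 \<le> X n" using X by (auto simp: filterlim_at_top)
  moreover have "\<forall>\<^sub>F n in sequentially. 48 \<le> ln (real n)" by real_asymp
  moreover have "\<forall>\<^sub>F n in sequentially. (1::nat) \<le> n" by (rule eventually_ge_at_top)
  ultimately have "\<forall>\<^sub>F n in sequentially.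
      min_power a b n (\<phi> n) (F_union a b (\<delta> n) (c n * sqrt (ln (exp 1 / \<delta> n) / real n))) \<le> ereal (\<alpha> + R (X n))"
  proof eventually_elim
    case (elim n)
    define d \<Lambda> x m where "d = \<delta> n" and "\<Lambda> = ln (exp 1 / \<delta> n)" and "x = X n" and "m = sample_size a b n"
    have n0: "0 < real n" using elim by simp
    have lp: "0 < ln (real n)" using elim(2) by linarith
    have d: "0 < d" "d \<le> 1" "(ln (real n))\<^sup>2 \<le> real n * d" using \<delta>[OF elim(3)] \<delta>log elim n0 by (auto simp: d_def pos_divide_le_eq mult.commute)
    have cn: "0 < c n" "c n < sqrt 24" using c[OF elim(3)] by auto
    have \<Lambda>_eq: "\<Lambda> = 1 - ln d" using d by (simp add: \<Lambda>_def d_def ln_div)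
    have "ln d \<le> ln 1" using d by (subst ln_le_cancel_iff) auto
    then have \<Lambda>1: "1 \<le> \<Lambda>" unfolding \<Lambda>_eq ln_one by linarith
    have nd1: "1 \<le> real n * d"
    proof -
      have "1 * 1 \<le> ln (real n) * ln (real n)" using elim by (intro mult_mono) auto
      then show ?thesis using d(3) by (simp add: power2_eq_square)
    qed
    have \<Lambda>n: "\<Lambda> \<le> 1 + ln (real n)"
    proof -
      have "ln 1 \<le> ln (real n * d)" using nd1 by (subst ln_le_cancel_iff) auto
      also have "\<dots> = ln (real n) + ln d" using n0 d by (intro ln_mult_pos)
      finally show ?thesis unfolding \<Lambda>_eq ln_one by linarith
    qed
    have \<Lambda>n': "\<Lambda> \<le> real n" "\<Lambda> \<le> 2 * ln (real n)"
      using \<Lambda>n ln_le_minus_one[OF n0] elim by linarith+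
    define h where "h = c n * sqrt (\<Lambda> / (real n * d))"
    have c24: "(c n)\<^sup>2 \<le> 24"
    proof -
      have "(c n)\<^sup>2 \<le> (sqrt 24)\<^sup>2" using cn by (intro power_mono) auto
      then show ?thesis by simp
    qed
    have h2: "h\<^sup>2 = (c n)\<^sup>2 * (\<Lambda> / (real n * d))" using \<Lambda>1 d n0 by (simp add: h_def power_mult_distrib)
    have h0: "0 < h" using cn \<Lambda>1 d n0 by (simp add: h_def)
    have rat: "\<Lambda> / (real n * d) \<le> 2 / ln (real n)"
    proof -
      have "\<Lambda> / (real n * d) \<le> (2 * ln (real n)) / (ln (real n))\<^sup>2" using \<Lambda>n' d lp \<Lambda>1 by (intro frac_le) auto
      also have "\<dots> = 2 / ln (real n)" using lp by (simp add: power2_eq_square)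
      finally show ?thesis .
    qed
    have h1: "h \<le> 1"
    proof -
      have "2 / ln (real n) \<le> 2 / 48" using elim(2) lp by (intro divide_left_mono mult_pos_pos) simp_all
      then have "\<Lambda> / (real n * d) \<le> 1 / 24" using rat by linarith
      then have "h\<^sup>2 \<le> 24 * (1 / 24)" unfolding h2 using c24 \<Lambda>1 d n0 by (intro mult_mono) auto
      then show ?thesis by (intro power2_le_imp_le[of h 1]) auto
    qed
    obtain A w where Aw: "0 < w" "\<And>x. A < x \<Longrightarrow> x < A + w \<Longrightarrow> a < ereal x \<and> ereal x < b"
      "(\<lambda>x. indicator {A<..<A + w} x / w) \<in> nonincreasing_densities a b"
      "(\<lambda>x. indicator {A<..<A + w} x / w) \<in> densities a b" 
      by (rule uniform_base_density[OF ab], rule that)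
    interpret B: bumps a b A w d h
      by (rule bumps.intro[OF Aw(1) d(1,2) h0 h1 Aw(2,4)])
    have lev: "level_test a b n \<alpha> (nonincreasing_densities a b) (\<phi> n)" using level elim by auto
    have test: "is_test n (\<phi> n)" "expect_test a b n (\<phi> n) B.f0 \<le> \<alpha>"
      using lev Aw(3) unfolding level_test_def B.f0_def[abs_def] by blast+
    define \<epsilon> where "\<epsilon> = 1 - c n / sqrt 24"
    (* half of the available exponent is used for truncation, the other half is the gap *)
    define \<tau> where "\<tau> = exp (- (\<epsilon> * \<Lambda>) / 2)"
    have \<epsilon>: "0 < \<epsilon>" "\<epsilon> < 1" using cn by (auto simp: \<epsilon>_def divide_less_eq)
    have x: "x = \<epsilon> * sqrt \<Lambda>" "1000 \<le> x" using elim by (simp_all add: x_def X_def \<epsilon>_def \<Lambda>_def)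
    have s1: "1 \<le> sqrt \<Lambda>" using \<Lambda>1 by simp
    have x\<Lambda>: "x * sqrt \<Lambda> = \<epsilon> * \<Lambda>" using \<Lambda>1 by (simp add: x(1))
    define gap where "gap = (x / 2 - 33) * sqrt \<Lambda>"
    have gap0: "0 < gap" using x s1 by (simp add: gap_def)
    have m3: "real m \<le> 3 * real n" "real m \<le> real n + 2" using sample_size_bounds(2)[of a b n] elim by (auto simp: m_def)
    have mh: "real m * (h\<^sup>2 * d) \<le> 72 * \<Lambda>"
    proof -
      have "h\<^sup>2 * d = (c n)\<^sup>2 * \<Lambda> / real n" using d n0 by (simp add: h2)
      also have "\<dots> \<le> 24 * \<Lambda> / real n" using c24 \<Lambda>1 n0 by (intro divide_right_mono mult_right_mono) auto
      finally have "real m * (h\<^sup>2 * d) \<le> (3 * real n) * (24 * \<Lambda> / real n)" using m3 d by (intro mult_mono) auto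
      then show ?thesis using n0 by simp
    qed
    have gap2: "gap \<le> ln (\<tau> * real B.cells) - real m * (h\<^sup>2 * d / 24 + h ^ 4 * d / 240)"
    proof -
      have cells: "1 / (2 * d) \<le> real B.cells"
      proof -
        have "1 \<le> \<lfloor>1 / d\<rfloor>" using d by (simp add: le_floor_iff)
        then have "1 \<le> real_of_int \<lfloor>1 / d\<rfloor>" by simp
        then have "1 / d \<le> 2 * real_of_int \<lfloor>1 / d\<rfloor>"
          using real_of_int_floor_add_one_gt[of "1 / d"] by linarith
        then show ?thesis using d by (simp add: B.cells_def)
      qed
      have dpos: "0 < 1 / (2 * d)" using d by simp
      then have cpos: "0 < real B.cells" using cells by linarith
      have "ln (1 / (2 * d)) \<le> ln (real B.cells)" using cells dpos cpos by (subst ln_le_cancel_iff)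
      moreover have "ln (1 / (2 * d)) = - (ln 2 + ln d)" using d by (simp add: ln_div ln_mult_pos)
      ultimately have lc: "\<Lambda> - 2 \<le> ln (real B.cells)" unfolding \<Lambda>_eq using ln_2_less_1 by linarith
      have "ln (\<tau> * real B.cells) = ln \<tau> + ln (real B.cells)" using cpos by (intro ln_mult_pos) (auto simp: \<tau>_def)
      then have l1: "- \<epsilon> * \<Lambda> / 2 + (\<Lambda> - 2) \<le> ln (\<tau> * real B.cells)" using lc by (simp add: \<tau>_def)
      have l2: "real m * (h\<^sup>2 * d / 24) \<le> (1 - \<epsilon>) * \<Lambda> + 2"
      proof -
        have cc: "(c n)\<^sup>2 / 24 \<le> 1 - \<epsilon>"
        proof -
          have "(c n)\<^sup>2 / 24 = (1 - \<epsilon>)\<^sup>2" by (simp add: \<epsilon>_def power_divide)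
          also have "\<dots> \<le> (1 - \<epsilon>) * 1" unfolding power2_eq_square using \<epsilon> by (intro mult_left_mono) auto
          finally show ?thesis by simp
        qed
        have "h\<^sup>2 * d / 24 = ((c n)\<^sup>2 / 24) * (\<Lambda> / real n)" using d n0 by (simp add: h2)
        then have "real m * (h\<^sup>2 * d / 24) \<le> (real n + 2) * ((1 - \<epsilon>) * (\<Lambda> / real n))"
          using m3 cc \<Lambda>1 n0 \<epsilon> by (auto intro!: mult_mono divide_right_mono simp del: times_divide_eq_right)
        also have "\<dots> = (1 - \<epsilon>) * \<Lambda> + 2 * ((1 - \<epsilon>) * (\<Lambda> / real n))" using n0 by (simp add: field_simps)
        also have "(1 - \<epsilon>) * (\<Lambda> / real n) \<le> 1 * 1" using \<epsilon> \<Lambda>n' n0 \<Lambda>1 by (intro mult_mono) auto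
        finally show ?thesis by simp
      qed
      (* this is where the lower bound (ln n)^2 / n on the mass enters: h^4 d is then of order 1 / n *)
    have l3: "real m * (h ^ 4 * d / 240) \<le> 29"
      proof -
        have "h ^ 4 * d = (h\<^sup>2)\<^sup>2 * d" by (simp flip: power_mult)
        also have "\<dots> = ((c n)\<^sup>2)\<^sup>2 * (\<Lambda>\<^sup>2 / (real n * d)) / real n" unfolding h2 using d n0 by (simp add: field_simps power2_eq_square)
        also have "\<dots> \<le> 24\<^sup>2 * 4 / real n"
        proof (intro divide_right_mono mult_mono)
          show "((c n)\<^sup>2)\<^sup>2 \<le> 24\<^sup>2" using c24 by (intro power_mono) auto
          have "\<Lambda>\<^sup>2 / (real n * d) \<le> (2 * ln (real n))\<^sup>2 / (ln (real n))\<^sup>2"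
            using \<Lambda>n' \<Lambda>1 d lp by (intro frac_le power_mono) auto
          also have "\<dots> = 4" using lp by (simp add: power_mult_distrib)
          finally show "\<Lambda>\<^sup>2 / (real n * d) \<le> 4" .
        qed (use d n0 in auto)
        finally have "h ^ 4 * d / 240 \<le> 24\<^sup>2 * 4 / real n / 240" by (intro divide_right_mono) auto
        then have "real m * (h ^ 4 * d / 240) \<le> (3 * real n) * (24\<^sup>2 * 4 / real n / 240)"
          using m3 d h0 by (intro mult_mono) auto
        also have "\<dots> \<le> 29" using n0 by simp
        finally show ?thesis .
      qed
      have "gap \<le> \<epsilon> * \<Lambda> / 2 - 33"
      proof -
        have "gap = x * sqrt \<Lambda> / 2 - 33 * sqrt \<Lambda>" by (simp add: gap_def algebra_simps)
        also have "\<dots> = \<epsilon> * \<Lambda> / 2 - 33 * sqrt \<Lambda>" unfolding x\<Lambda> ..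
        finally show ?thesis using s1 by linarith
      qed
      then show ?thesis using l1 l2 l3 by (simp add: algebra_simps)
    qed
    have e0: "0 \<le> e x" "e x \<le> 1"
    proof -
      have "72 \<le> (x / 2 - 33)\<^sup>2"
      proof -
        have "9 * 9 \<le> (x / 2 - 33) * (x / 2 - 33)" using x by (intro mult_mono) auto
        then show ?thesis by (simp add: power2_eq_square)
      qed
      then show "0 \<le> e x" "e x \<le> 1" by (auto simp: e_def divide_le_eq)
    qed
    have "(x / 2 - 33)\<^sup>2 \<noteq> 0" using x by simp
    then have "e x * gap\<^sup>2 = 72 * \<Lambda>" using \<Lambda>1 by (simp add: e_def gap_def power_mult_distrib)
    then have me: "real m * (h\<^sup>2 * d) \<le> e x * gap\<^sup>2" using mh by simp
    have "min_power a b n (\<phi> n) (F_union a b d (h * sqrt d)) \<le> ereal (\<alpha> + sqrt (\<tau> + 2 * e x) + e x)"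
      by (rule B.min_power_mixture[OF test less_imp_le[OF \<alpha>] _ gap0 m_def gap2 me e0]) (simp add: \<tau>_def)
    also have "h * sqrt d = c n * sqrt (\<Lambda> / real n)" using d n0 by (simp add: h_def real_sqrt_divide real_sqrt_mult)
    also have "\<tau> \<le> exp (- x / 2)"
    proof -
      have "x * 1 \<le> x * sqrt \<Lambda>" using x s1 by (intro mult_left_mono) auto
      then have "x \<le> \<epsilon> * \<Lambda>" unfolding x\<Lambda> by simp
      then show ?thesis by (simp add: \<tau>_def)
    qed
    then have "ereal (\<alpha> + sqrt (\<tau> + 2 * e x) + e x) \<le> ereal (\<alpha> + R x)" by (simp add: R_def)
    finally show ?case by (simp add: d_def \<Lambda>_def x_def)
  qed
  then show ?thesis using Rlim by (intro exI[of _ "\<lambda>n. R (X n)"]) auto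
qed

section \<open>Consistency of the multiscale test\<close>

lemma measure_law:
  assumes f: "f \<in> densities a b" and L: "L \<in> sets borel"
  shows "measure (law f) L = mass f L"
proof -
  have "emeasure (law f) L = ennreal (mass f L)"
    unfolding law_def using densitiesD(1)[OF f] L nn_mass[OF f L] by (subst emeasure_density) auto
  then show ?thesis using mass_nonneg[OF f, of L] by (simp add: measure_def)
qed

text \<open>
  All \<open>m\<close> observations miss the set with probability \<open>(1 - p) ^ m\<close>.
\<close>

lemma prob_no_point_in:
  assumes f: "f \<in> densities a' b'" and L: "L \<in> sets borel" and p: "mass f L = p" and m: "m = sample_size a b n"
  shows "measure (sample_law a b n f) {y \<in> space (sample_law a b n f). \<forall>i<m. y i \<notin> L} \<le> exp (- real m * p)"
    "{y \<in> space (sample_law a b n f). \<forall>i<m. y i \<notin> L} \<in> sets (sample_law a b n f)"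
proof -
  interpret lf: prob_space "law f" by (rule prob_space_law[OF f])
  interpret prod: product_sigma_finite "\<lambda>_::nat. law f" by standard
  have eq: "{y \<in> space (sample_law a b n f). \<forall>i<m. y i \<notin> L} = Pi\<^sub>E {..<m} (\<lambda>_. - L)"
    unfolding sample_law_eq m[symmetric] space_PiM
    by (rule set_eqI) (simp add: PiE_iff law_def Ball_def conj_commute)
  show "{y \<in> space (sample_law a b n f). \<forall>i<m. y i \<notin> L} \<in> sets (sample_law a b n f)"
    unfolding eq unfolding sample_law_eq m[symmetric] 
    by (rule sets_PiM_I_finite) (use L in \<open>simp_all add: law_def\<close>)
  have q: "lf.prob (- L) = 1 - p"
  proof -
    have L': "L \<in> lf.events" using L by (simp add: law_def)
    have "lf.prob (space (law f) - L) = 1 - p"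
      using lf.prob_compl[OF L'] measure_law[OF f L] p by (simp only:)
    moreover have "space (law f) - L = - L" unfolding law_def by (simp only: space_density space_lborel space_borel) blast
    ultimately show ?thesis by (simp only:)
  qed
  have "emeasure (sample_law a b n f) (Pi\<^sub>E {..<m} (\<lambda>_. - L)) = ennreal (1 - p) ^ m"
  proof -
    have "emeasure (Pi\<^sub>M {..<m} (\<lambda>_. law f)) (Pi\<^sub>E {..<m} (\<lambda>_. - L)) = (\<Prod>i<m. emeasure (law f) (- L))"
      by (rule prod.emeasure_PiM) (use L in \<open>simp_all add: law_def\<close>)
    also have "\<dots> = (\<Prod>i<m. ennreal (1 - p))" unfolding lf.emeasure_eq_measure q ..
    also have "\<dots> = ennreal (1 - p) ^ m" by (simp only: prod_constant card_lessThan)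
    finally show ?thesis unfolding sample_law_eq m[symmetric] .
  qed
  also have q0: "0 \<le> 1 - p" unfolding q[symmetric] by simp
  then have "ennreal (1 - p) ^ m = ennreal ((1 - p) ^ m)" by (rule ennreal_power)
  finally have "measure (sample_law a b n f) (Pi\<^sub>E {..<m} (\<lambda>_. - L)) = (1 - p) ^ m" using q0 by (simp add: measure_def)
  also have "\<dots> \<le> exp (- p) ^ m" using q0 exp_ge_add_one_self[of "- p"] by (intro power_mono) auto
  also have "\<dots> = exp (- real m * p)" using exp_of_nat_mult[of m "- p"] by simp
  finally show "measure (sample_law a b n f) {y \<in> space (sample_law a b n f). \<forall>i<m. y i \<notin> L} \<le> exp (- real m * p)"
    unfolding eq .
qed

text \<open>
  Continuity of the distribution function and the intermediate value theorem.
\<close>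

lemma exists_left_quantile:
  assumes f: "f \<in> densities a b" and lr: "l < r" and p: "0 < p" "p \<le> mass f {l<..<r}"
  obtains u where "l < u" "u \<le> r" "mass f {l<..<u} = p"
proof -
  have int: "set_integrable lborel {l..r} f"
    unfolding set_integrable_def using integrable_density_fun[OF f] by (intro integrable_mult_indicator) auto
  have mass: "mass f {l<..<u} = integral {l..u} f" if "u \<le> r" for u
  proof -
    have "mass f {l<..<u} = (LINT x:{l..u}|lborel. f x)"
      unfolding mass_def set_lebesgue_integral_def
    proof (rule integral_cong_AE)
      show "AE x in lborel. indicator {l<..<u} x *\<^sub>R f x = indicator {l..u} x *\<^sub>R f x"
        using AE_lborel_singleton[of l] AE_lborel_singleton[of u] by eventually_elim (auto simp: indicator_def)
    qed (use densitiesD(1)[OF f] in measurable)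
    also have "\<dots> = integral {l..u} f"
      using that by (intro set_borel_integral_eq_integral set_integrable_subset[OF int]) auto
    finally show ?thesis .
  qed
  have "continuous_on {l..r} (\<lambda>u. integral {l..u} f)"
    by (intro indefinite_integral_continuous_1) (rule set_borel_integral_eq_integral(1)[OF int])
  then obtain u where u: "l \<le> u" "u \<le> r" "integral {l..u} f = p"
    using IVT'[of "\<lambda>u. integral {l..u} f" l p r] p mass[of r] lr by auto
  have "l \<noteq> u" using u p by auto
  then show ?thesis using that[of u] u mass by auto
qed

lemma exists_right_quantile:
  assumes f: "f \<in> densities a b" and lr: "l < r" and p: "0 < p" "p \<le> mass f {l<..<r}"
  obtains u where "l \<le> u" "u < r" "mass f {u<..<r} = p"
proof -
  have int: "set_integrable lborel {l..r} f"
    unfolding set_integrable_def using integrable_density_fun[OF f] by (intro integrable_mult_indicator) auto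
  have mass: "mass f {u<..<r} = integral {u..r} f" if "l \<le> u" for u
  proof -
    have "mass f {u<..<r} = (LINT x:{u..r}|lborel. f x)"
      unfolding mass_def set_lebesgue_integral_def
    proof (rule integral_cong_AE)
      show "AE x in lborel. indicator {u<..<r} x *\<^sub>R f x = indicator {u..r} x *\<^sub>R f x"
        using AE_lborel_singleton[of r] AE_lborel_singleton[of u] by eventually_elim (auto simp: indicator_def)
    qed (use densitiesD(1)[OF f] in measurable)
    also have "\<dots> = integral {u..r} f"
      using that by (intro set_borel_integral_eq_integral set_integrable_subset[OF int]) auto
    finally show ?thesis .
  qed
  have "continuous_on {l..r} (\<lambda>u. integral {u..r} f)"
    by (intro indefinite_integral_continuous_1') (rule set_borel_integral_eq_integral(1)[OF int])
  then obtain u where u: "l \<le> u" "u \<le> r" "integral {u..r} f = p"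
    using IVT2'[of "\<lambda>u. integral {u..r} f" r p l] p mass[of l] lr by auto
  have "u \<noteq> r" using u p by auto
  then show ?thesis using that[of u] u mass by auto
qed

text \<open>
  Here \<open>\<psi>\<close> maps the interval to \<open>(0,1)\<close>, in analogy to the standardisation inside the local statistic.
\<close>

locale steep_density =
  fixes a b :: ereal and f :: "real \<Rightarrow> real" and l r \<sigma> \<delta> :: real
  assumes f: "f \<in> densities a b" and lr: "l < r" and mass: "mass f {l<..<r} = \<delta>" and \<sigma>: "0 < \<sigma>"
    and slope: "\<And>x y. l < x \<Longrightarrow> x < y \<Longrightarrow> y < r \<Longrightarrow> \<sigma> * (y - x) \<le> f y - f x"
begin

definition w :: real where "w = r - l"
definition \<psi> :: "real \<Rightarrow> real" where "\<psi> x = (x - l) / w"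

lemma w: "0 < w" using lr by (simp add: w_def)

text \<open>
  Slope bound and nonnegativity at a point slightly to the right of \<open>u\<close>; the point \<open>u\<close> itself may be
  the end point of the interval, where nothing is known.
\<close>

lemma density_lower: assumes "l \<le> u" "u < x" "x < r" shows "\<sigma> * (x - u) \<le> f x"
proof (rule field_le_epsilon)
  fix e :: real assume e: "0 < e"
  define y where "y = min ((u + x) / 2) (u + e / \<sigma>)"
  have y: "u < y" "y < x" "y \<le> u + e / \<sigma>" using assms e \<sigma> by (auto simp: y_def min_less_iff_disj)
  have "\<sigma> * (x - y) \<le> f x - f y" using y assms by (intro slope) auto
  moreover have "\<sigma> * (y - u) \<le> \<sigma> * (e / \<sigma>)" using y \<sigma> by (intro mult_left_mono) auto
  ultimately show "\<sigma> * (x - u) \<le> f x + e" using densitiesD(2)[OF f, of y] \<sigma> by (simp add: algebra_simps)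
qed

lemma mass_lower: assumes "l \<le> u" "u < v" "v \<le> r" shows "\<sigma> * (v - u)\<^sup>2 / 2 \<le> mass f {u<..<v}"
proof -
  have "ennreal ((\<lambda>x. \<sigma> * (x - u)\<^sup>2 / 2) v - (\<lambda>x. \<sigma> * (x - u)\<^sup>2 / 2) u) = (\<integral>\<^sup>+ x. ennreal (\<sigma> * (x - u)) * indicator {u<..<v} x \<partial>lborel)"
  proof (rule nn_integral_interior_FTC[symmetric])
    fix x assume "x \<in> {u<..<v}"
    then show "0 \<le> \<sigma> * (x - u)" using \<sigma> by simp
    show "((\<lambda>x. \<sigma> * (x - u)\<^sup>2 / 2) has_real_derivative \<sigma> * (x - u)) (at x)"
      by (auto intro!: derivative_eq_intros)
  qed (use assms in \<open>auto intro!: continuous_intros\<close>)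
  also have "\<dots> \<le> (\<integral>\<^sup>+ x. ennreal (f x) * indicator {u<..<v} x \<partial>lborel)"
    using density_lower[of u] assms by (intro nn_integral_mono) (auto simp: indicator_def intro!: ennreal_leI)
  also have "\<dots> = ennreal (mass f {u<..<v})" by (rule nn_mass[OF f]) simp
  finally show ?thesis using mass_nonneg[OF f, of "{u<..<v}"] by simp
qed

text \<open>
  The extreme observations in the interval leave gaps of relative sizes \<open>s\<close> and \<open>t\<close> at its ends. On the
  interval \<open>(u,v)\<close> between the gaps the score is centred at the midpoint \<open>c\<close>, so a density with slope at least \<open>\<sigma>\<close> correlates with it
  at least as much as a linear one. On the left gap the integrand is bounded below by \<open>- 2\<close>, and on the right gap it
  is nonnegative.
\<close>

lemma score_moment:
  assumes s: "0 \<le> s" "0 \<le> t" "s + t < 1"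
  shows "\<sigma> * w\<^sup>2 * (1 - s - t) ^ 3 / 6 - 2 * mass f {l<..<l + s * w}
    \<le> (LINT x|law f. indicator {l<..<r} x * (2 * \<psi> x - 1)) - (s - t) * \<delta>"
proof -
  define u v c where "u = l + s * w" and "v = r - t * w" and "c = (l + s * w + (r - t * w)) / 2"
  have uv: "l \<le> u" "u < v" "v \<le> r"
  proof -
    show "l \<le> u" "v \<le> r" using s w by (auto simp: u_def v_def)
    have "(s + t) * w < 1 * w" using s w by (intro mult_strict_right_mono) auto
    then show "u < v" by (simp add: u_def v_def w_def algebra_simps)
  qed
  have vu: "v - u = (1 - s - t) * w" by (simp add: u_def v_def w_def algebra_simps)
  have c: "c = (u + v) / 2" by (simp add: c_def u_def v_def)
  have c_in: "l < c" "c < r" using uv by (auto simp: c)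
  have lin: "2 * \<psi> x - 1 - s + t = 2 * (x - c) / w" for x
  proof -
    have "2 * c = l + s * w + (r - t * w)" by (simp add: c_def)
    then have "2 * c = l + r + (s - t) * w" by (simp add: algebra_simps)
    then have "2 * (x - c) = 2 * (x - l) - w - (s - t) * w" by (simp add: w_def algebra_simps)
    then have "2 * (x - c) / w = (2 * (x - l) - w - (s - t) * w) / w" by simp
    also have "\<dots> = 2 * ((x - l) / w) - 1 - (s - t)" using w by (simp add: diff_divide_distrib)
    finally show ?thesis by (simp add: \<psi>_def)
  qed
  (* g is the score recentred at c; k is its product with the line of slope \<sigma> through (c, f c) *)
  define g where "g x = indicator {l<..<r} x * (2 * \<psi> x - 1 - s + t)" for x
  define k where "k x = (2 * (x - c) / w) * (f c + \<sigma> * (x - c))" for x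
  have [measurable]: "\<psi> \<in> borel_measurable borel" unfolding \<psi>_def[abs_def] by measurable
  note [measurable] = densitiesD(1)[OF f]
  interpret lf: prob_space "law f" by (rule prob_space_law[OF f])
  have \<psi>01: "0 < \<psi> x" "\<psi> x < 1" if "l < x" "x < r" for x using that w by (auto simp: \<psi>_def w_def)
  have gb: "\<bar>g x\<bar> \<le> 2" for x
    using s \<psi>01[of x] unfolding g_def by (cases "x \<in> {l<..<r}") (auto simp: abs_if)
  have gm: "g \<in> borel_measurable borel" unfolding g_def[abs_def] by measurable
  have ig: "integrable (law f) g" by (rule lf.integrable_const_bound[of _ 2]) (use gb gm in auto)
  have i1: "integrable (law f) (\<lambda>x. indicator {l<..<r} x * (2 * \<psi> x - 1))"
  proof (rule lf.integrable_const_bound[of _ 1])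
    show "AE x in law f. norm (indicator {l<..<r} x * (2 * \<psi> x - 1)) \<le> 1"
    proof (rule AE_I2)
      fix x show "norm (indicator {l<..<r} x * (2 * \<psi> x - 1)) \<le> 1"
        using \<psi>01[of x] by (cases "x \<in> {l<..<r}") (auto simp: abs_le_iff)
    qed
  qed measurable
  have i2: "integrable (law f) (\<lambda>x. indicator {l<..<r} x :: real)" by (rule lf.integrable_const_bound[of _ 1]) auto
  have EI: "(LINT x|law f. indicator {l<..<r} x) = \<delta>"
    using measure_law[OF f, of "{l<..<r}"] mass by simp
  have "(LINT x|law f. indicator {l<..<r} x * (2 * \<psi> x - 1)) - (s - t) * \<delta>
      = (LINT x|law f. indicator {l<..<r} x * (2 * \<psi> x - 1) - (s - t) * indicator {l<..<r} x)"
    using i1 i2 EI by simp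
  also have "\<dots> = (LINT x|law f. g x)" by (intro Bochner_Integration.integral_cong) (auto simp: g_def algebra_simps)
  also have "\<dots> = (LINT x|lborel. f x *\<^sub>R g x)"
    unfolding law_def using densitiesD(2)[OF f] gm by (intro integral_density) auto
  finally have Eg: "(LINT x|law f. indicator {l<..<r} x * (2 * \<psi> x - 1)) - (s - t) * \<delta> = (LINT x|lborel. f x * g x)" by simp
  have ifg: "integrable lborel (\<lambda>x. f x * g x)"
  proof -
    have "integrable lborel (\<lambda>x. f x *\<^sub>R g x)"
      using ig densitiesD(2)[OF f] gm unfolding law_def by (subst (asm) integrable_density) auto
    then show ?thesis by simp
  qed
  define F where "F x = 2 / w * (f c * ((x - c)\<^sup>2 / 2) + \<sigma> * ((x - c) ^ 3 / 3))" for x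
  have kint: "has_bochner_integral lborel (\<lambda>x. k x * indicator {u..v} x) (F v - F u)"
  proof (rule has_bochner_integral_FTC_Icc_real)
    show "u \<le> v" using uv by simp
    fix x
    have "(F has_real_derivative 2 / w * (f c * (x - c) + \<sigma> * (x - c)\<^sup>2)) (at x)"
      unfolding F_def by (rule DERIV_cmult) (auto intro!: derivative_eq_intros)
    moreover have "2 / w * (f c * (x - c) + \<sigma> * (x - c)\<^sup>2) = k x"
      unfolding k_def by (simp only: divide_inverse power2_eq_square) algebra
    ultimately show "(F has_real_derivative k x) (at x)" by simp
    show "isCont k x" unfolding k_def using w by (intro continuous_intros) auto
  qed
  have Fvu: "F v - F u = \<sigma> * w\<^sup>2 * (1 - s - t) ^ 3 / 6"
  proof -
    have vc: "v - c = (v - u) / 2" "u - c = - ((v - u) / 2)" by (simp_all add: c field_simps)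
    have "F v - F u = 2 / w * (\<sigma> * (2 * ((v - u) / 2) ^ 3 / 3))"
      unfolding F_def vc by (simp add: algebra_simps)
    also have "\<dots> = 2 / w * (\<sigma> * (2 * ((1 - s - t) * w / 2) ^ 3 / 3))" by (simp only: vu)
    also have "\<dots> = \<sigma> * w\<^sup>2 * (1 - s - t) ^ 3 / 6" using w by (simp add: power_mult_distrib power2_eq_square power3_eq_cube)
    finally show ?thesis .
  qed
  define z where "z x = f x * indicator {l<..<u} x" for x
  have zint: "integrable lborel z" "(LINT x|lborel. z x) = mass f {l<..<u}"
  proof -
    have "integrable lborel (\<lambda>x. indicator {l<..<u} x *\<^sub>R f x)"
      using integrable_density_fun[OF f] by (intro integrable_mult_indicator) auto
    then show "integrable lborel z" by (simp add: z_def[abs_def] mult.commute)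
    show "(LINT x|lborel. z x) = mass f {l<..<u}" by (simp add: mass_def set_lebesgue_integral_def z_def mult.commute)
  qed
  have "(LINT x|lborel. k x * indicator {u..v} x - 2 * z x) \<le> (LINT x|lborel. f x * g x)"
  proof (rule integral_mono_AE[OF _ ifg])
    show "integrable lborel (\<lambda>x. k x * indicator {u..v} x - 2 * z x)"
      using has_bochner_integral_integrable kint zint(1) by (auto simp: has_bochner_integral_iff)
    have "AE x in lborel. x \<noteq> l \<and> x \<noteq> r" using AE_lborel_singleton[of l] AE_lborel_singleton[of r] by eventually_elim auto
    then show "AE x in lborel. k x * indicator {u..v} x - 2 * z x \<le> f x * g x"
    proof eventually_elim
      case (elim x)
      have fx: "0 \<le> f x" by (rule densitiesD(2)[OF f])
      consider "x \<notin> {l<..<r}" | "x \<in> {l<..<r}" "x < u" | "x \<in> {l<..<r}" "u \<le> x" "x \<le> v" | "x \<in> {l<..<r}" "v < x" by force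
      then show ?case
      proof cases
        case 1
        then have "x \<notin> {u..v}" "x \<notin> {l<..<u}" using uv elim by auto
        then show ?thesis using 1 by (simp add: z_def g_def)
      next
        case 2
        have "f x * (- 2) \<le> f x * g x" using gb[of x] fx by (intro mult_left_mono) (auto simp: abs_le_iff)
        then show ?thesis using 2 by (simp add: z_def)
      next
        case 3
        have gx: "g x = 2 * (x - c) / w" using 3 lin[of x] by (simp add: g_def)
        have "0 \<le> (x - c) * (f x - f c - \<sigma> * (x - c))"
        proof (cases x c rule: linorder_cases)
          case less
          then have "\<sigma> * (c - x) \<le> f c - f x" using 3 c_in by (intro slope) auto
          then have "f x - f c - \<sigma> * (x - c) \<le> 0" by (simp add: algebra_simps)
          then show ?thesis using less by (intro mult_nonpos_nonpos) auto
        next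
          case greater
          then have "\<sigma> * (x - c) \<le> f x - f c" using 3 c_in by (intro slope) auto
          then show ?thesis using greater by (intro mult_nonneg_nonneg) auto
        qed simp
        then have "0 \<le> 2 / w * ((x - c) * (f x - f c - \<sigma> * (x - c)))" using w by simp
        also have "2 / w * ((x - c) * (f x - f c - \<sigma> * (x - c))) = f x * g x - k x"
          unfolding gx k_def by (simp only: divide_inverse) algebra
        finally have "k x \<le> f x * g x" by simp
        moreover have "z x = 0" using 3 by (simp add: z_def)
        ultimately show ?thesis using 3 by simp
      next
        case 4
        have "0 \<le> g x" using 4 lin[of x] uv w by (simp add: g_def c)
        then show ?thesis using 4 fx uv by (simp add: z_def)
      qed
    qed
  qed
  moreover have "(LINT x|lborel. k x * indicator {u..v} x - 2 * z x) = (F v - F u) - 2 * mass f {l<..<u}"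
    using kint zint by (simp add: has_bochner_integral_iff)
  ultimately show ?thesis unfolding Eg Fvu by (simp add: u_def)
qed

end

text \<open>
  An end gap of relative size \<open>s\<close> has mass at least \<open>\<delta> h s\<^sup>2 / 2\<close>, and a gap without observations has
  mass \<open>O(1/n)\<close>; this explains the hypotheses on \<open>s\<close> and \<open>s'\<close>.
\<close>

lemma small_gaps:
  fixes M h t s s' R :: real
  assumes R: "0 \<le> R" "M = R\<^sup>2" and t: "1 \<le> t" and h: "0 \<le> h" "h \<le> 2" and Mh: "32 * t \<le> M * h"
    and s: "0 \<le> s" "M * h * s\<^sup>2 \<le> 2 * t" and s': "0 \<le> s'" "M * h * s'\<^sup>2 \<le> 2 * t"
  shows "s + s' \<le> 1 / 2" "M * h * (s + s') \<le> 4 * t * R"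
proof -
  have "(s + s')\<^sup>2 \<le> 2 * s\<^sup>2 + 2 * s'\<^sup>2" using zero_le_power2[of "s - s'"] by (simp add: power2_eq_square algebra_simps)
  then have "M * h * (s + s')\<^sup>2 \<le> M * h * (2 * s\<^sup>2 + 2 * s'\<^sup>2)" using Mh t by (intro mult_left_mono) auto
  also have "\<dots> = 2 * (M * h * s\<^sup>2) + 2 * (M * h * s'\<^sup>2)" by (simp add: algebra_simps)
  also have "\<dots> \<le> 8 * t" using s(2) s'(2) by linarith
  finally have z: "M * h * (s + s')\<^sup>2 \<le> 8 * t" .
  have "32 * t * (s + s')\<^sup>2 \<le> M * h * (s + s')\<^sup>2" using Mh by (intro mult_right_mono) auto
  with z have "t * (4 * (s + s')\<^sup>2) \<le> t * 1" by linarith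
  then have "4 * (s + s')\<^sup>2 \<le> 1" by (rule mult_left_le_imp_le) (use t in simp)
  moreover have "(1 / 2 :: real)\<^sup>2 = 1 / 4" by (simp add: power2_eq_square)
  ultimately have "(s + s')\<^sup>2 \<le> (1 / 2)\<^sup>2" by linarith
  then show "s + s' \<le> 1 / 2" by (rule power2_le_imp_le) simp
  have "(M * h * (s + s'))\<^sup>2 = M * h * (M * h * (s + s')\<^sup>2)" by (simp add: power2_eq_square)
  also have "\<dots> \<le> M * h * (8 * t)" using z Mh t by (intro mult_left_mono) auto
  also have "\<dots> \<le> M * 2 * (8 * t)" using h(2) t R(2) by (intro mult_right_mono mult_left_mono) simp_all
  also have "\<dots> = 16 * R\<^sup>2 * t" unfolding R(2) by simp
  also have "\<dots> \<le> 16 * R\<^sup>2 * t\<^sup>2" using t self_le_power[of t 2] by (intro mult_left_mono) auto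
  also have "\<dots> = (4 * t * R)\<^sup>2" by (simp add: power2_eq_square)
  finally show "M * h * (s + s') \<le> 4 * t * R" by (rule power2_le_imp_le) (use t R(1) in simp)
qed

text \<open>
  The arithmetic of the signal bound. Here \<open>M = n \<delta>\<close>, \<open>A\<close> is the number of observations in the interval,
  \<open>S\<close> the sum of their scores relative to the whole interval, and \<open>T\<close> the local statistic relative to the extreme
  observations; the two kinds of scores are related by an affine map.
\<close>

lemma local_statistic_lower:
  fixes M h t s s' R A S T :: real
  assumes R: "1 \<le> R" "M = R\<^sup>2" and t: "1 \<le> t" and h: "0 \<le> h" "h \<le> 2" and Mh: "32 * t \<le> M * h"
    and s: "0 \<le> s" "M * h * s\<^sup>2 \<le> 2 * t" and s': "0 \<le> s'" "M * h * s'\<^sup>2 \<le> 2 * t"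
    and A: "\<bar>A - M\<bar> \<le> t * R" and S: "M * h * (1 - s - s') ^ 3 / 6 + (s - s') * M - 2 * t - t * R \<le> S"
    and T: "(1 - s - s') * T = S - A * (s - s')"
  shows "M * h / 6 - 10 * t * R \<le> T"
proof -
  define z where "z = 1 - s - s'"
  have gaps: "s + s' \<le> 1 / 2" "M * h * (s + s') \<le> 4 * t * R"
    using small_gaps[OF _ R(2) t h Mh s s'] R(1) by auto
  have z: "1 / 2 \<le> z" "z \<le> 1" using gaps s s' by (auto simp: z_def)
  have tR: "t \<le> t * R" "1 \<le> t * R" using t R(1) mult_mono[of 1 t 1 R] by auto
  have "\<bar>(s - s') * (A - M)\<bar> \<le> 1 * (t * R)" unfolding abs_mult using A gaps s s' by (intro mult_mono) auto
  then have "(s - s') * (A - M) \<le> t * R" by (simp add: abs_le_iff)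
  then have "M * h * z ^ 3 / 6 - 4 * (t * R) \<le> S - A * (s - s')"
    using S tR unfolding z_def[symmetric] by (simp add: algebra_simps)
  then have zT: "M * h * z ^ 3 / 6 - 4 * (t * R) \<le> z * T" unfolding T[symmetric] z_def .
  have "z * (M * h / 6 - 10 * t * R) \<le> z * (M * h * z\<^sup>2 / 6 - 8 * (t * R))"
  proof (rule mult_left_mono)
    have "(1 - 2 * (s + s')) \<le> z\<^sup>2" using zero_le_power2[of "s + s'"] by (simp add: z_def power2_eq_square algebra_simps)
    then have "M * h * (1 - 2 * (s + s')) \<le> M * h * z\<^sup>2" using Mh t by (intro mult_left_mono) auto
    then have "M * h - 2 * (M * h * (s + s')) \<le> M * h * z\<^sup>2" by (simp add: algebra_simps)
    then show "M * h / 6 - 10 * t * R \<le> M * h * z\<^sup>2 / 6 - 8 * (t * R)" using gaps tR by linarith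
  qed (use z in simp)
  also have "\<dots> = M * h * z ^ 3 / 6 - z * (8 * (t * R))" by (simp add: power2_eq_square power3_eq_cube algebra_simps)
  also have "\<dots> \<le> M * h * z ^ 3 / 6 - 1 / 2 * (8 * (t * R))"
    using z tR by (intro diff_left_mono mult_right_mono) auto
  also have "\<dots> \<le> z * T" using zT by linarith
  finally show ?thesis using z by simp
qed

lemma large_sample:
  fixes C t K R \<Lambda> :: real
  assumes t: "1 \<le> t" and \<Lambda>: "1 \<le> \<Lambda>" and C: "C * sqrt \<Lambda> \<le> 2 * R" and K: "0 \<le> K"
    and big: "6 * (11 * t + (1 + t) * (4 + K)) + 1 \<le> (C - sqrt 24) * sqrt \<Lambda>"
  shows "66 * t \<le> C * sqrt \<Lambda>" "33 * t \<le> R"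
proof -
  define q where "q = (1 + t) * (4 + K)"
  have "0 \<le> q" using t K by (simp add: q_def)
  moreover have "6 * (11 * t + q) + 1 \<le> (C - sqrt 24) * sqrt \<Lambda>" using big by (simp only: q_def)
  moreover have "6 * (11 * t + q) = 66 * t + 6 * q" by simp
  ultimately have "66 * t \<le> (C - sqrt 24) * sqrt \<Lambda>" by linarith
  moreover have "0 \<le> sqrt 24 * sqrt \<Lambda>" using \<Lambda> by simp
  ultimately show "66 * t \<le> C * sqrt \<Lambda>" by (simp add: algebra_simps)
  then show "33 * t \<le> R" using C by linarith
qed

text \<open>
  The arithmetic of the critical value: \<open>k - j - 1\<close> is \<open>M\<close> up to \<open>O(sqrt M)\<close>, and the penalty at
  \<open>(k - j) / (n + 1) \<ge> \<delta> / 4\<close> exceeds the one at \<open>\<delta>\<close> by at most \<open>4\<close>. All lower order terms are absorbed by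
  the excess of \<open>C\<close> over \<open>sqrt 24\<close>.
\<close>

lemma local_critical_value:
  fixes \<delta> C t K R A :: real and n m :: nat
  assumes n: "1 \<le> n" "n \<le> m" and \<delta>: "0 < \<delta>" "\<delta> \<le> 1" and R: "R = sqrt (real m * \<delta>)" and t: "1 \<le> t"
    and \<Lambda>: "\<Lambda> = ln (exp 1 / \<delta>)" and C: "sqrt 24 < C" "C * sqrt \<Lambda> \<le> 2 * R"
    and K: "0 \<le> K" "kappa n \<alpha> \<le> K"
    and big: "6 * (11 * t + (1 + t) * (4 + K)) + 1 \<le> (C - sqrt 24) * sqrt \<Lambda>"
    and A: "\<bar>A - R\<^sup>2\<bar> \<le> t * R" and jk: "real k - real j = A - 1" "(A - 1) / (real n + 1) \<le> 1"
  shows "crit n \<alpha> j k < R * (C * sqrt \<Lambda>) / 6 - 10 * t * R"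
proof -
  have \<Lambda>1: "1 \<le> \<Lambda>" unfolding \<Lambda> using \<delta> by (simp add: ln_div)
  have R33: "33 * t \<le> R" by (rule large_sample(2)[OF t \<Lambda>1 C(2) K(1) big])
  then have R1: "1 \<le> R" "4 * t \<le> R" using t by auto
  have "t * R \<le> R * R / 4" using R1 mult_right_mono[of "4 * t" R R] by simp
  moreover have "1 \<le> R * R / 16"
  proof -
    have "4 * 4 \<le> R * R" using R1 t by (intro mult_mono) auto
    then show ?thesis by simp
  qed
  ultimately have A1: "R\<^sup>2 / 2 \<le> A - 1" using A unfolding power2_eq_square by (simp add: abs_le_iff)
  have pd: "pen ((A - 1) / (real n + 1)) \<le> sqrt (2 * \<Lambda>) + 4"
  proof -
    have "real n * \<delta> / 2 \<le> A - 1"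
    proof -
      have "real n * \<delta> \<le> real m * \<delta>" using n \<delta> by (intro mult_right_mono) auto
      moreover have "R\<^sup>2 = real m * \<delta>" unfolding R using \<delta> by simp
      ultimately show ?thesis using A1 by linarith
    qed
    moreover have "\<delta> / 4 * (real n + 1) \<le> real n * \<delta> / 2"
    proof -
      have "\<delta> * 1 \<le> \<delta> * real n" using n \<delta> by (intro mult_left_mono) auto
      then show ?thesis by (simp add: algebra_simps)
    qed
    ultimately have "\<delta> / 4 \<le> (A - 1) / (real n + 1)" by (simp add: pos_le_divide_eq)
    then have "pen ((A - 1) / (real n + 1)) \<le> pen (\<delta> / 4)" using \<delta> by (intro pen_antimono) auto
    also have "\<dots> \<le> pen (\<delta> / 2) + 2" using \<delta> by (intro pen_half) auto
    also have "pen (\<delta> / 2) \<le> pen \<delta> + 2" using \<delta> by (intro pen_half) auto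
    finally show ?thesis by (simp add: pen_def \<Lambda>)
  qed
  have sA: "sqrt ((A - 2) / 3) \<le> (R + t) / sqrt 3"
  proof -
    have "A - 2 \<le> R\<^sup>2 + t * R" using A by (simp add: abs_le_iff)
    also have "\<dots> \<le> (R + t)\<^sup>2" using t R1 by (simp add: power2_sum)
    finally have "sqrt (A - 2) \<le> R + t" using t R1 by (intro real_le_lsqrt) auto
    then show ?thesis by (simp add: real_sqrt_divide divide_right_mono)
  qed
  have "crit n \<alpha> j k = sqrt ((A - 2) / 3) * (pen ((A - 1) / (real n + 1)) + kappa n \<alpha>)"
    unfolding crit_def jk by simp
  also have "\<dots> \<le> sqrt ((A - 2) / 3) * (sqrt (2 * \<Lambda>) + 4 + K)"
  proof (rule mult_left_mono)
    have "0 \<le> A - 2" using A1 R33 t \<open>1 \<le> R * R / 16\<close> unfolding power2_eq_square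
    proof -
      have "33 * 33 \<le> R * R" using R33 t by (intro mult_mono) auto
      then show ?thesis using A1 unfolding power2_eq_square by linarith
    qed
    then show "0 \<le> sqrt ((A - 2) / 3)" by simp
  qed (use pd K in linarith)
  also have "\<dots> \<le> (R + t) / sqrt 3 * (sqrt (2 * \<Lambda>) + 4 + K)"
    using sA K \<Lambda>1 by (intro mult_right_mono) auto
  also have "\<dots> = R * (sqrt (2 / 3) * sqrt \<Lambda>) + t * (sqrt (2 / 3) * sqrt \<Lambda>) + (R + t) * (4 + K) / sqrt 3"
    by (simp add: real_sqrt_mult real_sqrt_divide algebra_simps add_divide_distrib)
  also have "sqrt (2 / 3) = sqrt 24 / 6"
  proof -
    have "sqrt 24 / sqrt 36 = sqrt (24 / 36)" by (simp only: real_sqrt_divide)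
    moreover have "sqrt 36 = (6::real)" using real_sqrt_abs[of 6] by simp
    ultimately show ?thesis by simp
  qed
  also have "t * (sqrt 24 / 6 * sqrt \<Lambda>) \<le> t * R"
  proof (rule mult_left_mono)
    have "sqrt 24 * sqrt \<Lambda> \<le> C * sqrt \<Lambda>" using C \<Lambda>1 by (intro mult_right_mono) auto
    then show "sqrt 24 / 6 * sqrt \<Lambda> \<le> R" using C R1 by simp
  qed (use t in simp)
  also have "(R + t) * (4 + K) / sqrt 3 \<le> R * ((1 + t) * (4 + K))"
  proof -
    have "t * 1 \<le> t * R" using t R1 by (intro mult_left_mono) auto
    then have "(R + t) * (4 + K) \<le> R * (1 + t) * (4 + K)" using K by (intro mult_right_mono) (auto simp: algebra_simps)
    moreover have "(R + t) * (4 + K) / sqrt 3 \<le> (R + t) * (4 + K) / 1" using K R1 t by (intro divide_left_mono) auto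
    ultimately show ?thesis by (simp add: mult.assoc)
  qed
  finally have 1: "crit n \<alpha> j k \<le> R * (sqrt 24 / 6 * sqrt \<Lambda>) + t * R + R * ((1 + t) * (4 + K))" by simp
  have "R * (6 * (11 * t + (1 + t) * (4 + K)) + 1) \<le> R * ((C - sqrt 24) * sqrt \<Lambda>)"
    using big R1 by (intro mult_left_mono) auto
  then have "66 * (t * R) + 6 * (R * ((1 + t) * (4 + K))) + R \<le> R * (C * sqrt \<Lambda>) - R * (sqrt 24 * sqrt \<Lambda>)"
    by (simp add: algebra_simps)
  moreover have "R * (sqrt 24 / 6 * sqrt \<Lambda>) = R * (sqrt 24 * sqrt \<Lambda>) / 6" by simp
  ultimately show "crit n \<alpha> j k < R * (C * sqrt \<Lambda>) / 6 - 10 * t * R" using 1 R1 by linarith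
qed

context steep_density
begin

lemma \<psi>_01: "l < x \<Longrightarrow> x < r \<Longrightarrow> 0 < \<psi> x \<and> \<psi> x < 1"
  using w by (simp add: \<psi>_def w_def)

lemma support: "l < x \<Longrightarrow> x < r \<Longrightarrow> a < ereal x" "l < x \<Longrightarrow> x < r \<Longrightarrow> ereal x < b"
  using steep_support[OF f \<sigma> slope] by blast+

text \<open>
  Known end points of the support do not lie inside the interval, so they do not contribute.
\<close>

lemma sum_observations:
  assumes h: "\<And>x. x \<notin> {l<..<r} \<Longrightarrow> h x = 0" and ab: "a < b"
  shows "(\<Sum>i\<le>n+1. h (ordered_vector a b n y i)) = (\<Sum>i<sample_size a b n. h (y i) :: real)"
proof -
  have "h (real_of_ereal a) = 0" if "a \<noteq> -\<infinity>"
  proof (rule h)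
    have "a \<noteq> \<infinity>" using ab by auto
    then have "ereal (real_of_ereal a) = a" using that by (intro ereal_real') auto
    then show "real_of_ereal a \<notin> {l<..<r}" using support(1)[of "real_of_ereal a"] by auto
  qed
  moreover have "h (real_of_ereal b) = 0" if "b \<noteq> \<infinity>"
  proof (rule h)
    have "b \<noteq> -\<infinity>" using ab by auto
    then have "ereal (real_of_ereal b) = b" using that by (intro ereal_real') auto
    then show "real_of_ereal b \<notin> {l<..<r}" using support(2)[of "real_of_ereal b"] by auto
  qed
  ultimately show ?thesis unfolding sum_ordered_vector sum_list_points by auto
qed

text \<open>
  The indices \<open>j\<close> and \<open>k\<close> are those of the smallest and the largest point in the interval. The scores
  relative to \<open>(X j, X k)\<close> are affine functions of those relative to \<open>(l,r)\<close>; the terms of the points \<open>X j\<close> and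
  \<open>X k\<close> themselves, which the local statistic omits, cancel.
\<close>

lemma observed_range:
  fixes y n
  defines "X \<equiv> ordered_vector a b n y"
  defines "A \<equiv> (\<Sum>i<sample_size a b n. indicator {l<..<r} (y i) :: real)"
    and "S \<equiv> (\<Sum>i<sample_size a b n. indicator {l<..<r} (y i) * (2 * \<psi> (y i) - 1))"
  assumes ab: "a < b" and dist: "distinct (points a b n y)"
    and u: "u \<le> r" "\<exists>i<sample_size a b n. y i \<in> {l<..<u}" and v: "l \<le> v" "\<exists>i<sample_size a b n. y i \<in> {v<..<r}"
    and A3: "3 \<le> A"
  obtains j k where "j + 1 < k" "k \<le> n + 1" "l < X j" "X j < u" "v < X k" "X k < r" "real k - real j = A - 1"
    "(1 - \<psi> (X j) - (1 - \<psi> (X k))) * T_loc j k X = S - A * (\<psi> (X j) - (1 - \<psi> (X k)))"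
proof -
  define Idx where "Idx = {i \<in> {..n+1}. X i \<in> {l<..<r}}"
  have fin: "finite Idx" by (simp add: Idx_def)
  have mono: "X i \<le> X j" if "i \<le> j" "j \<le> n + 1" for i j
    unfolding X_def by (rule ordered_vector_mono[OF that])
  have smono: "X i < X j" if "i < j" "j \<le> n + 1" for i j
    unfolding X_def by (rule ordered_vector_strict_mono[OF dist that])
  have pt: "\<exists>i\<le>n+1. X i = y i0" if "i0 < sample_size a b n" for i0
  proof -
    have "y i0 \<in> set (points a b n y)" using that by (auto simp: points_def)
    then show ?thesis unfolding ordered_vector_image[of a b n y, symmetric] X_def by auto
  qed
  obtain i1 where i1: "i1 \<in> Idx" "X i1 < u"
    using u pt unfolding Idx_def by fastforce
  obtain i2 where i2: "i2 \<in> Idx" "v < X i2"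
    using v pt unfolding Idx_def by fastforce
  define j k where "j = Min Idx" and "k = Max Idx"
  have ne: "Idx \<noteq> {}" using i1 by auto
  have jI: "j \<in> Idx" and kI: "k \<in> Idx" using fin ne by (auto simp: j_def k_def)
  have Idx_eq: "Idx = {j..k}"
  proof
    show "Idx \<subseteq> {j..k}" using fin by (auto simp: j_def k_def)
    show "{j..k} \<subseteq> Idx"
    proof
      fix i assume i: "i \<in> {j..k}"
      then have "X j \<le> X i" "X i \<le> X k" "i \<le> n + 1" using kI by (auto simp: Idx_def intro!: mono)
      then show "i \<in> Idx" using jI kI by (auto simp: Idx_def)
    qed
  qed
  have inI: "l < X i \<and> X i < r" if "i \<in> {j..k}" for i
    using that unfolding Idx_eq[symmetric] by (simp add: Idx_def)
  have kn: "k \<le> n + 1" and jX: "l < X j" "X j < r" and kX: "l < X k" "X k < r" using jI kI by (auto simp: Idx_def)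
  have Xju: "X j < u"
  proof -
    have "X j \<le> X i1" using i1 fin by (intro mono) (auto simp: j_def Idx_def)
    then show ?thesis using i1 by simp
  qed
  have Xkv: "v < X k"
  proof -
    have "X i2 \<le> X k" using i2 fin kn by (intro mono) (auto simp: k_def)
    then show ?thesis using i2 by simp
  qed
  have sumI: "(\<Sum>i<sample_size a b n. h (y i)) = (\<Sum>i=j..k. h (X i))" if "\<And>x. x \<notin> {l<..<r} \<Longrightarrow> h x = (0::real)" for h
  proof -
    have "(\<Sum>i<sample_size a b n. h (y i)) = (\<Sum>i\<le>n+1. h (X i))"
      unfolding X_def by (rule sum_observations[symmetric]) (use that ab in auto)
    also have "\<dots> = (\<Sum>i\<in>Idx. h (X i))"
      by (rule sum.mono_neutral_right) (use that in \<open>auto simp: Idx_def\<close>)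
    finally show ?thesis unfolding Idx_eq .
  qed
  have "A = (\<Sum>i=j..k. indicator {l<..<r} (X i))" unfolding A_def by (rule sumI) auto
  also have "\<dots> = (\<Sum>i=j..k. 1)" by (rule sum.cong[OF refl]) (use inI in simp)
  also have "\<dots> = real (Suc k - j)" by simp
  finally have "A = real (Suc k - j)" .
  then have jk: "j + 1 < k" and Ak: "real k - real j = A - 1" using A3 by auto
  define s s' where "s = \<psi> (X j)" and "s' = 1 - \<psi> (X k)"
  have XX: "X j < X k" using jk kn by (intro smono) auto
  have z: "1 - s - s' = (X k - X j) / w" unfolding s_def s'_def \<psi>_def using w by (simp add: diff_divide_distrib)
  then have z0: "0 < 1 - s - s'" using XX w by simp
  have "S = (\<Sum>i=j..k. indicator {l<..<r} (X i) * (2 * \<psi> (X i) - 1))" unfolding S_def by (rule sumI) auto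
  also have "\<dots> = (\<Sum>i=j..k. 2 * \<psi> (X i) - 1)" by (rule sum.cong[OF refl]) (use inI in simp)
  finally have S: "S = (\<Sum>i=j..k. 2 * \<psi> (X i) - 1)" .
  have "S - A * (s - s') = (\<Sum>i=j..k. (2 * \<psi> (X i) - 1) - (s - s'))"
    unfolding S sum_subtractf sum_constant \<open>A = real (Suc k - j)\<close> by (simp only: card_atLeastAtMost right_diff_distrib)
  also have "\<dots> = (\<Sum>i=j+1..k-1. (2 * \<psi> (X i) - 1) - (s - s'))"
  proof -
    (* the scores at the two ends are -1 and 1 after the affine map, so their sum is zero *)
    have set: "{j..k} = insert j (insert k {j+1..k-1})" using jk by auto
    have "(\<Sum>i=j..k. (2 * \<psi> (X i) - 1) - (s - s')) = ((2 * \<psi> (X j) - 1) - (s - s')) + (((2 * \<psi> (X k) - 1) - (s - s')) + (\<Sum>i=j+1..k-1. (2 * \<psi> (X i) - 1) - (s - s')))"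
      unfolding set using jk by (subst sum.insert; simp)
    moreover have "((2 * \<psi> (X j) - 1) - (s - s')) + ((2 * \<psi> (X k) - 1) - (s - s')) = 0" by (simp add: s_def s'_def)
    ultimately show ?thesis by linarith
  qed
  also have "\<dots> = (\<Sum>i=j+1..k-1. (1 - s - s') * score ((X i - X j) / (X k - X j)))"
  proof (rule sum.cong[OF refl])
    fix i assume i: "i \<in> {j+1..k-1}"
    then have "X j < X i" "X i < X k" using jk kn by (auto intro!: smono)
    then have "score ((X i - X j) / (X k - X j)) = 2 * ((X i - X j) / (X k - X j)) - 1"
      by (simp add: score_def)
    then have "(1 - s - s') * score ((X i - X j) / (X k - X j)) = (1 - s - s') * (2 * ((X i - X j) / (X k - X j)) - 1)"
      by (simp only:)
    also have "\<dots> = 2 * ((1 - s - s') * ((X i - X j) / (X k - X j))) - (1 - s - s')"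
      by (simp only: right_diff_distrib mult.left_commute mult_1_right)
    also have "(1 - s - s') * ((X i - X j) / (X k - X j)) = (X i - X j) / w" unfolding z using XX by simp
    also have "(X i - X j) / w = \<psi> (X i) - s" by (simp add: \<psi>_def s_def diff_divide_distrib)
    finally show "(2 * \<psi> (X i) - 1) - (s - s') = (1 - s - s') * score ((X i - X j) / (X k - X j))" by simp
  qed
  also have "\<dots> = (1 - s - s') * T_loc j k X" by (simp only: T_loc_def sum_distrib_left)
  finally show ?thesis using that[of j k] jk kn jX kX Xju Xkv Ak unfolding s_def s'_def by simp
qed

end

lemma mass_mono:
  assumes f: "f \<in> densities a b" and L: "L \<in> sets borel" "L' \<in> sets borel" "L \<subseteq> L'"
  shows "mass f L \<le> mass f L'"
proof -
  interpret lf: prob_space "law f" by (rule prob_space_law[OF f])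
  have "lf.prob L \<le> lf.prob L'" by (rule lf.finite_measure_mono) (use L in simp_all)
  then show ?thesis unfolding measure_law[OF f L(1)] measure_law[OF f L(2)] .
qed

lemma sets_detection_event:
  "{y \<in> space (sample_law a b n f). \<exists>J \<in> D_plus n \<alpha> (ordered_vector a b n y). J \<subseteq> {l<..<r}} \<in> sets (sample_law a b n f)"
proof -
  define P where "P p y \<longleftrightarrow> (let j = fst p; k = snd p; X = ordered_vector a b n y in
      crit n \<alpha> j k < T_loc j k X \<and> (X k \<le> X j \<or> (l \<le> X j \<and> X k \<le> r)))" for p y
  have sub: "{x<..<z} \<subseteq> {l<..<r} \<longleftrightarrow> z \<le> x \<or> (l \<le> x \<and> z \<le> r)" for x z :: real
    by (auto simp: greaterThanLessThan_subseteq_greaterThanLessThan)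
  have eq: "(\<exists>J \<in> D_plus n \<alpha> (ordered_vector a b n y). J \<subseteq> {l<..<r}) \<longleftrightarrow> (\<exists>p\<in>pairs n. P p y)" for y
  proof -
    have "(\<exists>J \<in> D_plus n \<alpha> X. J \<subseteq> {l<..<r}) \<longleftrightarrow>
        (\<exists>j k. (j + 1 < k \<and> k \<le> n + 1) \<and> crit n \<alpha> j k < T_loc j k X \<and> {X j<..<X k} \<subseteq> {l<..<r})" for X
      unfolding D_plus_def by blast
    then show ?thesis unfolding sub by (simp add: pairs_def P_def Let_def)
  qed
  have "{y \<in> space (sample_law a b n f). \<exists>p\<in>pairs n. P p y} \<in> sets (sample_law a b n f)"
  proof (rule sets.sets_Collect_finite_Ex[OF _ finite_pairs])
    fix p assume "p \<in> pairs n"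
    then obtain j k where p: "p = (j, k)" "j + 1 < k" "k \<le> n + 1" by (auto simp: pairs_def)
    then have jk: "j < k" "j \<le> n + 1" "k \<le> n + 1" by auto
    have *: "(\<lambda>y. T_loc j k (ordered_vector a b n y)) \<in> borel_measurable (sample_law a b n f)"
      "(\<lambda>y. ordered_vector a b n y j) \<in> borel_measurable (sample_law a b n f)"
      "(\<lambda>y. ordered_vector a b n y k) \<in> borel_measurable (sample_law a b n f)"
      unfolding measurable_cong_sets[OF sets_sample_law refl]
      by (rule measurable_T_loc[OF jk(1,3)] measurable_ordered_vector_component[OF jk(2)] measurable_ordered_vector_component[OF jk(3)])+
    have "{y \<in> space N. c < T y \<and> (Z y \<le> Y y \<or> (l \<le> Y y \<and> Z y \<le> r))} \<in> sets N"
      if "T \<in> borel_measurable N" "Y \<in> borel_measurable N" "Z \<in> borel_measurable N"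
      for N :: "(nat \<Rightarrow> real) measure" and T Y Z :: "(nat \<Rightarrow> real) \<Rightarrow> real" and c
    proof -
      have "{y \<in> space N. c < T y} \<in> sets N" "{y \<in> space N. Z y \<le> Y y} \<in> sets N"
        "{y \<in> space N. l \<le> Y y} \<in> sets N" "{y \<in> space N. Z y \<le> r} \<in> sets N"
        by (rule borel_measurable_less borel_measurable_le, (rule that borel_measurable_const)+)+
      then show ?thesis by (intro sets.sets_Collect_conj sets.sets_Collect_disj)
    qed
    from this[OF *] show "{y \<in> space (sample_law a b n f). P p y} \<in> sets (sample_law a b n f)"
      unfolding P_def p Let_def fst_conv snd_conv .
  qed
  then show ?thesis unfolding eq .
qed

text \<open>
  For functions that are bounded by \<open>1\<close> and vanish outside a set of mass \<open>p\<close>, the standard deviation of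
  the sum is at most \<open>sqrt (m p)\<close>.
\<close>

lemma Chebyshev_sample:
  fixes g :: "real \<Rightarrow> real"
  assumes f: "f \<in> densities a' b'" and g: "g \<in> borel_measurable borel" and gI: "\<And>x. \<bar>g x\<bar> \<le> indicator I x" and I: "I \<in> sets borel"
    and p: "mass f I = p" "0 < p" and m: "m = sample_size a b n" "0 < m" and t: "0 < t"
  shows "measure (sample_law a b n f) {y \<in> space (sample_law a b n f).
     t * sqrt (real m * p) \<le> \<bar>(\<Sum>i<m. g (y i)) - real m * (LINT x|law f. g x)\<bar>} \<le> 1 / t\<^sup>2"
    "{y \<in> space (sample_law a b n f).
     t * sqrt (real m * p) \<le> \<bar>(\<Sum>i<m. g (y i)) - real m * (LINT x|law f. g x)\<bar>} \<in> sets (sample_law a b n f)"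
proof -
  interpret lf: prob_space "law f" by (rule prob_space_law[OF f])
  have gm: "g \<in> borel_measurable (law f)" using g by simp
  have sq: "(g x)\<^sup>2 \<le> indicator I x" for x
  proof -
    have "(g x)\<^sup>2 \<le> (indicator I x)\<^sup>2" using gI[of x] by (rule abs_le_square_iff[THEN iffD1, OF order.trans]) simp
    then show ?thesis by (auto simp: indicator_def split: if_splits)
  qed
  have int: "integrable (law f) (\<lambda>x. (g x)\<^sup>2)"
  proof (rule lf.integrable_const_bound[of _ 1])
    show "AE x in law f. norm ((g x)\<^sup>2) \<le> 1"
    proof (rule AE_I2)
      fix x show "norm ((g x)\<^sup>2) \<le> 1" using order_trans[OF sq[of x] indicator_le_1] by simp
    qed
  qed (use gm in measurable)
  have "lf.expectation (\<lambda>x. (g x)\<^sup>2) \<le> lf.expectation (indicator I)"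
  proof (rule integral_mono[OF int])
    show "integrable (law f) (indicator I :: real \<Rightarrow> real)"
      by (rule lf.integrable_const_bound[of _ 1]) (use I in \<open>auto simp: indicator_def\<close>)
  qed (rule sq)
  also have "\<dots> = p" using measure_law[OF f I] I p by simp
  finally have E: "lf.expectation (\<lambda>x. (g x)\<^sup>2) \<le> p" .
  have tR: "0 < t * sqrt (real m * p)" using t m p by simp
  have "measure (sample_law a b n f) {y \<in> space (sample_law a b n f).
     t * sqrt (real m * p) \<le> \<bar>(\<Sum>i<m. g (y i)) - real m * (LINT x|law f. g x)\<bar>} \<le> real m * lf.expectation (\<lambda>x. (g x)\<^sup>2) / (t * sqrt (real m * p))\<^sup>2"
    unfolding sample_law_eq m(1)[symmetric] by (rule lf.Chebyshev_iid_sum[OF gm int tR])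
  also have "\<dots> \<le> real m * p / (t * sqrt (real m * p))\<^sup>2" using E by (intro divide_right_mono mult_left_mono) auto
  also have "\<dots> = 1 / t\<^sup>2" using m p t by (simp add: power_mult_distrib)
  finally show "measure (sample_law a b n f) {y \<in> space (sample_law a b n f).
     t * sqrt (real m * p) \<le> \<bar>(\<Sum>i<m. g (y i)) - real m * (LINT x|law f. g x)\<bar>} \<le> 1 / t\<^sup>2" .
  show "{y \<in> space (sample_law a b n f).
     t * sqrt (real m * p) \<le> \<bar>(\<Sum>i<m. g (y i)) - real m * (LINT x|law f. g x)\<bar>} \<in> sets (sample_law a b n f)"
    unfolding sample_law_eq m(1)[symmetric] using gm by measurable
qed

context steep_density
begin

text \<open>
  Deterministic part of the detection bound: on the event that both sums deviate little and that both end
  gaps are occupied, the extreme observations in the interval yield a significant pair.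
\<close>

lemma detection_pointwise:
  fixes y n
  defines "m \<equiv> sample_size a b n" and "M \<equiv> real (sample_size a b n) * \<delta>" and "h \<equiv> \<sigma> * w\<^sup>2 / \<delta>"
    and "R \<equiv> sqrt (real (sample_size a b n) * \<delta>)"
  assumes ab: "a < b" and \<delta>: "0 < \<delta>" and m0: "0 < m" and t: "1 \<le> t" and Mh: "32 * t \<le> M * h" and R: "33 * t \<le> R"
    and crit: "\<And>A j k. \<bar>A - M\<bar> \<le> t * R \<Longrightarrow> real k - real j = A - 1 \<Longrightarrow> (A - 1) / (real n + 1) \<le> 1 \<Longrightarrow>
      crit n \<alpha> j k < M * h / 6 - 10 * t * R"
    and u: "u \<le> r" "mass f {l<..<u} = t / real m" "\<exists>i<m. y i \<in> {l<..<u}"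
    and v: "l \<le> v" "mass f {v<..<r} = t / real m" "\<exists>i<m. y i \<in> {v<..<r}"
    and A: "\<bar>(\<Sum>i<m. indicator {l<..<r} (y i)) - M\<bar> \<le> t * R"
    and S: "\<bar>(\<Sum>i<m. indicator {l<..<r} (y i) * (2 * \<psi> (y i) - 1))
        - real m * (LINT x|law f. indicator {l<..<r} x * (2 * \<psi> x - 1))\<bar> \<le> t * R"
    and dist: "distinct (points a b n y)"
  shows "\<exists>J \<in> D_plus n \<alpha> (ordered_vector a b n y). J \<subseteq> {l<..<r}"
proof -
  define X where "X = ordered_vector a b n y"
  define A where "A = (\<Sum>i<m. indicator {l<..<r} (y i) :: real)"
  define S where "S = (\<Sum>i<m. indicator {l<..<r} (y i) * (2 * \<psi> (y i) - 1))"
  define \<mu> where "\<mu> = (LINT x|law f. indicator {l<..<r} x * (2 * \<psi> x - 1))"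
  have R2: "M = R\<^sup>2" using \<delta> by (simp add: M_def R_def)
  have Mm: "M = real m * \<delta>" by (simp add: M_def m_def)
  have R1: "1 \<le> R" using R t by simp
  have AM: "\<bar>A - M\<bar> \<le> t * R" using A by (simp add: A_def)
  have A3: "3 \<le> A"
  proof -
    have "t * R \<le> R / 33 * R" using R R1 by (intro mult_right_mono) auto
    moreover have "33 * 33 \<le> R * R" using R t by (intro mult_mono) auto
    ultimately show ?thesis using AM R2 unfolding power2_eq_square by (simp add: abs_le_iff)
  qed
  obtain j k where jk: "j + 1 < k" "k \<le> n + 1" "l < X j" "X j < u" "v < X k" "X k < r" "real k - real j = A - 1"
    and T: "(1 - \<psi> (X j) - (1 - \<psi> (X k))) * T_loc j k X = S - A * (\<psi> (X j) - (1 - \<psi> (X k)))"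
    using observed_range[OF ab dist u(1) u(3)[unfolded m_def] v(1) v(3)[unfolded m_def] A3[unfolded A_def m_def]]
    unfolding X_def A_def S_def m_def by blast
  define s s' where "s = \<psi> (X j)" and "s' = 1 - \<psi> (X k)"
  have lX: "l < X k" "X j < r" using jk v u by auto
  have s0: "0 \<le> s" "0 \<le> s'" using \<psi>_01[of "X j"] \<psi>_01[of "X k"] jk lX by (auto simp: s_def s'_def)
  have h0: "0 \<le> h" unfolding h_def using \<sigma> \<delta> by simp
  have h2: "h \<le> 2" using mass_lower[of l r] lr mass \<delta> by (simp add: h_def w_def field_simps)
  have ml: "mass f {l<..<X j} \<le> t / real m" unfolding u(2)[symmetric]
    by (rule mass_mono[OF f]) (use jk in auto)
  have mr: "mass f {X k<..<r} \<le> t / real m" unfolding v(2)[symmetric]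
    by (rule mass_mono[OF f]) (use jk in auto)
  have gap: "M * h * (d / w)\<^sup>2 \<le> 2 * t" if "\<sigma> * d\<^sup>2 / 2 \<le> t / real m" for d
  proof -
    have "M * h * (d / w)\<^sup>2 = real m * (\<sigma> * d\<^sup>2)" using w \<delta> by (simp add: Mm h_def power_divide)
    moreover have "real m * (\<sigma> * d\<^sup>2 / 2) \<le> real m * (t / real m)" using that by (intro mult_left_mono) auto
    ultimately show ?thesis using m0 by simp
  qed
  have "s = (X j - l) / w" by (simp add: s_def \<psi>_def)
  moreover have "\<sigma> * (X j - l)\<^sup>2 / 2 \<le> t / real m"
    by (rule order_trans[OF mass_lower ml]) (use jk lX in auto)
  ultimately have s2: "M * h * s\<^sup>2 \<le> 2 * t" using gap by simp
  have "s' = (r - X k) / w" using w by (simp add: s'_def \<psi>_def w_def field_simps)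
  moreover have "\<sigma> * (r - X k)\<^sup>2 / 2 \<le> t / real m"
    by (rule order_trans[OF mass_lower mr]) (use jk lX in auto)
  ultimately have s2': "M * h * s'\<^sup>2 \<le> 2 * t" using gap by simp
  have z: "s + s' \<le> 1 / 2" using small_gaps(1)[OF _ R2 t h0 h2 Mh s0(1) s2 s0(2) s2'] R1 by simp
  have "l + s * w = X j" using w by (simp add: s_def \<psi>_def)
  then have "\<sigma> * w\<^sup>2 * (1 - s - s') ^ 3 / 6 - 2 * (t / real m) \<le> \<mu> - (s - s') * \<delta>"
    using score_moment[OF s0, folded \<mu>_def] z ml by simp
  then have "real m * (\<sigma> * w\<^sup>2 * (1 - s - s') ^ 3 / 6 - 2 * (t / real m)) \<le> real m * (\<mu> - (s - s') * \<delta>)"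
    by (rule mult_left_mono) simp
  moreover have "M * h * (1 - s - s') ^ 3 / 6 - 2 * t = real m * (\<sigma> * w\<^sup>2 * (1 - s - s') ^ 3 / 6 - 2 * (t / real m))"
    using m0 \<delta> by (simp add: Mm h_def right_diff_distrib)
  moreover have "real m * (\<mu> - (s - s') * \<delta>) = real m * \<mu> - (s - s') * M" by (simp add: Mm right_diff_distrib mult_ac)
  moreover have "real m * \<mu> - S \<le> t * R" using S unfolding S_def \<mu>_def by (simp add: abs_le_iff)
  ultimately have "M * h * (1 - s - s') ^ 3 / 6 + (s - s') * M - 2 * t - t * R \<le> S" by linarith
  from local_statistic_lower[OF R1 R2 t h0 h2 Mh s0(1) s2 s0(2) s2' AM this T[folded s_def s'_def]]
  have "M * h / 6 - 10 * t * R \<le> T_loc j k X" .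
  moreover have "crit n \<alpha> j k < M * h / 6 - 10 * t * R"
  proof (rule crit[OF AM jk(7)])
    have "A - 1 \<le> real n + 1" using jk(2) unfolding jk(7)[symmetric] by simp
    then show "(A - 1) / (real n + 1) \<le> 1" by simp
  qed
  ultimately have "crit n \<alpha> j k < T_loc j k X" by (rule less_le_trans[rotated])
  then have "{X j<..<X k} \<in> D_plus n \<alpha> X" unfolding D_plus_def using jk(1,2) by blast
  moreover have "{X j<..<X k} \<subseteq> {l<..<r}" using jk by auto
  ultimately show ?thesis unfolding X_def by blast
qed

text \<open>
  Four exceptional events are excluded: deviations of the two sums by Chebyshev's inequality, with
  probability at most \<open>1 / t\<^sup>2\<close> each, and empty end gaps of mass \<open>t / m\<close>, with probability at most
  \<open>exp (- t)\<close> each.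
\<close>

lemma detection_bound:
  fixes n
  defines "m \<equiv> sample_size a b n" and "M \<equiv> real (sample_size a b n) * \<delta>" and "h \<equiv> \<sigma> * w\<^sup>2 / \<delta>"
    and "R \<equiv> sqrt (real (sample_size a b n) * \<delta>)"
  assumes ab: "a < b" and \<delta>: "0 < \<delta>" and m0: "0 < m" and t: "1 \<le> t" and Mh: "32 * t \<le> M * h" and R: "33 * t \<le> R"
    and crit: "\<And>A j k. \<bar>A - M\<bar> \<le> t * R \<Longrightarrow> real k - real j = A - 1 \<Longrightarrow> (A - 1) / (real n + 1) \<le> 1 \<Longrightarrow>
      crit n \<alpha> j k < M * h / 6 - 10 * t * R"
  shows "1 - (2 * exp (- t) + 2 / t\<^sup>2) \<le> measure (sample_law a b n f)
    {y \<in> space (sample_law a b n f). \<exists>J \<in> D_plus n \<alpha> (ordered_vector a b n y). J \<subseteq> {l<..<r}}"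
proof -
  define P where "P = sample_law a b n f"
  interpret P: prob_space P unfolding P_def by (rule prob_space_sample_law[OF f])
  define G where "G = {y \<in> space P. \<exists>J \<in> D_plus n \<alpha> (ordered_vector a b n y). J \<subseteq> {l<..<r}}"
  have G: "G \<in> P.events" unfolding G_def P_def by (rule sets_detection_event)
  have R2: "M = R\<^sup>2" using \<delta> by (simp add: M_def R_def)
  have "t * 1 \<le> R * R" using R t by (intro mult_mono) auto
  then have p: "0 < t / real m" "t / real m \<le> mass f {l<..<r}"
    unfolding mass using t m0 R2 by (simp_all add: M_def m_def power2_eq_square field_simps)
  obtain u where u: "l < u" "u \<le> r" "mass f {l<..<u} = t / real m" using exists_left_quantile[OF f lr p] .
  obtain v where v: "l \<le> v" "v < r" "mass f {v<..<r} = t / real m" using exists_right_quantile[OF f lr p] .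
  define g1 where "g1 x = (indicator {l<..<r} x :: real)" for x
  define g2 where "g2 x = indicator {l<..<r} x * (2 * \<psi> x - 1)" for x
  have \<psi>m: "\<psi> \<in> borel_measurable borel" unfolding \<psi>_def[abs_def] by measurable
  have g1: "g1 \<in> borel_measurable borel" unfolding g1_def[abs_def] by measurable
  have g2: "g2 \<in> borel_measurable borel" unfolding g2_def[abs_def] using \<psi>m by measurable
  have b1: "\<bar>g1 x\<bar> \<le> indicator {l<..<r} x" for x by (simp add: g1_def)
  have b2: "\<bar>g2 x\<bar> \<le> indicator {l<..<r} x" for x
    using \<psi>_01[of x] by (cases "x \<in> {l<..<r}") (auto simp: g2_def abs_le_iff)
  have E1: "(LINT x|law f. g1 x) = \<delta>" unfolding g1_def using measure_law[OF f, of "{l<..<r}"] mass by simp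
  (* B1, B2: deviations of count and score sum; B3, B4: empty end gaps *)
  define B1 where "B1 = {y \<in> space P. t * sqrt (real m * \<delta>) \<le> \<bar>(\<Sum>i<m. g1 (y i)) - real m * (LINT x|law f. g1 x)\<bar>}"
  define B2 where "B2 = {y \<in> space P. t * sqrt (real m * \<delta>) \<le> \<bar>(\<Sum>i<m. g2 (y i)) - real m * (LINT x|law f. g2 x)\<bar>}"
  define B3 where "B3 = {y \<in> space P. \<forall>i<m. y i \<notin> {l<..<u}}"
  define B4 where "B4 = {y \<in> space P. \<forall>i<m. y i \<notin> {v<..<r}}"
  have t0: "0 < t" using t by simp
  have I: "{l<..<r} \<in> sets borel" "{l<..<u} \<in> sets borel" "{v<..<r} \<in> sets borel" by simp_all
  have m: "m = sample_size a b n" by (rule m_def[THEN meta_eq_to_obj_eq])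
  have B1: "P.prob B1 \<le> 1 / t\<^sup>2" "B1 \<in> P.events"
    unfolding B1_def P_def by (rule Chebyshev_sample[OF f g1 b1 I(1) mass \<delta> m m0 t0])+
  have B2: "P.prob B2 \<le> 1 / t\<^sup>2" "B2 \<in> P.events"
    unfolding B2_def P_def by (rule Chebyshev_sample[OF f g2 b2 I(1) mass \<delta> m m0 t0])+
  have expm: "- real m * (t / real m) = - t" using m0 by simp
  have B3: "P.prob B3 \<le> exp (- t)" "B3 \<in> P.events"
    unfolding B3_def P_def by (rule prob_no_point_in[OF f I(2) u(3) m, unfolded expm])+
  have B4: "P.prob B4 \<le> exp (- t)" "B4 \<in> P.events"
    unfolding B4_def P_def by (rule prob_no_point_in[OF f I(3) v(3) m, unfolded expm])+
  note B = B1(2) B2(2) B3(2) B4(2)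
  have "AE y in P. y \<in> space P - (B1 \<union> B2 \<union> (B3 \<union> B4)) \<longrightarrow> y \<in> G"
    using AE_distinct_points[OF f ab, of n, folded P_def]
  proof eventually_elim
    case (elim y)
    show ?case
    proof
      assume y: "y \<in> space P - (B1 \<union> B2 \<union> (B3 \<union> B4))"
      then have sp: "y \<in> space P" and good: "y \<notin> B1" "y \<notin> B2" "y \<notin> B3" "y \<notin> B4" by blast+
      have n1: "\<not> t * sqrt (real m * \<delta>) \<le> \<bar>(\<Sum>i<m. g1 (y i)) - real m * \<delta>\<bar>"
        using good(1) sp unfolding B1_def E1 by blast
      have n2: "\<not> t * sqrt (real m * \<delta>) \<le> \<bar>(\<Sum>i<m. g2 (y i)) - real m * (LINT x|law f. g2 x)\<bar>"
        using good(2) sp unfolding B2_def by blast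
      have "\<exists>J \<in> D_plus n \<alpha> (ordered_vector a b n y). J \<subseteq> {l<..<r}"
      proof (rule detection_pointwise[OF ab \<delta> m0[unfolded m_def] t Mh[unfolded M_def h_def] R[unfolded R_def] _
            u(2) u(3)[unfolded m_def] _ v(1) v(3)[unfolded m_def] _ _ _ elim])
        show "\<exists>i<sample_size a b n. y i \<in> {l<..<u}" using good(3) sp unfolding B3_def m_def by blast
        show "\<exists>i<sample_size a b n. y i \<in> {v<..<r}" using good(4) sp unfolding B4_def m_def by blast
        show "\<bar>(\<Sum>i<sample_size a b n. indicator {l<..<r} (y i)) - real (sample_size a b n) * \<delta>\<bar> \<le> t * sqrt (real (sample_size a b n) * \<delta>)"
          using n1 unfolding g1_def m_def not_le by (rule less_imp_le)
        show "\<bar>(\<Sum>i<sample_size a b n. indicator {l<..<r} (y i) * (2 * \<psi> (y i) - 1))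
          - real (sample_size a b n) * (LINT x|law f. indicator {l<..<r} x * (2 * \<psi> x - 1))\<bar> \<le> t * sqrt (real (sample_size a b n) * \<delta>)"
          using n2 unfolding g2_def m_def not_le by (rule less_imp_le)
        show "crit n \<alpha> j k < real (sample_size a b n) * \<delta> * (\<sigma> * w\<^sup>2 / \<delta>) / 6 - 10 * t * sqrt (real (sample_size a b n) * \<delta>)"
          if "\<bar>A - real (sample_size a b n) * \<delta>\<bar> \<le> t * sqrt (real (sample_size a b n) * \<delta>)"
            "real k - real j = A - 1" "(A - 1) / (real n + 1) \<le> 1" for A j k
          by (rule crit[unfolded M_def R_def h_def, OF that])
      qed
      then show "y \<in> G" using sp unfolding G_def by blast
    qed
  qed
  then have "P.prob (space P - (B1 \<union> B2 \<union> (B3 \<union> B4))) \<le> P.prob G"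
    by (rule P.finite_measure_mono_AE[OF _ G])
  moreover have "P.prob (space P - (B1 \<union> B2 \<union> (B3 \<union> B4))) = 1 - P.prob (B1 \<union> B2 \<union> (B3 \<union> B4))"
    by (rule P.prob_compl) ((rule sets.Un | rule B)+)
  moreover have "P.prob (B1 \<union> B2 \<union> (B3 \<union> B4)) \<le> (P.prob B1 + P.prob B2) + (P.prob B3 + P.prob B4)"
    using measure_Un_le[OF sets.Un[OF B(1,2)] sets.Un[OF B(3,4)]] measure_Un_le[OF B(1,2)] measure_Un_le[OF B(3,4)] by linarith
  ultimately have "1 - (2 * exp (- t) + 2 * (1 / t\<^sup>2)) \<le> P.prob G" using B1(1) B2(1) B3(1) B4(1) by linarith
  then show ?thesis unfolding G_def P_def times_divide_eq_right mult_1_right .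
qed

end

text \<open>
  The class only bounds \<open>h\<close> from below, but \<open>h \<le> 2\<close> holds for every density that is steep on an interval;
  therefore \<open>C sqrt (log (e/\<delta>))\<close> is at most \<open>2 sqrt (n \<delta>)\<close>, and a large signal implies a large expected number of
  observations.
\<close>

lemma detection_probability:
  fixes f :: "real \<Rightarrow> real"
  assumes f: "f \<in> F_class a b {l<..<r} \<delta> (C * sqrt (ln (exp 1 / \<delta>) / real n))" and lr: "l < r" and ab: "a < b"
    and \<delta>: "0 < \<delta>" "\<delta> \<le> 1" and n: "1 \<le> n" and C: "sqrt 24 < C" and t: "1 \<le> t" and K: "0 \<le> K" "kappa n \<alpha> \<le> K"
    and big: "6 * (11 * t + (1 + t) * (4 + K)) + 1 \<le> (C - sqrt 24) * sqrt (ln (exp 1 / \<delta>))"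
  shows "1 - (2 * exp (- t) + 2 / t\<^sup>2) \<le> measure (sample_law a b n f)
    {y \<in> space (sample_law a b n f). \<exists>J \<in> D_plus n \<alpha> (ordered_vector a b n y). J \<subseteq> {l<..<r}}"
proof -
  define \<Lambda> \<eta> where "\<Lambda> = ln (exp 1 / \<delta>)" and "\<eta> = C * sqrt (\<Lambda> / real n)"
  define \<sigma> where "\<sigma> = \<eta> * sqrt \<delta> / (r - l)\<^sup>2"
  define m where "m = sample_size a b n"
  define R where "R = sqrt (real m * \<delta>)"
  have \<Lambda>1: "1 \<le> \<Lambda>" unfolding \<Lambda>_def using \<delta> by (simp add: ln_div)
  have "0 < sqrt (24::real)" by simp
  then have C0: "0 < C" using C by linarith
  have \<eta>0: "0 < \<eta>" unfolding \<eta>_def using C0 \<Lambda>1 n by simp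
  have mn: "n \<le> m" unfolding m_def by (rule sample_size_bounds)
  interpret steep_density a b f l r \<sigma> \<delta>
  proof
    show "f \<in> densities a b" "mass f {l<..<r} = \<delta>" using f by (auto simp: F_class_def)
    show "0 < \<sigma>" unfolding \<sigma>_def using \<eta>0 \<delta> lr by simp
    fix x y assume "l < x" "x < y" "y < r"
    then show "\<sigma> * (y - x) \<le> f y - f x"
      unfolding \<sigma>_def \<eta>_def \<Lambda>_def by (rule F_class_slope[OF f lr \<delta>(1)])
  qed (rule lr)
  have h: "\<sigma> * w\<^sup>2 / \<delta> = \<eta> / sqrt \<delta>"
  proof -
    have "\<sigma> * w\<^sup>2 = \<eta> * sqrt \<delta>" using lr by (simp add: \<sigma>_def w_def)
    then have "\<sigma> * w\<^sup>2 / \<delta> = \<eta> * (sqrt \<delta> / \<delta>)" by simp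
    also have "\<dots> = \<eta> * inverse (sqrt \<delta>)" using \<delta> by (simp only: sqrt_divide_self_eq less_imp_le)
    finally show ?thesis by (simp only: divide_inverse)
  qed
  have h2: "\<sigma> * w\<^sup>2 / \<delta> \<le> 2" using mass_lower[of l r] lr mass \<delta> by (simp add: w_def field_simps)
  have eC: "\<eta> / sqrt \<delta> = C * sqrt \<Lambda> / sqrt (real n * \<delta>)" by (simp add: \<eta>_def real_sqrt_divide real_sqrt_mult)
  have nm: "sqrt (real n * \<delta>) \<le> R" unfolding R_def using mn \<delta> by (simp add: mult_right_mono)
  have R0: "0 \<le> R" unfolding R_def using \<delta> by simp
  have n\<delta>: "0 < sqrt (real n * \<delta>)" using n \<delta> by simp
  have CR: "C * sqrt \<Lambda> \<le> 2 * R"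
  proof -
    have "C * sqrt \<Lambda> \<le> 2 * sqrt (real n * \<delta>)" using h2 n\<delta> unfolding h eC by (simp add: pos_divide_le_eq)
    then show ?thesis using nm by simp
  qed
  have MR: "real m * \<delta> = R\<^sup>2" unfolding R_def using \<delta> by simp
  have Mh: "R * (C * sqrt \<Lambda>) \<le> real m * \<delta> * (\<sigma> * w\<^sup>2 / \<delta>)"
  proof -
    have "R * sqrt (real n * \<delta>) \<le> R * R" using nm R0 by (rule mult_left_mono)
    then have "C * sqrt \<Lambda> * (R * sqrt (real n * \<delta>)) \<le> C * sqrt \<Lambda> * (R * R)"
      by (rule mult_left_mono) (use C0 \<Lambda>1 in simp)
    then show ?thesis unfolding h eC MR using n\<delta> by (simp add: pos_le_divide_eq power2_eq_square mult_ac)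
  qed
  have C66: "66 * t \<le> C * sqrt \<Lambda>" and R33: "33 * t \<le> R"
    using large_sample[OF t \<Lambda>1 CR K(1) big[folded \<Lambda>_def]] by auto
  show ?thesis
  proof (rule detection_bound)
    have "1 * (66 * t) \<le> R * (C * sqrt \<Lambda>)" by (rule mult_mono) (use C66 R33 t in auto)
    then show "32 * t \<le> real (sample_size a b n) * \<delta> * (\<sigma> * w\<^sup>2 / \<delta>)" using Mh t unfolding m_def by linarith
    fix A :: real and j k :: nat
    assume A: "\<bar>A - real (sample_size a b n) * \<delta>\<bar> \<le> t * sqrt (real (sample_size a b n) * \<delta>)"
      and jk: "real k - real j = A - 1" "(A - 1) / (real n + 1) \<le> 1"
    have "crit n \<alpha> j k < R * (C * sqrt \<Lambda>) / 6 - 10 * t * R"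
      by (rule local_critical_value[OF n mn \<delta> R_def t \<Lambda>_def C CR K big[folded \<Lambda>_def] _ jk])
        (use A R0 in \<open>simp add: m_def[symmetric] R_def[symmetric] MR\<close>)
    also have "\<dots> \<le> real m * \<delta> * (\<sigma> * w\<^sup>2 / \<delta>) / 6 - 10 * t * R" using Mh by simp
    finally show "crit n \<alpha> j k < real (sample_size a b n) * \<delta> * (\<sigma> * w\<^sup>2 / \<delta>) / 6 - 10 * t * sqrt (real (sample_size a b n) * \<delta>)"
      by (simp add: m_def R_def)
  qed (use ab \<delta> t R33 n mn in \<open>simp_all add: m_def R_def\<close>)
qed

text \<open>
  For every fixed \<open>t\<close> the detection bound applies eventually, because \<open>kappa n \<alpha>\<close> is bounded and the
  signal diverges.
\<close>

theorem detection_consistency: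
  fixes a b :: ereal and \<delta> C :: "nat \<Rightarrow> real" and I :: "nat \<Rightarrow> real set" and f :: "nat \<Rightarrow> real \<Rightarrow> real"
  assumes ab: "a < b" and \<delta>: "\<And>n. n \<ge> 1 \<Longrightarrow> 0 < \<delta> n \<and> \<delta> n \<le> 1" and C: "\<And>n. n \<ge> 1 \<Longrightarrow> sqrt 24 < C n"
    and \<alpha>: "0 < \<alpha>" "\<alpha> < 1"
    and f: "\<And>n. n \<ge> 1 \<Longrightarrow> I n \<in> bounded_open_intervals \<and>
        f n \<in> F_class a b (I n) (\<delta> n) (C n * sqrt (ln (exp 1 / \<delta> n) / real n))"
    and lim: "filterlim (\<lambda>n. (C n - sqrt 24) * sqrt (ln (exp 1 / \<delta> n))) at_top sequentially"
  shows "(\<lambda>n. measure (sample_law a b n (f n))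
     {y \<in> space (sample_law a b n (f n)). \<exists>J \<in> D_plus n \<alpha> (ordered_vector a b n y). J \<subseteq> I n}) \<longlonglongrightarrow> 1"
    (is "?p \<longlonglongrightarrow> 1")
proof (rule order_tendstoI)
  fix c :: real assume c: "1 < c"
  have "?p n < c" if n: "n \<ge> 1" for n
  proof -
    interpret prob_space "sample_law a b n (f n)"
      by (rule prob_space_sample_law) (use f[OF n] in \<open>auto simp: F_class_def\<close>)
    show ?thesis using prob_le_1 c by (rule le_less_trans)
  qed
  then show "\<forall>\<^sub>F n in sequentially. ?p n < c" using eventually_ge_at_top[of 1] by (rule eventually_mono[rotated])
next
  fix c :: real assume c: "c < 1"
  obtain K0 where K0: "\<forall>\<^sub>F n in sequentially. kappa n \<alpha> \<le> K0" using kappa_bounded[OF \<alpha>] by blast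
  define K where "K = max 0 K0"
  have "((\<lambda>t::real. 2 * exp (- t) + 2 / t\<^sup>2) \<longlongrightarrow> 0) at_top" by real_asymp
  then have "\<forall>\<^sub>F t::real in at_top. 2 * exp (- t) + 2 / t\<^sup>2 < 1 - c" by (rule order_tendstoD) (use c in simp)
  then have "\<forall>\<^sub>F t::real in at_top. 1 \<le> t \<and> 2 * exp (- t) + 2 / t\<^sup>2 < 1 - c"
    using eventually_ge_at_top[of 1] by eventually_elim simp
  then obtain t :: real where t: "1 \<le> t" "2 * exp (- t) + 2 / t\<^sup>2 < 1 - c"
    using eventually_happens by fastforce
  have "\<forall>\<^sub>F n in sequentially. 6 * (11 * t + (1 + t) * (4 + K)) + 1 \<le> (C n - sqrt 24) * sqrt (ln (exp 1 / \<delta> n))"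
    using lim unfolding filterlim_at_top by blast
  with K0 eventually_ge_at_top[of 1] show "\<forall>\<^sub>F n in sequentially. c < ?p n"
  proof eventually_elim
    case (elim n)
    obtain l r where lr: "I n = {l<..<r}" "l < r" using f[OF elim(2)] by (auto simp: bounded_open_intervals_def)
    have "1 - (2 * exp (- t) + 2 / t\<^sup>2) \<le> ?p n"
      unfolding lr(1)
    proof (rule detection_probability[OF _ lr(2) ab])
      show "f n \<in> F_class a b {l<..<r} (\<delta> n) (C n * sqrt (ln (exp 1 / \<delta> n) / real n))" using f[OF elim(2)] lr by simp
      show "0 \<le> K" "kappa n \<alpha> \<le> K" using elim(1) by (auto simp: K_def)
    qed (use \<delta>[OF elim(2)] C[OF elim(2)] elim t in simp_all)
    then show ?case using t by linarith
  qed
qed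

section \<open>Consistency and optimality\<close>

theorem theorem4p1:
  fixes a b :: ereal and \<delta> c C :: "nat \<Rightarrow> real" and \<alpha> :: real
  assumes "a < b"
    and "\<And>n. n \<ge> 1 \<Longrightarrow> 0 < \<delta> n \<and> \<delta> n \<le> 1"
    and "\<And>n. n \<ge> 1 \<Longrightarrow> 0 < c n \<and> c n < sqrt 24 \<and> sqrt 24 < C n"
    and "0 < \<alpha>" and "\<alpha> < 1"
  shows
    "(\<forall>(I :: nat \<Rightarrow> real set) (f :: nat \<Rightarrow> real \<Rightarrow> real).
        (\<forall>n\<ge>1. I n \<in> bounded_open_intervals \<and>
           f n \<in> F_class a b (I n) (\<delta> n) (C n * sqrt (ln (exp 1 / \<delta> n) / real n))) \<longrightarrow>
        filterlim (\<lambda>n. (C n - sqrt 24) * sqrt (ln (exp 1 / \<delta> n))) at_top sequentially \<longrightarrow>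
        (\<lambda>n. measure (sample_law a b n (f n))
           {y \<in> space (sample_law a b n (f n)).
              \<exists>J \<in> D_plus n \<alpha> (ordered_vector a b n y). J \<subseteq> I n}) \<longlonglongrightarrow> 1)
     \<and>
     (\<forall>\<phi> :: nat \<Rightarrow> (nat \<Rightarrow> real) \<Rightarrow> real.
        (\<forall>n\<ge>1. level_test a b n \<alpha> (nonincreasing_densities a b) (\<phi> n)) \<longrightarrow>
        (\<forall>n\<ge>1. (ln (real n))\<^sup>2 / real n \<le> \<delta> n) \<longrightarrow>
        \<delta> \<longlonglongrightarrow> 0 \<longrightarrow>
        filterlim (\<lambda>n. (sqrt 24 - c n) * sqrt (ln (exp 1 / \<delta> n))) at_top sequentially \<longrightarrow>
        (\<exists>r :: nat \<Rightarrow> real. r \<longlonglongrightarrow> 0 \<and>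
           (\<forall>\<^sub>F n in sequentially.
              min_power a b n (\<phi> n) (F_union a b (\<delta> n) (c n * sqrt (ln (exp 1 / \<delta> n) / real n)))
                \<le> ereal (\<alpha> + r n))))
     \<and>
     (\<forall>(I :: nat \<Rightarrow> real set) (b' :: nat \<Rightarrow> real) (\<phi> :: nat \<Rightarrow> (nat \<Rightarrow> real) \<Rightarrow> real).
        (\<forall>n\<ge>1. I n \<in> bounded_open_intervals \<and>
           0 \<le> b' n \<and> b' n \<le> 2 * sqrt (real n * \<delta> n) \<and>
           level_test a b n \<alpha> (nonincreasing_densities_on a b (I n)) (\<phi> n)) \<longrightarrow>
        (\<lambda>n. min_power a b n (\<phi> n) (F_class a b (I n) (\<delta> n) (b' n / sqrt (real n)))) \<longlonglongrightarrow> 1 \<longrightarrow>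
        filterlim b' at_top sequentially \<and>
        filterlim (\<lambda>n. real n * \<delta> n) at_top sequentially)"
proof (intro conjI allI impI)
  fix I :: "nat \<Rightarrow> real set" and f :: "nat \<Rightarrow> real \<Rightarrow> real"
  assume "\<forall>n\<ge>1. I n \<in> bounded_open_intervals \<and>
      f n \<in> F_class a b (I n) (\<delta> n) (C n * sqrt (ln (exp 1 / \<delta> n) / real n))"
    and "filterlim (\<lambda>n. (C n - sqrt 24) * sqrt (ln (exp 1 / \<delta> n))) at_top sequentially"
  then show "(\<lambda>n. measure (sample_law a b n (f n))
      {y \<in> space (sample_law a b n (f n)). \<exists>J \<in> D_plus n \<alpha> (ordered_vector a b n y). J \<subseteq> I n}) \<longlonglongrightarrow> 1"
    using assms by (intro detection_consistency) auto
next
  fix \<phi> :: "nat \<Rightarrow> (nat \<Rightarrow> real) \<Rightarrow> real"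
  assume "\<forall>n\<ge>1. level_test a b n \<alpha> (nonincreasing_densities a b) (\<phi> n)"
    and "\<forall>n\<ge>1. (ln (real n))\<^sup>2 / real n \<le> \<delta> n"
    and "filterlim (\<lambda>n. (sqrt 24 - c n) * sqrt (ln (exp 1 / \<delta> n))) at_top sequentially"
  then show "\<exists>r :: nat \<Rightarrow> real. r \<longlonglongrightarrow> 0 \<and> (\<forall>\<^sub>F n in sequentially.
      min_power a b n (\<phi> n) (F_union a b (\<delta> n) (c n * sqrt (ln (exp 1 / \<delta> n) / real n))) \<le> ereal (\<alpha> + r n))"
    using assms(3) by (intro optimality[OF assms(1,2) _ assms(4)]) auto
next
  fix I :: "nat \<Rightarrow> real set" and b' :: "nat \<Rightarrow> real" and \<phi> :: "nat \<Rightarrow> (nat \<Rightarrow> real) \<Rightarrow> real"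
  assume H: "\<forall>n\<ge>1. I n \<in> bounded_open_intervals \<and> 0 \<le> b' n \<and> b' n \<le> 2 * sqrt (real n * \<delta> n) \<and>
      level_test a b n \<alpha> (nonincreasing_densities_on a b (I n)) (\<phi> n)"
    and power: "(\<lambda>n. min_power a b n (\<phi> n) (F_class a b (I n) (\<delta> n) (b' n / sqrt (real n)))) \<longlonglongrightarrow> 1"
  have pos: "\<And>n. n \<ge> 1 \<Longrightarrow> 0 < \<delta> n" using assms(2) by blast
  show "filterlim b' at_top sequentially"
    by (rule consistency_necessary(1)[OF assms(1) pos assms(4,5) H power])
  show "filterlim (\<lambda>n. real n * \<delta> n) at_top sequentially"
    by (rule consistency_necessary(2)[OF assms(1) pos assms(4,5) H power])
qed

end
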